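(* Let $P_0=P_0(G,H,\Gamma,W_0)$ be a regular model set in a lcsc group $G$, with punctured hull $X^\times=X^\times_{P_0}$, parameter space $Y=(G\times H)/\Gamma$ with invariant probability measure $m_Y$, and parametrization map $\beta:X^\times\to Y$. There exists a unique $G$-invariant probability measure $\nu$ on $X^\times$. This measure satisfies $\nu(X^{\rm ns})=1$ and is also the unique stationary probability measure on $X^\times$ with respect to any admissible probability measure $\mu$ on $G$. Moreover, $\beta:(X^\times,\nu)\to(Y,m_Y)$ is a measurable isomorphism of $G$-spaces and thus induces an isomorphism $\beta^*:L^2(Y,m_Y)\to L^2(X^\times,\nu)$ of unitary $G$-representations.
   Context: lcsc means locally compact second countable; $m_G$, $m_H$ denote Haar measures. A lattice in a lcsc group $L$ is a discrete subgroup $\Gamma<L$ such that $L/\Gamma$ admits an $L$-invariant probability measure. A cut-and-project scheme is a triple $(G,H,\Gamma)$ with $G,H$ lcsc groups and $\Gamma<G\times H$ a lattice such that the coordinate projection $\pi_G$ is injective on $\Gamma$ and $\pi_H(\Gamma)$ is dense in $H$. Put $\Gamma_G=\pi_G(\Gamma)$ and $\tau := \pi_H\circ(\pi_G|_\Gamma)^{-1}:\Gamma_G\to H$. A compact set $W\subset H$ is $\Gamma$-regular if $\partial W\cap\pi_H(\Gamma)=\emptyset$. A regular model set in $G$ is a set $P_0=P_0(G,H,\Gamma,W_0):=\tau^{-1}(W_0)$, where $W_0\subset H$ is compact with non-empty interior, is Jordan-measurable ($m_H(\partial W_0)=0$), has dense interior ($W_0$ is the closure of its interior), has trivial stabilizer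 $\{h\in H : hW_0=W_0\}=\{e\}$, and is $\Gamma$-regular. The Chabauty--Fell topology on the set $\mathcal C(G)$ of closed subsets of $G$ is generated by the sets $\{C : C\cap V\neq\emptyset\}$ ($V$ open) and $\{C : C\cap K=\emptyset\}$ ($K$ compact). $G$ acts on $\mathcal C(G)$ by left translation; $X_{P_0}$ is the closure of $G.P_0$, and $X_{P_0}^\times := X_{P_0}\setminus\{\emptyset\}$. $G$ acts on $Y$ by left multiplication in the first factor. The parametrization map $\beta$ is the unique $G$-equivariant Borel map $X^\times\to Y$ with closed graph and $\beta(P_0)=(e,e)\Gamma$ (such a map exists). Put $Y^{\rm ns}:=\{(g,h)\Gamma\in Y : h^{-1}W_0\text{ is }\Gamma\text{-regular}\}$ and $X^{\rm ns}:=\beta^{-1}(Y^{\rm ns})$. A probability measure $\mu$ on $G$ is admissible if its support generates $G$ and it is absolutely continuous with respect to $m_G$; a probability measure $\nu$ is $\mu$-stationary if $\mu*\nu=\int_G g_*\nu\,d\mu(g)=\nu$. *)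

theory Defs
  imports "HOL-Analysis.Analysis" "HOL-Probability.Probability_Measure" "HOL-Library.Set_Algebras"
begin

text \<open>
  Groups are written additively but are not assumed commutative (type class \<^class>\<open>group_add\<close>).
  So \<open>x + y\<close>, \<open>- x\<close>, \<open>0\<close> stand for $xy$, $x^{-1}$, $e$, and \<open>x +o A\<close> is the left translate $xA$.
\<close>

definition add_subgroup :: "'l::group_add set \<Rightarrow> bool" where
  "add_subgroup S \<longleftrightarrow> 0 \<in> S \<and> (\<forall>x\<in>S. \<forall>y\<in>S. x + y \<in> S) \<and> (\<forall>x\<in>S. - x \<in> S)"

definition borel_of :: "'a topology \<Rightarrow> 'a measure" where
  "borel_of T = sigma (topspace T) {U. openin T U}"

definition prob_measure_on :: "'a topology \<Rightarrow> 'a measure \<Rightarrow> bool" where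
  "prob_measure_on T \<nu> \<longleftrightarrow> prob_space \<nu> \<and> sets \<nu> = sets (borel_of T)"

definition invariant_measure :: "('k \<Rightarrow> 'a \<Rightarrow> 'a) \<Rightarrow> 'a measure \<Rightarrow> bool" where
  "invariant_measure act \<nu> \<longleftrightarrow> (\<forall>k. distr \<nu> \<nu> (act k) = \<nu>)"

text \<open>Left Haar measures. On an lcsc group local finiteness makes a Borel measure Radon.\<close>

definition haar_measure :: "'l::topological_group_add measure \<Rightarrow> bool" where
  "haar_measure m \<longleftrightarrow> sets m = sets borel \<and> invariant_measure (+) m \<and>
     (\<forall>K. compact K \<longrightarrow> emeasure m K < \<infinity>) \<and>
     (\<forall>U. open U \<and> U \<noteq> {} \<longrightarrow> 0 < emeasure m U)"


subsection \<open>Lattices\<close>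

definition coset_space :: "'l::group_add set \<Rightarrow> 'l set set" where
  "coset_space \<Gamma> = range (\<lambda>x. x +o \<Gamma>)"

text \<open>The quotient topology on the set of left cosets.\<close>

definition coset_topology :: "'l::{group_add,topological_space} set \<Rightarrow> 'l set topology" where
  "coset_topology \<Gamma> = topology (\<lambda>U. U \<subseteq> coset_space \<Gamma> \<and> open {x. x +o \<Gamma> \<in> U})"

lemma openin_coset_topology:
  "openin (coset_topology \<Gamma>) U \<longleftrightarrow> U \<subseteq> coset_space \<Gamma> \<and> open {x. x +o \<Gamma> \<in> U}"
proof -
  have "istopology (\<lambda>U. U \<subseteq> coset_space \<Gamma> \<and> open {x. x +o \<Gamma> \<in> U})"
    unfolding istopology_def
  proof (intro conjI allI impI)
    fix S T assume *: "S \<subseteq> coset_space \<Gamma> \<and> open {x. x +o \<Gamma> \<in> S}"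
      "T \<subseteq> coset_space \<Gamma> \<and> open {x. x +o \<Gamma> \<in> T}"
    then show "S \<inter> T \<subseteq> coset_space \<Gamma>" by blast
    have "{x. x +o \<Gamma> \<in> S \<inter> T} = {x. x +o \<Gamma> \<in> S} \<inter> {x. x +o \<Gamma> \<in> T}" by blast
    with * show "open {x. x +o \<Gamma> \<in> S \<inter> T}" by (simp add: open_Int)
  next
    fix \<K> assume *: "\<forall>K\<in>\<K>. K \<subseteq> coset_space \<Gamma> \<and> open {x. x +o \<Gamma> \<in> K}"
    then show "\<Union>\<K> \<subseteq> coset_space \<Gamma>" by blast
    have "{x. x +o \<Gamma> \<in> \<Union>\<K>} = (\<Union>K\<in>\<K>. {x. x +o \<Gamma> \<in> K})" by blast
    with * show "open {x. x +o \<Gamma> \<in> \<Union>\<K>}" by (simp add: open_UN)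
  qed
  then show ?thesis
    unfolding coset_topology_def by (simp add: topology_inverse')
qed

lemma topspace_coset_topology: "topspace (coset_topology \<Gamma>) = coset_space \<Gamma>"
proof (rule equalityI)
  show "topspace (coset_topology \<Gamma>) \<subseteq> coset_space \<Gamma>"
    using openin_topspace[of "coset_topology \<Gamma>"] unfolding openin_coset_topology by blast
  have "{x. x +o \<Gamma> \<in> coset_space \<Gamma>} = UNIV" unfolding coset_space_def by blast
  then have "openin (coset_topology \<Gamma>) (coset_space \<Gamma>)" by (simp add: openin_coset_topology)
  then show "coset_space \<Gamma> \<subseteq> topspace (coset_topology \<Gamma>)" by (rule openin_subset)
qed

definition group_lattice :: "'l::{group_add,topological_space} set \<Rightarrow> bool" where
  "group_lattice \<Gamma> \<longleftrightarrow> add_subgroup \<Gamma> \<and> discrete \<Gamma> \<and>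
     (\<exists>m. prob_measure_on (coset_topology \<Gamma>) m \<and> invariant_measure (+o) m)"


subsection \<open>Model sets\<close>

definition cut_and_project_scheme ::
  "('g::{group_add,topological_space} \<times> 'h::{group_add,topological_space}) set \<Rightarrow> bool" where
  "cut_and_project_scheme \<Gamma> \<longleftrightarrow> group_lattice \<Gamma> \<and> inj_on fst \<Gamma> \<and> closure (snd ` \<Gamma>) = UNIV"

text \<open>The map $\tau = \pi_H \circ (\pi_G|_\Gamma)^{-1}$; only its values on \<open>fst ` \<Gamma>\<close> matter.\<close>

definition star_map :: "('g \<times> 'h) set \<Rightarrow> 'g \<Rightarrow> 'h" where
  "star_map \<Gamma> g = snd (inv_into \<Gamma> fst g)"

definition model_set :: "('g \<times> 'h) set \<Rightarrow> 'h set \<Rightarrow> 'g set" where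
  "model_set \<Gamma> W = {g \<in> fst ` \<Gamma>. star_map \<Gamma> g \<in> W}"

definition lattice_regular :: "('g \<times> 'h::topological_space) set \<Rightarrow> 'h set \<Rightarrow> bool" where
  "lattice_regular \<Gamma> W \<longleftrightarrow> compact W \<and> frontier W \<inter> snd ` \<Gamma> = {}"

definition regular_window ::
  "'h::{group_add,topological_space} measure \<Rightarrow> ('g \<times> 'h) set \<Rightarrow> 'h set \<Rightarrow> bool" where
  "regular_window mH \<Gamma> W \<longleftrightarrow> compact W \<and> interior W \<noteq> {} \<and> emeasure mH (frontier W) = 0 \<and>
     W = closure (interior W) \<and> {h. h +o W = W} = {0} \<and> lattice_regular \<Gamma> W"


subsection \<open>The punctured hull and the parameter space\<close>

definition chabauty_fell :: "'g::topological_space set topology" where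
  "chabauty_fell = topology_generated_by
     ({{C. closed C \<and> C \<inter> V \<noteq> {}} | V. open V} \<union> {{C. closed C \<and> C \<inter> K = {}} | K. compact K})"

definition hull_of :: "'g::{group_add,topological_space} set \<Rightarrow> 'g set set" where
  "hull_of P = chabauty_fell closure_of (range (\<lambda>g. g +o P))"

definition punctured_hull :: "'g::{group_add,topological_space} set \<Rightarrow> 'g set set" where
  "punctured_hull P = hull_of P - {{}}"

definition punctured_hull_topology :: "'g::{group_add,topological_space} set \<Rightarrow> 'g set topology" where
  "punctured_hull_topology P = subtopology chabauty_fell (punctured_hull P)"

definition param_act :: "'g::group_add \<Rightarrow> ('g \<times> 'h::group_add) set \<Rightarrow> ('g \<times> 'h) set" where
  "param_act g y = (g, 0) +o y"

text \<open>On the punctured hull these conditions determine the map; its values elsewhere are irrelevant.\<close>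

definition parametrization_map ::
  "('g::{group_add,topological_space} \<times> 'h::{group_add,topological_space}) set \<Rightarrow> 'g set
    \<Rightarrow> ('g set \<Rightarrow> ('g \<times> 'h) set) \<Rightarrow> bool" where
  "parametrization_map \<Gamma> P\<^sub>0 \<beta> \<longleftrightarrow>
     \<beta> \<in> measurable (borel_of (punctured_hull_topology P\<^sub>0)) (borel_of (coset_topology \<Gamma>)) \<and>
     (\<forall>g. \<forall>P\<in>punctured_hull P\<^sub>0. \<beta> (g +o P) = param_act g (\<beta> P)) \<and>
     closedin (prod_topology (punctured_hull_topology P\<^sub>0) (coset_topology \<Gamma>))
       {(P, \<beta> P) | P. P \<in> punctured_hull P\<^sub>0} \<and>
     \<beta> P\<^sub>0 = (0, 0) +o \<Gamma>"

definition nonsingular_params ::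
  "('g::group_add \<times> 'h::{group_add,topological_space}) set \<Rightarrow> 'h set \<Rightarrow> ('g \<times> 'h) set set" where
  "nonsingular_params \<Gamma> W = {(g, h) +o \<Gamma> | g h. lattice_regular \<Gamma> ((- h) +o W)}"

definition nonsingular_hull ::
  "('g::{group_add,topological_space} \<times> 'h::{group_add,topological_space}) set \<Rightarrow> 'h set \<Rightarrow> 'g set
    \<Rightarrow> ('g set \<Rightarrow> ('g \<times> 'h) set) \<Rightarrow> 'g set set" where
  "nonsingular_hull \<Gamma> W P \<beta> = {Q \<in> punctured_hull P. \<beta> Q \<in> nonsingular_params \<Gamma> W}"


subsection \<open>Stationary measures\<close>

definition measure_support :: "'g::topological_space measure \<Rightarrow> 'g set" where
  "measure_support \<mu> = {x. \<forall>U. open U \<and> x \<in> U \<longrightarrow> 0 < emeasure \<mu> U}"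

definition admissible :: "'g::{group_add,topological_space} measure \<Rightarrow> 'g measure \<Rightarrow> bool" where
  "admissible mG \<mu> \<longleftrightarrow> prob_space \<mu> \<and> sets \<mu> = sets borel \<and>
     add_subgroup hull (measure_support \<mu>) = UNIV \<and> absolutely_continuous mG \<mu>"

definition stationary_measure :: "('g \<Rightarrow> 'a \<Rightarrow> 'a) \<Rightarrow> 'g measure \<Rightarrow> 'a measure \<Rightarrow> bool" where
  "stationary_measure act \<mu> \<nu> \<longleftrightarrow>
     (\<forall>A\<in>sets \<nu>. (\<integral>\<^sup>+ g. emeasure (distr \<nu> \<nu> (act g)) A \<partial>\<mu>) = emeasure \<nu> A)"


subsection \<open>Isomorphisms of measured spaces with a group action\<close>

text \<open>As usual, isomorphisms are only required to be bijective between invariant conull sets.\<close>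

definition measurable_isomorphism ::
  "('k \<Rightarrow> 'a \<Rightarrow> 'a) \<Rightarrow> ('k \<Rightarrow> 'b \<Rightarrow> 'b) \<Rightarrow> 'a measure \<Rightarrow> 'b measure \<Rightarrow> ('a \<Rightarrow> 'b) \<Rightarrow> bool" where
  "measurable_isomorphism actM actN M N f \<longleftrightarrow>
     f \<in> measurable M N \<and> distr M N f = N \<and>
     (\<forall>k. \<forall>x\<in>space M. f (actM k x) = actN k (f x)) \<and>
     (\<exists>A\<in>sets M. \<exists>B\<in>sets N. (AE x in M. x \<in> A) \<and> (AE y in N. y \<in> B) \<and>
        (\<forall>k. actM k ` A = A) \<and> (\<forall>k. actN k ` B = B) \<and> bij_betw f A B \<and>
        inv_into A f \<in> measurable (restrict_space N B) (restrict_space M A))"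


subsection \<open>Square-integrable functions and unitary representations\<close>

text \<open>Elements of $L^2(M)$ are almost-everywhere classes of square-integrable functions.\<close>

definition L2_fun :: "'a measure \<Rightarrow> ('a \<Rightarrow> complex) set" where
  "L2_fun M = {f \<in> borel_measurable M. integrable M (\<lambda>x. (cmod (f x))\<^sup>2)}"

definition L2_rel :: "'a measure \<Rightarrow> (('a \<Rightarrow> complex) \<times> ('a \<Rightarrow> complex)) set" where
  "L2_rel M = {(f, k). f \<in> L2_fun M \<and> k \<in> L2_fun M \<and> (AE x in M. f x = k x)}"

definition L2 :: "'a measure \<Rightarrow> ('a \<Rightarrow> complex) set set" where
  "L2 M = L2_fun M // L2_rel M"

definition L2_add ::
  "'a measure \<Rightarrow> ('a \<Rightarrow> complex) set \<Rightarrow> ('a \<Rightarrow> complex) set \<Rightarrow> ('a \<Rightarrow> complex) set" where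
  "L2_add M u v = (\<Union>f\<in>u. \<Union>k\<in>v. L2_rel M `` {\<lambda>x. f x + k x})"

definition L2_scale ::
  "'a measure \<Rightarrow> complex \<Rightarrow> ('a \<Rightarrow> complex) set \<Rightarrow> ('a \<Rightarrow> complex) set" where
  "L2_scale M c u = (\<Union>f\<in>u. L2_rel M `` {\<lambda>x. c * f x})"

definition L2_inner ::
  "'a measure \<Rightarrow> ('a \<Rightarrow> complex) set \<Rightarrow> ('a \<Rightarrow> complex) set \<Rightarrow> complex" where
  "L2_inner M u v = the_elem (\<Union>f\<in>u. \<Union>k\<in>v. {LINT x|M. f x * cnj (k x)})"

definition L2_dist ::
  "'a measure \<Rightarrow> ('a \<Rightarrow> complex) set \<Rightarrow> ('a \<Rightarrow> complex) set \<Rightarrow> real" where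
  "L2_dist M u v = (let w = L2_add M u (L2_scale M (- 1) v) in sqrt (Re (L2_inner M w w)))"

text \<open>The operator $f \mapsto f \circ \phi$ into $L^2(M)$.\<close>

definition L2_pullback ::
  "'a measure \<Rightarrow> ('a \<Rightarrow> 'b) \<Rightarrow> ('b \<Rightarrow> complex) set \<Rightarrow> ('a \<Rightarrow> complex) set" where
  "L2_pullback M \<phi> u = (\<Union>f\<in>u. L2_rel M `` {f \<circ> \<phi>})"

definition koopman ::
  "('k::group_add \<Rightarrow> 'a \<Rightarrow> 'a) \<Rightarrow> 'a measure \<Rightarrow> 'k \<Rightarrow> ('a \<Rightarrow> complex) set \<Rightarrow> ('a \<Rightarrow> complex) set" where
  "koopman act M k = L2_pullback M (act (- k))"

definition L2_unitary ::
  "'a measure \<Rightarrow> 'b measure \<Rightarrow> (('a \<Rightarrow> complex) set \<Rightarrow> ('b \<Rightarrow> complex) set) \<Rightarrow> bool" where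
  "L2_unitary M N T \<longleftrightarrow> bij_betw T (L2 M) (L2 N) \<and>
     (\<forall>u\<in>L2 M. \<forall>v\<in>L2 M. T (L2_add M u v) = L2_add N (T u) (T v)) \<and>
     (\<forall>c. \<forall>u\<in>L2 M. T (L2_scale M c u) = L2_scale N c (T u)) \<and>
     (\<forall>u\<in>L2 M. \<forall>v\<in>L2 M. L2_inner N (T u) (T v) = L2_inner M u v)"

definition L2_unitary_rep ::
  "'a measure \<Rightarrow> ('k::{group_add,topological_space} \<Rightarrow> ('a \<Rightarrow> complex) set \<Rightarrow> ('a \<Rightarrow> complex) set)
    \<Rightarrow> bool" where
  "L2_unitary_rep M \<pi> \<longleftrightarrow> (\<forall>k. L2_unitary M M (\<pi> k)) \<and>
     (\<forall>u\<in>L2 M. \<pi> 0 u = u) \<and> (\<forall>k l. \<forall>u\<in>L2 M. \<pi> (k + l) u = \<pi> k (\<pi> l u)) \<and>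
     (\<forall>u\<in>L2 M. \<forall>k. ((\<lambda>l. L2_dist M (\<pi> l u) (\<pi> k u)) \<longlongrightarrow> 0) (at k))"

definition unitary_rep_isomorphism ::
  "'a measure \<Rightarrow> ('k::{group_add,topological_space} \<Rightarrow> ('a \<Rightarrow> complex) set \<Rightarrow> ('a \<Rightarrow> complex) set)
    \<Rightarrow> 'b measure \<Rightarrow> ('k \<Rightarrow> ('b \<Rightarrow> complex) set \<Rightarrow> ('b \<Rightarrow> complex) set)
    \<Rightarrow> (('a \<Rightarrow> complex) set \<Rightarrow> ('b \<Rightarrow> complex) set) \<Rightarrow> bool" where
  "unitary_rep_isomorphism M \<pi> N \<rho> T \<longleftrightarrow> L2_unitary_rep M \<pi> \<and> L2_unitary_rep N \<rho> \<and>
     L2_unitary M N T \<and> (\<forall>k. \<forall>u\<in>L2 M. T (\<pi> k u) = \<rho> k (T u))"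

end

theory Submission
  imports Defs
begin

text \<open>
  The group \<open>G\<close> acts on \<open>Y = (G \<times> H)/\<Gamma>\<close> with \<open>mY\<close> as its only stationary probability measure. To see this,
  average a stationary \<open>\<eta>\<close> over a small neighbourhood of the identity in \<open>H\<close>. Since \<open>G\<close> and \<open>H\<close> commute, the
  average is again stationary, and by Fubini it is absolutely continuous, with density \<open>f\<close> say. Among all sets of
  the same \<open>mY\<close>-measure, \<open>{f > 1}\<close> has maximal average, so stationarity forces it to be \<open>G\<close>-invariant modulo null
  sets; by ergodicity, a consequence of the density of the projection of \<open>\<Gamma>\<close> to \<open>H\<close>, \<open>f = 1\<close>. Letting the
  neighbourhood shrink gives \<open>\<eta> = mY\<close>.

  On the nonsingular cosets, which have full measure because the window has null boundary, the map
  \<open>y \<mapsto> fst ` {x \<in> y. snd x \<in> W}\<close> is continuous. There it inverts \<open>\<beta>\<close>: as \<open>W\<close> is compact, the closed graph of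
  \<open>\<beta>\<close> is the closure of the orbit of the base point. Hence measures on the punctured hull that are
  pushed to \<open>mY\<close> by \<open>\<beta>\<close> correspond to \<open>mY\<close> itself.
\<close>

subsection \<open>Topological groups\<close>

text \<open>Unimodularity is bypassed: Haar measure and \<open>mY\<close> are compared only through
  null sets. Fubini makes Haar-null sets stable under inversion and right translation, and shows
  that a set of cosets is \<open>mY\<close>-null exactly when its preimage is Haar-null. Absolute
  continuity of the averaged measure has two sources. Averaging smooths along \<open>H\<close>,
  while the density of the admissible measure smooths along \<open>G\<close>, because a stationary
  measure is its own convolution with \<open>\<mu>\<close>. The maximum argument gives invariance of
  the superlevel set only under \<open>\<mu>\<close>-almost every \<open>g\<close>. The measure of
  the symmetric difference of a set and its translate depends continuously on the translation, so
  the elements that preserve the set up to null sets form a closed subgroup; it contains the support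
  of \<open>\<mu>\<close>, which generates \<open>G\<close>. The same continuity on indicator
  functions later yields strong continuity of the Koopman representations. Uniqueness of the
  invariant measure is read off from unique stationarity: some admissible \<open>\<mu>\<close>
  exists, and an invariant measure is stationary for it.\<close>

instance prod :: (topological_monoid_add, topological_monoid_add) topological_monoid_add
proof
  fix a b :: "'a \<times> 'b"
  have "(((\<lambda>x. (fst (fst x) + fst (snd x), snd (fst x) + snd (snd x))) \<longlongrightarrow> (fst a + fst b, snd a + snd b))
    (nhds (a, b)))"
    by (intro tendsto_intros filterlim_ident tendsto_fst[where a="(a,b)", simplified]
        tendsto_fst[where a=a] tendsto_fst[where a=b] tendsto_snd[where a=a] tendsto_snd[where a=b]
        tendsto_snd[where a="(a,b)", simplified])
  then show "((\<lambda>x. fst x + snd x) \<longlongrightarrow> a + b) (nhds a \<times>\<^sub>F nhds b)"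
    by (simp add: nhds_prod plus_prod_def)
qed

instance prod :: (topological_group_add, topological_group_add) topological_group_add
proof
  fix a :: "'a \<times> 'b"
  have "((\<lambda>x. (- fst x, - snd x)) \<longlongrightarrow> (- fst a, - snd a)) (nhds a)"
    by (intro tendsto_intros filterlim_ident)
  then show "(uminus \<longlongrightarrow> - a) (nhds a)"
    by (simp add: uminus_prod_def[abs_def])
qed

lemma open_add_nbhds:
  fixes a b :: "'l::topological_group_add"
  assumes "open U" "a + b \<in> U"
  obtains N V where "open N" "open V" "a \<in> N" "b \<in> V" "\<And>n v. n \<in> N \<Longrightarrow> v \<in> V \<Longrightarrow> n + v \<in> U"
proof -
  have "open ((\<lambda>p::'l\<times>'l. fst p + snd p) -` U)"
    using assms(1) by (intro open_vimage continuous_intros)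
  then obtain N V where "open N" "open V" "(a, b) \<in> N \<times> V" "N \<times> V \<subseteq> (\<lambda>p::'l\<times>'l. fst p + snd p) -` U"
    by (rule open_prod_elim[where x="(a,b)"]) (use assms(2) in auto)
  then show ?thesis by (intro that[of N V]) auto
qed

lemma open_left_translate:
  fixes a :: "'l::topological_group_add"
  assumes "open U" shows "open {x. a + x \<in> U}"
  using open_vimage[OF assms, of "\<lambda>x. a + x"]
  by (simp add: vimage_def continuous_on_add continuous_on_id continuous_on_const)

lemma open_right_translate:
  fixes a :: "'l::topological_group_add"
  assumes "open U" shows "open {x. x + a \<in> U}"
  using open_vimage[OF assms, of "\<lambda>x. x + a"]
  by (simp add: vimage_def continuous_on_add continuous_on_id continuous_on_const)

lemma open_uminus_group:
  fixes U :: "'l::topological_group_add set"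
  assumes "open U" shows "open {x. - x \<in> U}"
  using open_vimage[OF assms, of "\<lambda>x. - x"]
  by (simp add: vimage_def continuous_on_minus[OF continuous_on_id, simplified])

lemma borel_measurable_uminus_group [measurable]:
  fixes f :: "'a \<Rightarrow> 'l::{topological_group_add,second_countable_topology}"
  assumes "f \<in> borel_measurable M"
  shows "(\<lambda>x. - f x) \<in> borel_measurable M"
proof -
  have "uminus \<in> borel_measurable (borel :: 'l measure)"
    by (intro borel_measurable_continuous_onI continuous_intros)
  then show ?thesis using measurable_comp[OF assms] by (simp add: comp_def)
qed

lemma borel_of_euclidean: "borel_of (euclidean :: 'a::topological_space topology) = borel"
  by (simp add: borel_of_def borel_def)

text \<open>Sigma-compactness, from Lindelof applied to the open sets with compact hull. It gives
  sigma-finiteness of Haar measures and measurability of the singular cosets.\<close>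

lemma locally_compact_countable_cover:
  assumes "locally_compact_space (euclidean :: ('a::second_countable_topology) topology)"
  obtains \<K> :: "'a::second_countable_topology set set" where "countable \<K>" "\<And>K. K \<in> \<K> \<Longrightarrow> compact K" "\<Union>\<K> = UNIV"
proof -
  define \<F> where "\<F> = {U::'a set. open U \<and> (\<exists>K. compact K \<and> U \<subseteq> K)}"
  have "\<exists>U\<in>\<F>. x \<in> U" for x
    using assms unfolding locally_compact_space_def \<F>_def by (auto 4 4)
  then have "\<Union>\<F> = UNIV" by blast
  moreover obtain \<F>' where F': "\<F>' \<subseteq> \<F>" "countable \<F>'" "\<Union>\<F>' = \<Union>\<F>"
    using Lindelof[of \<F>] unfolding \<F>_def by blast
  moreover have "\<forall>U\<in>\<F>'. \<exists>K. compact K \<and> U \<subseteq> K" using F'(1) unfolding \<F>_def by blast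
  then obtain k where "\<forall>U\<in>\<F>'. compact (k U) \<and> U \<subseteq> k U" by metis
  ultimately show ?thesis by (intro that[of "k ` \<F>'"]) blast+
qed

text \<open>Each point is isolated by a member of a countable basis, and distinct points need
  distinct members.\<close>

lemma discrete_countable:
  fixes S :: "'a::second_countable_topology set"
  assumes "discrete S" shows "countable S"
proof -
  obtain \<B> :: "'a set set" where B: "countable \<B>" "topological_basis \<B>"
    using ex_countable_basis by blast
  have "\<exists>B\<in>\<B>. B \<inter> S = {x}" if "x \<in> S" for x
  proof -
    obtain T where T: "open T" "T \<inter> S = {x}" using assms \<open>x \<in> S\<close> unfolding discrete_def isolated_in_def by blast
    then obtain B where "B \<in> \<B>" "x \<in> B" "B \<subseteq> T" using topological_basisE[OF B(2) T(1)] by blast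
    then show ?thesis using T(2) \<open>x \<in> S\<close> by blast
  qed
  then obtain f where f: "\<And>x. x \<in> S \<Longrightarrow> f x \<in> \<B> \<and> f x \<inter> S = {x}" by metis
  then have "inj_on f S" unfolding inj_on_def by (metis singleton_inject)
  then show ?thesis using countable_subset[of "f ` S" \<B>] B(1) f by (meson countable_image_inj_on image_subsetI)
qed

text \<open>Projection along a compact factor is a closed map, by the tube lemma. This is why model
  sets are closed although the projection of the lattice to the first factor need not be.\<close>

lemma closed_fst_image_compact:
  fixes y :: "('a::topological_space \<times> 'b::topological_space) set"
  assumes y: "closed y" and W: "compact W"
  shows "closed (fst ` {x \<in> y. snd x \<in> W})"
  unfolding closed_def
proof (subst open_subopen, intro ballI)
  fix g assume "g \<in> - fst ` {x \<in> y. snd x \<in> W}"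
  then have "{g} \<times> W \<subseteq> - y" by force
  then obtain X0 where "g \<in> X0" "open X0" "X0 \<times> W \<subseteq> - y"
    using Elementary_Topology.tube_lemma[OF W] y by (metis open_Compl)
  then show "\<exists>T. open T \<and> g \<in> T \<and> T \<subseteq> - fst ` {x \<in> y. snd x \<in> W}"
    by (intro exI[of _ X0]) force
qed

lemma mem_translate_iff: "x \<in> a +o S \<longleftrightarrow> - a + x \<in> (S :: 'h::group_add set)"
proof
  assume "- a + x \<in> S"
  then have "a + (- a + x) \<in> a +o S" by (rule set_plus_intro2)
  then show "x \<in> a +o S" by simp
qed (auto simp: elt_set_plus_def simp flip: add.assoc)

lemma bex_translate_iff: "(\<exists>x\<in>a +o S. Q x) \<longleftrightarrow> (\<exists>s\<in>S. Q (a + s))"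
  by (auto simp: elt_set_plus_def)

lemma interior_translate:
  fixes S :: "'h::topological_group_add set"
  shows "interior (a +o S) = a +o interior S"
proof -
  \<comment> \<open>This inclusion is proved for every translate, so that applying it to
    \<open>- a\<close> and \<open>a +o S\<close> yields the converse.\<close>
  have sub: "b +o interior T \<subseteq> interior (b +o T)" for b and T :: "'h set"
  proof (rule interior_maximal)
    show "b +o interior T \<subseteq> b +o T" using interior_subset by (rule set_plus_mono)
    have "b +o interior T = {x. - b + x \<in> interior T}" by (auto simp: mem_translate_iff)
    then show "open (b +o interior T)" using open_left_translate[of "interior T" "- b"] by simp
  qed
  have "- a +o interior (a +o S) \<subseteq> interior S"
  proof -
    have "- a +o (a +o S) = S" by (auto simp: mem_translate_iff)
    then show ?thesis using sub[of "- a" "a +o S"] by simp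
  qed
  then have "interior (a +o S) \<subseteq> a +o interior S"
    by (auto simp: mem_translate_iff subset_iff)
  with sub show ?thesis by blast
qed

lemma frontier_translate:
  fixes S :: "'h::topological_group_add set"
  shows "frontier (a +o S) = a +o frontier S"
proof -
  have "- (a +o T) = a +o (- T)" for T :: "'h set" by (auto simp: mem_translate_iff)
  then show ?thesis
    unfolding frontier_closures closure_interior
    by (simp add: interior_translate) (auto simp: mem_translate_iff)
qed

subsection \<open>Null sets of Haar measures\<close>

lemma haar_measure_sigma_finite:
  fixes m :: "'l::{topological_group_add,t2_space,second_countable_topology} measure"
  assumes "locally_compact_space (euclidean :: 'l topology)" "haar_measure m"
  shows "sigma_finite_measure m"
proof -
  obtain \<K> :: "'l set set" where K: "countable \<K>" "\<And>K. K \<in> \<K> \<Longrightarrow> compact K" "\<Union>\<K> = UNIV"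
    using locally_compact_countable_cover[OF assms(1)] by metis
  have s: "sets m = sets borel" using assms(2) by (simp add: haar_measure_def)
  show ?thesis
  proof
    show "\<exists>A. countable A \<and> A \<subseteq> sets m \<and> \<Union> A = space m \<and> (\<forall>a\<in>A. emeasure m a \<noteq> \<infinity>)"
      using K assms(2) s sets_eq_imp_space_eq[OF s] unfolding haar_measure_def
      by (intro exI[of _ \<K>]) (auto simp: compact_imp_closed less_top)
  qed
qed

lemma haar_emeasure_translate:
  fixes m :: "'l::{topological_group_add,second_countable_topology} measure"
  assumes "haar_measure m" "B \<in> sets borel"
  shows "emeasure m {x. a + x \<in> B} = emeasure m B"
proof -
  have s: "sets m = sets borel" and d: "distr m m ((+) a) = m"
    using assms(1) by (auto simp: haar_measure_def invariant_measure_def)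
  have sp: "space m = UNIV" using sets_eq_imp_space_eq[OF s] by simp
  have "(+) a \<in> measurable m m"
    unfolding measurable_cong_sets[OF s s] by measurable
  then have "emeasure (distr m m ((+) a)) B = emeasure m ((+) a -` B \<inter> space m)"
    using assms(2) s by (intro emeasure_distr) auto
  then show ?thesis unfolding d by (simp add: sp vimage_def)
qed

text \<open>Fubini for the indicator of -y + x lying in the inverse of \<open>B\<close>. For fixed y
  the integral over x is the measure of that inverse; for fixed x the condition says that y lies in
  \<open>x +o B\<close>, a null set. Left invariance alone is used, at the price of a statement
  about null sets only.\<close>

lemma haar_null_uminus:
  fixes m :: "'l::{topological_group_add,second_countable_topology} measure"
  assumes h: "haar_measure m" and sf: "sigma_finite_measure m"
    and B: "B \<in> sets borel" "emeasure m B = 0"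
  shows "emeasure m {x. - x \<in> B} = 0"
proof -
  interpret pair_sigma_finite m m using sf by (simp add: pair_sigma_finite_def)
  have s [measurable_cong]: "sets m = sets borel" using h by (auto simp: haar_measure_def)
  have sp: "space m = UNIV" using sets_eq_imp_space_eq[OF s] by simp
  note [measurable] = B(1)
  let ?f = "\<lambda>x y. indicator {x. - x \<in> B} (- y + x) :: ennreal"
  have "{x. - x \<in> B} \<in> sets borel"
    using measurable_sets_borel[of uminus borel B] by (simp add: vimage_def)
  note [measurable] = this
  have "(\<integral>\<^sup>+ y. \<integral>\<^sup>+ x. ?f x y \<partial>m \<partial>m) = (\<integral>\<^sup>+ x. \<integral>\<^sup>+ y. ?f x y \<partial>m \<partial>m)"
    by (intro Fubini'[symmetric]) measurable
  moreover have "(\<integral>\<^sup>+ x. ?f x y \<partial>m) = emeasure m {x. - x \<in> B}" for y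
  proof -
    have "(\<integral>\<^sup>+ x. ?f x y \<partial>m) = (\<integral>\<^sup>+ x. indicator {x. - y + x \<in> {x. - x \<in> B}} x \<partial>m)"
      by (intro nn_integral_cong) (simp add: indicator_def)
    also have "\<dots> = emeasure m {x. - y + x \<in> {x. - x \<in> B}}"
      by (rule nn_integral_indicator) measurable
    also have "\<dots> = emeasure m {x. - x \<in> B}"
      by (rule haar_emeasure_translate[OF h]) measurable
    finally show ?thesis .
  qed
  moreover have "(\<integral>\<^sup>+ y. ?f x y \<partial>m) = 0" for x
  proof -
    have "(\<integral>\<^sup>+ y. ?f x y \<partial>m) = (\<integral>\<^sup>+ y. indicator {y. - x + y \<in> B} y \<partial>m)"
      by (intro nn_integral_cong) (simp add: indicator_def minus_add)
    also have "\<dots> = emeasure m {y. - x + y \<in> B}"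
      by (rule nn_integral_indicator) measurable
    also have "\<dots> = 0"
      using haar_emeasure_translate[OF h B(1)] B(2) by simp
    finally show ?thesis .
  qed
  ultimately have "emeasure m {x. - x \<in> B} * emeasure m UNIV = 0"
    by (simp add: sp)
  moreover have "emeasure m UNIV \<noteq> 0" using h by (auto simp: haar_measure_def)
  ultimately show ?thesis by simp
qed

text \<open>A right translation is an inversion, a left translation and another inversion. It may
  rescale \<open>m\<close>, but it keeps null sets.\<close>

lemma haar_null_right_translate:
  fixes m :: "'l::{topological_group_add,second_countable_topology} measure"
  assumes h: "haar_measure m" and sf: "sigma_finite_measure m"
    and B: "B \<in> sets borel" "emeasure m B = 0"
  shows "emeasure m {x. x + a \<in> B} = 0"
proof -
  note [measurable] = B(1)
  have m1: "{x. - x \<in> B} \<in> sets borel" using measurable_sets_borel[of uminus borel B] by (simp add: vimage_def)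
  have m2: "{x. - a + x \<in> {x. - x \<in> B}} \<in> sets borel"
    using measurable_sets_borel[of "\<lambda>x. - a + x" borel, OF _ m1] by (simp add: vimage_def)
  have "emeasure m {x. - a + x \<in> {x. - x \<in> B}} = 0"
    using haar_emeasure_translate[OF h m1] haar_null_uminus[OF h sf B] by simp
  from haar_null_uminus[OF h sf m2 this] show ?thesis by (simp add: minus_add)
qed

text \<open>Compact sets lie in the product of their projections and nonempty open sets contain
  boxes; second countability identifies the product sigma-algebra with the Borel sets.\<close>

lemma haar_measure_pair:
  fixes m :: "'g::{topological_group_add,t2_space,second_countable_topology} measure"
    and n :: "'h::{topological_group_add,t2_space,second_countable_topology} measure"
  assumes "haar_measure m" "haar_measure n" "sigma_finite_measure m" "sigma_finite_measure n"
  shows "haar_measure (m \<Otimes>\<^sub>M n)" "sigma_finite_measure (m \<Otimes>\<^sub>M n)"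
proof -
  interpret pair_sigma_finite m n using assms by (simp add: pair_sigma_finite_def)
  show "sigma_finite_measure (m \<Otimes>\<^sub>M n)" ..
  have sm: "sets m = sets borel" and sn: "sets n = sets borel"
    using assms by (auto simp: haar_measure_def)
  have sets: "sets (m \<Otimes>\<^sub>M n) = sets borel"
    using sets_pair_measure_cong[OF sm sn] unfolding borel_prod .
  have "distr (m \<Otimes>\<^sub>M n) (m \<Otimes>\<^sub>M n) ((+) k) = m \<Otimes>\<^sub>M n" for k
  proof -
    have d: "distr m m ((+) (fst k)) = m" "distr n n ((+) (snd k)) = n"
      using assms by (auto simp: haar_measure_def invariant_measure_def)
    have "distr m m ((+) (fst k)) \<Otimes>\<^sub>M distr n n ((+) (snd k)) =
      distr (m \<Otimes>\<^sub>M n) (m \<Otimes>\<^sub>M n) (\<lambda>(x, y). (fst k + x, snd k + y))"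
      using assms(4) d by (intro pair_measure_distr) (auto simp: measurable_cong_sets[OF sm sm] measurable_cong_sets[OF sn sn])
    moreover have "(\<lambda>(x, y). (fst k + x, snd k + y)) = (+) k"
      by (auto simp: plus_prod_def)
    ultimately show ?thesis using d by simp
  qed
  moreover have "emeasure (m \<Otimes>\<^sub>M n) K < \<infinity>" if "compact K" for K
  proof -
    have c: "compact (fst ` K)" "compact (snd ` K)"
      using that by (auto intro!: compact_continuous_image continuous_intros)
    then have "emeasure (m \<Otimes>\<^sub>M n) (fst ` K \<times> snd ` K) = emeasure m (fst ` K) * emeasure n (snd ` K)"
      by (intro M2.emeasure_pair_measure_Times) (auto simp: sm sn compact_imp_closed)
    also have "\<dots> < \<infinity>"
      using assms c by (auto simp: haar_measure_def ennreal_mult_less_top)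
    finally have "emeasure (m \<Otimes>\<^sub>M n) (fst ` K \<times> snd ` K) < \<infinity>" .
    moreover have "emeasure (m \<Otimes>\<^sub>M n) K \<le> emeasure (m \<Otimes>\<^sub>M n) (fst ` K \<times> snd ` K)"
      using c sets by (intro emeasure_mono subset_fst_snd) (auto simp: compact_imp_closed compact_Times)
    ultimately show ?thesis by simp
  qed
  moreover have "0 < emeasure (m \<Otimes>\<^sub>M n) U" if "open U" "U \<noteq> {}" for U
  proof -
    obtain x where "x \<in> U" using \<open>U \<noteq> {}\<close> by blast
    then obtain A B where AB: "open A" "open B" "x \<in> A \<times> B" "A \<times> B \<subseteq> U"
      using \<open>open U\<close> open_prod_elim by metis
    then have "emeasure (m \<Otimes>\<^sub>M n) (A \<times> B) = emeasure m A * emeasure n B"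
      by (intro M2.emeasure_pair_measure_Times) (auto simp: sm sn)
    moreover have "0 < emeasure m A" "0 < emeasure n B"
      using AB assms by (auto simp: haar_measure_def)
    ultimately have "0 < emeasure (m \<Otimes>\<^sub>M n) (A \<times> B)" by (simp add: ennreal_zero_less_mult_iff)
    also have "\<dots> \<le> emeasure (m \<Otimes>\<^sub>M n) U"
      using AB that sets by (intro emeasure_mono) auto
    finally show ?thesis .
  qed
  ultimately show "haar_measure (m \<Otimes>\<^sub>M n)"
    using sets by (auto simp: haar_measure_def invariant_measure_def)
qed

subsection \<open>Continuity of measure preserving actions\<close>

lemma space_borel_of [simp]: "space (borel_of T) = topspace T"
  unfolding borel_of_def by (simp add: space_measure_of_conv)

lemma sets_borel_of: "sets (borel_of T) = sigma_sets (topspace T) {U. openin T U}"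
  unfolding borel_of_def using openin_subset by (auto intro!: sets_measure_of)

lemma openin_sets_borel_of: "openin T U \<Longrightarrow> U \<in> sets (borel_of T)"
  by (simp add: sets_borel_of)

lemma measurable_borel_ofI:
  assumes "f \<in> space N \<rightarrow> topspace T"
    and "\<And>U. openin T U \<Longrightarrow> f -` U \<inter> space N \<in> sets N"
  shows "f \<in> measurable N (borel_of T)"
proof (rule measurable_sigma_sets[OF sets_borel_of])
  show "{U. openin T U} \<subseteq> Pow (topspace T)" using openin_subset by auto
qed (use assms in auto)

text \<open>Continuity from above; it reduces countable unions to finite ones, for which finitely
  many neighbourhoods of the identity can be intersected.\<close>

lemma finite_measure_tail:
  fixes A :: "nat \<Rightarrow> 'a set"
  assumes A: "\<And>i. A i \<in> sets M" and fin: "emeasure M (\<Union>i. A i) < \<infinity>" and e: "e > (0::real)"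
  obtains k where "emeasure M ((\<Union>i. A i) - (\<Union>i<k. A i)) \<le> ennreal e"
proof -
  define B where "B k = (\<Union>i. A i) - (\<Union>i<k. A i)" for k :: nat
  have 1: "range B \<subseteq> sets M" using A unfolding B_def by auto
  have 2: "decseq B" unfolding B_def decseq_def by (auto intro: less_le_trans)
  have 3: "emeasure M (B i) \<noteq> \<infinity>" for i
  proof -
    have "emeasure M (B i) \<le> emeasure M (\<Union>i. A i)"
      unfolding B_def using A by (intro emeasure_mono) auto
    then show ?thesis using fin by (auto simp: top_unique)
  qed
  have 4: "(\<Inter>i. B i) = {}" unfolding B_def by auto
  have "(\<lambda>i. emeasure M (B i)) \<longlonglongrightarrow> 0"
    using Lim_emeasure_decseq[OF 1 2 3] unfolding 4 by simp
  then have "eventually (\<lambda>i. emeasure M (B i) < ennreal e) sequentially"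
    by (rule order_tendstoD) (use e in simp)
  then obtain k where "emeasure M (B k) < ennreal e" by (auto simp: eventually_sequentially)
  then show ?thesis using that[of k] unfolding B_def by auto
qed

text \<open>Common setting for two cases: a group acting on itself with its Haar measure, possibly
  infinite, and the group acting on cosets with \<open>mY\<close>. Continuity is stated at the
  identity, and the Lindelof property enters as a hypothesis because the coset topology is a
  topology on a set of sets rather than on a type.\<close>

locale continuous_mp_action =
  fixes T :: "'a topology" and M :: "'a measure"
    and act :: "'l::{monoid_add,topological_space} \<Rightarrow> 'a \<Rightarrow> 'a"
  assumes sets_M: "sets M = sets (borel_of T)"
    and act_measurable: "act l \<in> measurable M M"
    and act_invariant: "distr M M (act l) = M"
    and act_nbhds: "openin T U \<Longrightarrow> x \<in> U \<Longrightarrow>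
      \<exists>N V. open N \<and> 0 \<in> N \<and> openin T V \<and> x \<in> V \<and> (\<forall>n\<in>N. \<forall>v\<in>V. act n v \<in> U)"
    and Lindelof_T: "(\<And>V. V \<in> \<V> \<Longrightarrow> openin T V) \<Longrightarrow> \<exists>\<V>'. \<V>' \<subseteq> \<V> \<and> countable \<V>' \<and> \<Union>\<V>' = \<Union>\<V>"
begin

lemma act_vimage_sets [measurable]: "A \<in> sets M \<Longrightarrow> act n -` A \<inter> space M \<in> sets M"
  using act_measurable by (rule measurable_sets)

lemma emeasure_act_vimage: "A \<in> sets M \<Longrightarrow> emeasure M (act n -` A \<inter> space M) = emeasure M A"
  using emeasure_distr[OF act_measurable] act_invariant by metis

lemma emeasure_act_diff:
  assumes A: "A \<in> sets M" and fin: "emeasure M A < \<infinity>"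
  shows "emeasure M (act n -` A \<inter> space M - A) = emeasure M (A - (act n -` A \<inter> space M))"
proof -
  let ?B = "act n -` A \<inter> space M"
  have B: "?B \<in> sets M" using A by measurable
  have i: "emeasure M (A \<inter> ?B) \<noteq> \<infinity>"
  proof -
    have "emeasure M (A \<inter> ?B) \<le> emeasure M A" using A B by (intro emeasure_mono) auto
    then show ?thesis using fin by (auto simp: top_unique)
  qed
  have "emeasure M (?B - A) + emeasure M (A \<inter> ?B) = emeasure M ?B"
    using A B by (subst plus_emeasure) (auto intro: arg_cong[where f="emeasure M"])
  also have "\<dots> = emeasure M A" using A by (rule emeasure_act_vimage)
  also have "\<dots> = emeasure M (A - ?B) + emeasure M (A \<inter> ?B)"
    using A B by (subst plus_emeasure) (auto intro: arg_cong[where f="emeasure M"])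
  finally show ?thesis using i by (simp add: ennreal_add_left_cancel add.commute)
qed

text \<open>Only the half \<open>A - act n -` A\<close> of the symmetric difference has to be estimated, because for
  measure preserving maps both halves have the same measure.\<close>

definition almost_fixed :: "'a set \<Rightarrow> bool" where
  "almost_fixed A \<longleftrightarrow> A \<in> sets M \<and>
     (\<forall>e>0. \<exists>N. open N \<and> 0 \<in> N \<and> (\<forall>n\<in>N. emeasure M (A - (act n -` A \<inter> space M)) \<le> ennreal e))"

lemma almost_fixedD:
  assumes "almost_fixed A" "e > 0"
  obtains N where "open N" "0 \<in> N" "\<And>n. n \<in> N \<Longrightarrow> emeasure M (A - (act n -` A \<inter> space M)) \<le> ennreal e"
  using assms unfolding almost_fixed_def by blast

lemma emeasure_le_add:
  assumes "X \<subseteq> A \<union> B" "A \<in> sets M" "B \<in> sets M" "emeasure M A \<le> ennreal e" "emeasure M B \<le> ennreal e"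
    and "0 \<le> e"
  shows "emeasure M X \<le> ennreal (2 * e)"
proof -
  have "emeasure M X \<le> emeasure M (A \<union> B)" using assms by (intro emeasure_mono) auto
  also have "\<dots> \<le> emeasure M A + emeasure M B" using assms by (intro emeasure_subadditive) auto
  also have "\<dots> \<le> ennreal e + ennreal e" using assms by (intro add_mono)
  also have "\<dots> = ennreal (2 * e)" using assms by (simp flip: ennreal_plus)
  finally show ?thesis .
qed

lemma almost_fixed_Un:
  assumes "almost_fixed A" "almost_fixed B"
  shows "almost_fixed (A \<union> B)"
  unfolding almost_fixed_def
proof (intro conjI allI impI)
  have [measurable]: "A \<in> sets M" "B \<in> sets M" using assms by (auto simp: almost_fixed_def)
  then show "A \<union> B \<in> sets M" by auto
  fix e :: real assume "e > 0"
  then have e: "e / 2 > 0" by simp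
  obtain N where N: "open N" "0 \<in> N" "\<And>n. n \<in> N \<Longrightarrow> emeasure M (A - (act n -` A \<inter> space M)) \<le> ennreal (e/2)"
    using almost_fixedD[OF assms(1) e] by blast
  obtain N' where N': "open N'" "0 \<in> N'" "\<And>n. n \<in> N' \<Longrightarrow> emeasure M (B - (act n -` B \<inter> space M)) \<le> ennreal (e/2)"
    using almost_fixedD[OF assms(2) e] by blast
  have "emeasure M (A \<union> B - (act n -` (A \<union> B) \<inter> space M)) \<le> ennreal e" if "n \<in> N \<inter> N'" for n
    using emeasure_le_add[of "A \<union> B - (act n -` (A \<union> B) \<inter> space M)"
        "A - (act n -` A \<inter> space M)" "B - (act n -` B \<inter> space M)" "e/2"] N(3)[of n] N'(3)[of n] that e
    by auto
  then show "\<exists>N. open N \<and> 0 \<in> N \<and> (\<forall>n\<in>N. emeasure M (A \<union> B - (act n -` (A \<union> B) \<inter> space M)) \<le> ennreal e)"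
    using N N' by (intro exI[of _ "N \<inter> N'"]) auto
qed

lemma almost_fixed_empty: "almost_fixed {}"
  unfolding almost_fixed_def using open_UNIV by auto

text \<open>A point of the union that is moved out of it lies in a tail of measure at most
  \<open>e / 2\<close>, or in the finite part and is moved out of that.\<close>

lemma almost_fixed_countable_Union:
  fixes A :: "nat \<Rightarrow> 'a set"
  assumes A: "\<And>i. almost_fixed (A i)" and fin: "emeasure M (\<Union>i. A i) < \<infinity>"
  shows "almost_fixed (\<Union>i. A i)"
  unfolding almost_fixed_def
proof (intro conjI allI impI)
  have S[measurable]: "A i \<in> sets M" for i using A by (auto simp: almost_fixed_def)
  then show "(\<Union>i. A i) \<in> sets M" by auto
  fix e :: real assume "e > 0"
  then have e: "e / 2 > 0" by simp
  obtain k where k: "emeasure M ((\<Union>i. A i) - (\<Union>i<k. A i)) \<le> ennreal (e/2)"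
    using finite_measure_tail[OF S fin e] by blast
  have "almost_fixed (\<Union>i<j. A i)" for j
    by (induction j) (auto simp: lessThan_Suc almost_fixed_empty intro!: almost_fixed_Un A)
  then obtain N where N: "open N" "0 \<in> N"
    "\<And>n. n \<in> N \<Longrightarrow> emeasure M ((\<Union>i<k. A i) - (act n -` (\<Union>i<k. A i) \<inter> space M)) \<le> ennreal (e/2)"
    using almost_fixedD[OF _ e] by blast
  have "emeasure M ((\<Union>i. A i) - (act n -` (\<Union>i. A i) \<inter> space M)) \<le> ennreal e" if "n \<in> N" for n
  proof -
    have "(\<Union>i. A i) - (act n -` (\<Union>i. A i) \<inter> space M) \<subseteq>
      ((\<Union>i. A i) - (\<Union>i<k. A i)) \<union> ((\<Union>i<k. A i) - (act n -` (\<Union>i<k. A i) \<inter> space M))"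
      by auto
    then show ?thesis
      using emeasure_le_add[OF _ _ _ k N(3)[OF that]] e by simp
  qed
  then show "\<exists>N. open N \<and> 0 \<in> N \<and> (\<forall>n\<in>N. emeasure M ((\<Union>i. A i) - (act n -` (\<Union>i. A i) \<inter> space M)) \<le> ennreal e)"
    using N by blast
qed

text \<open>Continuity at the identity provides such a pair around every point of \<open>U\<close>,
  and Lindelof keeps countably many. The neighbourhood depends on the piece, since a single one need
  not keep all of \<open>U\<close> inside \<open>U\<close>.\<close>

lemma almost_fixed_open_aux:
  assumes U: "openin T U"
  obtains V :: "nat \<Rightarrow> 'a set" and N :: "nat \<Rightarrow> 'l set" where
    "\<And>i. openin T (V i)" "\<And>i. open (N i)" "\<And>i. 0 \<in> N i" "U = (\<Union>i. V i)"
    "\<And>i n v. n \<in> N i \<Longrightarrow> v \<in> V i \<Longrightarrow> act n v \<in> U"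
proof -
  define \<V> where "\<V> = {V. openin T V \<and> V \<subseteq> U \<and> (\<exists>N. open N \<and> 0 \<in> N \<and> (\<forall>n\<in>N. \<forall>v\<in>V. act n v \<in> U))}"
  have "\<exists>V\<in>\<V>. x \<in> V" if "x \<in> U" for x
  proof -
    obtain N V where NV: "open N" "0 \<in> N" "openin T V" "x \<in> V" "\<forall>n\<in>N. \<forall>v\<in>V. act n v \<in> U"
      using act_nbhds[OF U \<open>x \<in> U\<close>] by blast
    have "openin T (V \<inter> U)" using NV(3) U by (rule openin_Int)
    then have "V \<inter> U \<in> \<V>" unfolding \<V>_def using NV by blast
    then show ?thesis using NV(4) that by (intro bexI[of _ "V \<inter> U"]) auto
  qed
  moreover have "V \<subseteq> U" if "V \<in> \<V>" for V using that by (simp add: \<V>_def)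
  ultimately have UV: "\<Union>\<V> = U" by blast
  obtain \<V>' where V': "\<V>' \<subseteq> \<V>" "countable \<V>'" "\<Union>\<V>' = \<Union>\<V>"
  proof -
    have "openin T V" if "V \<in> \<V>" for V using that by (simp add: \<V>_def)
    then show thesis using Lindelof_T[of \<V>] that by metis
  qed
  have em: "{} \<in> \<V>" unfolding \<V>_def using open_UNIV by auto
  \<comment> \<open>Inserting the empty set keeps the family nonempty, so that it can be enumerated
    even when \<open>U\<close> is empty.\<close>
  define V where "V = from_nat_into (insert {} \<V>')"
  have rV: "range V = insert {} \<V>'" unfolding V_def using V'(2) by (intro range_from_nat_into) auto
  have VV: "V i \<in> \<V>" for i
  proof -
    have "V i \<in> insert {} \<V>'" using rV by (metis rangeI)
    then show ?thesis using V'(1) em by (metis insertE subsetD)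
  qed
  have "\<exists>N. open N \<and> 0 \<in> N \<and> (\<forall>n\<in>N. \<forall>v\<in>V i. act n v \<in> U)" for i
    using VV[of i] by (simp add: \<V>_def)
  then obtain N where N: "\<And>i. open (N i) \<and> 0 \<in> N i \<and> (\<forall>n\<in>N i. \<forall>v\<in>V i. act n v \<in> U)" by metis
  have "U = (\<Union>i. V i)" using rV V'(3) UV by auto
  show ?thesis
  proof (rule that[of V N])
    show "openin T (V i)" for i using VV[of i] by (simp add: \<V>_def)
  qed (use N \<open>U = (\<Union>i. V i)\<close> in auto)
qed

text \<open>For \<open>n\<close> in finitely many of the neighbourhoods from
  \<open>almost_fixed_open_aux\<close>, only the part of \<open>U\<close> outside the corresponding
  pieces can leave \<open>U\<close>, and that tail has small measure.\<close>

lemma almost_fixed_open: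
  assumes U: "openin T U" and fin: "emeasure M U < \<infinity>"
  shows "almost_fixed U"
  unfolding almost_fixed_def
proof (intro conjI allI impI)
  show US: "U \<in> sets M" using U by (simp add: sets_M openin_sets_borel_of)
  fix e :: real assume e: "e > 0"
  obtain V :: "nat \<Rightarrow> 'a set" and N :: "nat \<Rightarrow> 'l set" where VN: "\<And>i. openin T (V i)"
    "\<And>i. open (N i)" "\<And>i. 0 \<in> N i" "U = (\<Union>i. V i)"
    "\<And>i n v. n \<in> N i \<Longrightarrow> v \<in> V i \<Longrightarrow> act n v \<in> U"
    by (rule almost_fixed_open_aux[OF U]) (rule that)
  note V = VN(1,4) and N = VN(2,3,5)
  have VS: "V i \<in> sets M" for i using V by (simp add: sets_M openin_sets_borel_of)
  have "emeasure M (\<Union>i. V i) < \<infinity>" using fin V(2) by simp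
  then obtain k where k: "emeasure M ((\<Union>i. V i) - (\<Union>i<k. V i)) \<le> ennreal e"
    using finite_measure_tail[of V M e] VS e by metis
  have "emeasure M (U - (act n -` U \<inter> space M)) \<le> ennreal e" if "n \<in> (\<Inter>i<k. N i)" for n
  proof -
    have "U \<subseteq> space M" using US by (rule sets.sets_into_space)
    then have "U - (act n -` U \<inter> space M) \<subseteq> U - (\<Union>i<k. V i)"
      using that N(3) by blast
    then have "U - (act n -` U \<inter> space M) \<subseteq> (\<Union>i. V i) - (\<Union>i<k. V i)"
      using V(2) by simp
    then have "emeasure M (U - (act n -` U \<inter> space M)) \<le> emeasure M ((\<Union>i. V i) - (\<Union>i<k. V i))"
      using VS by (intro emeasure_mono) auto
    with k show ?thesis by simp
  qed
  then show "\<exists>N. open N \<and> 0 \<in> N \<and> (\<forall>n\<in>N. emeasure M (U - (act n -` U \<inter> space M)) \<le> ennreal e)"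
    using N by (intro exI[of _ "\<Inter>i<k. N i"]) auto
qed

text \<open>Induction over the generation of the Borel sets from open sets. Intersecting with the
  fixed set \<open>O'\<close> keeps all measures finite, as the tail estimate and the exchange of
  the two halves of a symmetric difference require.\<close>

lemma almost_fixed_Int:
  assumes O: "openin T O'" "emeasure M O' < \<infinity>" and A: "A \<in> sets M"
  shows "almost_fixed (A \<inter> O')"
proof -
  have OS[measurable]: "O' \<in> sets M" using O by (simp add: sets_M openin_sets_borel_of)
  have fin: "emeasure M B < \<infinity>" if "B \<subseteq> O'" for B
    using le_less_trans[OF emeasure_mono[OF that OS] O(2)] .
  have "A \<in> sigma_sets (topspace T) {U. openin T U}" using A by (simp add: sets_M sets_borel_of)
  then show ?thesis
  proof induction
    case (Basic U)
    then show ?case using O fin[of "U \<inter> O'"] by (intro almost_fixed_open) auto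
  next
    case Empty
    then show ?case by (simp add: almost_fixed_empty)
  next
    case (Compl A)
    let ?A = "A \<inter> O'"
    have AS[measurable]: "?A \<in> sets M" using Compl.IH by (auto simp: almost_fixed_def)
    have eq: "(topspace T - A) \<inter> O' = O' - ?A" using openin_subset[OF O(1)] by auto
    have "almost_fixed (O' - ?A)"
      unfolding almost_fixed_def
    proof (intro conjI allI impI)
      show "O' - ?A \<in> sets M" by measurable
      fix e :: real assume "e > 0"
      then have e: "e / 2 > 0" by simp
      obtain N where N: "open N" "0 \<in> N" "\<And>n. n \<in> N \<Longrightarrow> emeasure M (?A - (act n -` ?A \<inter> space M)) \<le> ennreal (e/2)"
        using almost_fixedD[OF Compl.IH e] by blast
      obtain N' where N': "open N'" "0 \<in> N'" "\<And>n. n \<in> N' \<Longrightarrow> emeasure M (O' - (act n -` O' \<inter> space M)) \<le> ennreal (e/2)"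
        using almost_fixedD[OF almost_fixed_open[OF O] e] by blast
      have "emeasure M (O' - ?A - (act n -` (O' - ?A) \<inter> space M)) \<le> ennreal e" if "n \<in> N \<inter> N'" for n
      proof -
        \<comment> \<open>A point of \<open>O' - ?A\<close> that leaves this set either leaves
          \<open>O'\<close> or enters \<open>?A\<close>. What enters \<open>?A\<close> has the same
          measure as what leaves it, which the induction hypothesis controls.\<close>
        have "O' - ?A - (act n -` (O' - ?A) \<inter> space M) \<subseteq>
          (O' - (act n -` O' \<inter> space M)) \<union> (act n -` ?A \<inter> space M - ?A)"
          using sets.sets_into_space[OF OS] by auto
        moreover have "emeasure M (act n -` ?A \<inter> space M - ?A) \<le> ennreal (e/2)"
          using N(3)[of n] that emeasure_act_diff[OF AS fin] by simp
        ultimately show ?thesis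
          using emeasure_le_add[OF _ _ _ N'(3)[of n], of _ "act n -` ?A \<inter> space M - ?A"] that e
            act_vimage_sets[OF AS, of n] AS act_vimage_sets[OF OS, of n] by (simp del: vimage_Int)
      qed
      then show "\<exists>N. open N \<and> 0 \<in> N \<and> (\<forall>n\<in>N. emeasure M (O' - ?A - (act n -` (O' - ?A) \<inter> space M)) \<le> ennreal e)"
        using N N' by (intro exI[of _ "N \<inter> N'"]) auto
    qed
    then show ?case by (simp add: eq)
  next
    case (Union A)
    have "almost_fixed (\<Union>i. A i \<inter> O')"
      by (intro almost_fixed_countable_Union Union.IH fin) auto
    then show ?case by (simp add: UN_simps)
  qed
qed

lemma act_sym_diff_small:
  assumes O: "openin T O'" "emeasure M O' < \<infinity>" and A: "A \<in> sets M" "A \<subseteq> O'" and e: "e > 0"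
  obtains N where "open N" "0 \<in> N"
    "\<And>n. n \<in> N \<Longrightarrow> emeasure M (sym_diff (act n -` A \<inter> space M) A) \<le> ennreal e"
proof -
  have AO: "A \<inter> O' = A" using A by auto
  have [measurable]: "A \<in> sets M" by fact
  have OS: "O' \<in> sets M" using O by (simp add: sets_M openin_sets_borel_of)
  have fin: "emeasure M A < \<infinity>" using le_less_trans[OF emeasure_mono[OF A(2) OS] O(2)] .
  have e2: "e / 2 > 0" using e by simp
  obtain N where N: "open N" "0 \<in> N" "\<And>n. n \<in> N \<Longrightarrow> emeasure M (A - (act n -` A \<inter> space M)) \<le> ennreal (e/2)"
    using almost_fixedD[OF almost_fixed_Int[OF O A(1)] e2] unfolding AO by blast
  have "emeasure M (sym_diff (act n -` A \<inter> space M) A) \<le> ennreal e" if "n \<in> N" for n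
    using emeasure_le_add[of "sym_diff (act n -` A \<inter> space M) A" "act n -` A \<inter> space M - A" "A - (act n -` A \<inter> space M)" "e/2"]
      N(3)[OF that] emeasure_act_diff[OF A(1) fin, of n] e by auto
  then show ?thesis using that N by blast
qed

end

subsection \<open>The quotient space\<close>

locale coset_quotient =
  fixes \<Gamma> :: "'l::{topological_group_add,t2_space,second_countable_topology} set"
  assumes subgroup: "add_subgroup \<Gamma>"
begin

abbreviation "\<T> \<equiv> coset_topology \<Gamma>"
abbreviation "\<Y> \<equiv> coset_space \<Gamma>"

lemma zero_in: "0 \<in> \<Gamma>" and add_in: "x \<in> \<Gamma> \<Longrightarrow> y \<in> \<Gamma> \<Longrightarrow> x + y \<in> \<Gamma>" and minus_in: "x \<in> \<Gamma> \<Longrightarrow> - x \<in> \<Gamma>"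
  using subgroup by (auto simp: add_subgroup_def)

lemma mem_coset: "z \<in> x +o \<Gamma> \<longleftrightarrow> - x + z \<in> \<Gamma>"
proof
  assume "- x + z \<in> \<Gamma>"
  then have "x + (- x + z) \<in> x +o \<Gamma>" by (rule set_plus_intro2)
  then show "z \<in> x +o \<Gamma>" by (simp flip: add.assoc)
qed (auto simp: elt_set_plus_def simp flip: add.assoc)

lemma coset_self: "x \<in> x +o \<Gamma>"
  by (simp add: mem_coset zero_in)

lemma coset_add_right: "\<gamma> \<in> \<Gamma> \<Longrightarrow> (x + \<gamma>) +o \<Gamma> = x +o \<Gamma>"
proof (rule set_eqI)
  fix z assume g: "\<gamma> \<in> \<Gamma>"
  have "- (x + \<gamma>) + z = - \<gamma> + (- x + z)" by (simp only: minus_add add.assoc)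
  moreover have "- x + z = \<gamma> + (- \<gamma> + (- x + z))" by (simp only: add.assoc[symmetric] right_minus add_0_left)
  ultimately show "z \<in> (x + \<gamma>) +o \<Gamma> \<longleftrightarrow> z \<in> x +o \<Gamma>"
    unfolding mem_coset using g add_in minus_in by metis
qed

lemma coset_eqI: "z \<in> x +o \<Gamma> \<Longrightarrow> z +o \<Gamma> = x +o \<Gamma>"
  using coset_add_right by (auto simp: elt_set_plus_def[of x])

lemma coset_eq_iff: "z +o \<Gamma> = x +o \<Gamma> \<longleftrightarrow> z \<in> x +o \<Gamma>"
  using coset_eqI coset_self by metis

lemma coset_in_space [simp]: "x +o \<Gamma> \<in> \<Y>"
  by (simp add: coset_space_def)

lemma coset_spaceE:
  assumes "y \<in> \<Y>" obtains x where "y = x +o \<Gamma>"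
  using assms by (auto simp: coset_space_def)

lemma coset_translate: "l +o (x +o \<Gamma>) = (l + x) +o \<Gamma>"
  by (rule set_plus_rearrange2)

lemma coset_zero [simp]: "0 +o y = (y :: 'l set)"
  by (auto simp: elt_set_plus_def)

lemma coset_translate_space: "y \<in> \<Y> \<Longrightarrow> l +o y \<in> \<Y>"
  by (elim coset_spaceE) (simp add: coset_translate)

text \<open>The saturation of \<open>V\<close> is the union of its right translates by lattice
  elements.\<close>

lemma openin_coset_image:
  assumes "open V" shows "openin \<T> ((\<lambda>x. x +o \<Gamma>) ` V)"
  unfolding openin_coset_topology
proof
  have "{x. x +o \<Gamma> \<in> (\<lambda>x. x +o \<Gamma>) ` V} = (\<Union>\<gamma>\<in>\<Gamma>. {x. x + \<gamma> \<in> V})" (is "?L = ?R")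
  proof (intro equalityI subsetI)
    fix x assume "x \<in> ?L"
    then obtain v where v: "v \<in> V" "v \<in> x +o \<Gamma>" using coset_eq_iff by blast
    then obtain \<gamma> where "\<gamma> \<in> \<Gamma>" "v = x + \<gamma>" by (auto simp: elt_set_plus_def)
    then show "x \<in> ?R" using v by auto
  next
    fix x assume "x \<in> ?R"
    then obtain \<gamma> where g: "\<gamma> \<in> \<Gamma>" "x + \<gamma> \<in> V" by blast
    show "x \<in> ?L" using coset_add_right[OF g(1), of x] g(2) by (auto intro!: image_eqI[of _ _ "x + \<gamma>"])
  qed
  moreover have "open (\<Union>\<gamma>\<in>\<Gamma>. {x. x + \<gamma> \<in> V})"
    using assms by (intro open_UN ballI open_right_translate)
  ultimately show "open {x. x +o \<Gamma> \<in> (\<lambda>x. x +o \<Gamma>) ` V}" by simp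
qed (auto simp: coset_space_def)

lemma openin_coset_vimage: "openin \<T> U \<Longrightarrow> open {x. x +o \<Gamma> \<in> U}"
  by (simp add: openin_coset_topology)

lemma coset_measurable [measurable]: "(\<lambda>x. x +o \<Gamma>) \<in> measurable borel (borel_of \<T>)"
  by (rule measurable_borel_ofI)
    (auto simp: topspace_coset_topology vimage_def intro!: borel_open openin_coset_vimage)

lemma coset_vimage_sets:
  assumes "N \<in> sets (borel_of \<T>)" shows "{x. x +o \<Gamma> \<in> N} \<in> sets borel"
  using measurable_sets[OF coset_measurable assms] by (simp add: vimage_def)

lemma coset_act_nbhds:
  assumes U: "openin \<T> U" and y: "l +o y \<in> U" "y \<in> \<Y>"
  obtains N V where "open N" "l \<in> N" "openin \<T> V" "y \<in> V"
    "\<And>n v. n \<in> N \<Longrightarrow> v \<in> V \<Longrightarrow> n +o v \<in> U"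
proof -
  obtain x where x: "y = x +o \<Gamma>" using y(2) by (rule coset_spaceE)
  have "l + x \<in> {x. x +o \<Gamma> \<in> U}" using y x by (simp add: coset_translate)
  then obtain N V where NV: "open N" "open V" "l \<in> N" "x \<in> V" "\<And>n v. n \<in> N \<Longrightarrow> v \<in> V \<Longrightarrow> n + v \<in> {x. x +o \<Gamma> \<in> U}"
    using open_add_nbhds[OF openin_coset_vimage[OF U]] by metis
  show ?thesis
    by (rule that[of N "(\<lambda>x. x +o \<Gamma>) ` V"]) (use NV x openin_coset_image in \<open>auto simp: coset_translate\<close>)
qed

lemma Lindelof_coset:
  assumes \<V>: "\<And>V. V \<in> \<V> \<Longrightarrow> openin \<T> V"
  shows "\<exists>\<V>'. \<V>' \<subseteq> \<V> \<and> countable \<V>' \<and> \<Union>\<V>' = \<Union>\<V>"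
proof -
  let ?p = "\<lambda>V. {x. x +o \<Gamma> \<in> V}"
  obtain \<W> where W: "\<W> \<subseteq> ?p ` \<V>" "countable \<W>" "\<Union>\<W> = \<Union>(?p ` \<V>)"
    using Lindelof[of "?p ` \<V>"] openin_coset_vimage \<V> by blast
  obtain \<V>' where V': "\<V>' \<subseteq> \<V>" "countable \<V>'" "\<W> = ?p ` \<V>'"
    using W(1,2) countable_subset_image[of \<W> ?p \<V>] by auto
  have "\<Union>\<V> \<subseteq> \<Union>\<V>'"
  proof
    fix y assume "y \<in> \<Union>\<V>"
    then obtain V where V: "V \<in> \<V>" "y \<in> V" by blast
    then have "y \<in> \<Y>" using \<V> by (auto simp: openin_coset_topology)
    then obtain x where "y = x +o \<Gamma>" by (rule coset_spaceE)
    then have "x \<in> \<Union>\<W>" unfolding W(3) using V by blast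
    then show "y \<in> \<Union>\<V>'" unfolding V'(3) using \<open>y = x +o \<Gamma>\<close> by blast
  qed
  then show ?thesis using V' by blast
qed

text \<open>Joint continuity would only give an open preimage, whereas membership in the product
  sigma-algebra needs a countable union of measurable rectangles. A countable basis of the group
  supplies them: pairs of basic sets whose sums project into \<open>U\<close>.\<close>

lemma coset_act_measurable_pair:
  "(\<lambda>p. fst p +o snd p) \<in> measurable (borel \<Otimes>\<^sub>M borel_of \<T>) (borel_of \<T>)"
proof (rule measurable_borel_ofI)
  show "(\<lambda>p. fst p +o snd p) \<in> space (borel \<Otimes>\<^sub>M borel_of \<T>) \<rightarrow> topspace \<T>"
    by (auto simp: space_pair_measure topspace_coset_topology coset_translate_space)
next
  fix U assume U: "openin \<T> U"
  obtain \<B> :: "'l set set" where B: "countable \<B>" "topological_basis \<B>"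
    using ex_countable_basis by blast
  let ?p = "\<lambda>x. x +o \<Gamma>"
  define \<P> where "\<P> = {P \<in> \<B> \<times> \<B>. \<forall>n\<in>fst P. \<forall>v\<in>snd P. (n + v) +o \<Gamma> \<in> U}"
  have cP: "countable \<P>" unfolding \<P>_def using B(1)
    by (intro countable_subset[OF _ countable_SIGMA[of \<B> "\<lambda>_. \<B>"]]) auto
  have "(\<lambda>p. fst p +o snd p) -` U \<inter> space (borel \<Otimes>\<^sub>M borel_of \<T>)
      = (\<Union>P\<in>\<P>. fst P \<times> (?p ` snd P))" (is "?L = ?R")
  proof (intro equalityI subsetI)
    fix q assume q: "q \<in> ?L"
    obtain l y where ly: "q = (l, y)" by (cases q)
    have "y \<in> \<Y>" "l +o y \<in> U" using q ly
      by (auto simp: space_pair_measure topspace_coset_topology)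
    then obtain x where x: "y = x +o \<Gamma>" "(l + x) +o \<Gamma> \<in> U"
      using coset_spaceE coset_translate by metis
    then obtain N V where NV: "open N" "open V" "l \<in> N" "x \<in> V" "\<And>n v. n \<in> N \<Longrightarrow> v \<in> V \<Longrightarrow> n + v \<in> {x. x +o \<Gamma> \<in> U}"
      using open_add_nbhds[OF openin_coset_vimage[OF U], of l x] by blast
    obtain B1 B2 where "B1 \<in> \<B>" "l \<in> B1" "B1 \<subseteq> N" "B2 \<in> \<B>" "x \<in> B2" "B2 \<subseteq> V"
      using topological_basisE[OF B(2)] NV(1-4) by metis
    then show "q \<in> ?R" using NV(5) x(1) ly
      by (intro UN_I[of "(B1, B2)"]) (auto simp: \<P>_def subset_eq)
  next
    fix q assume "q \<in> ?R"
    then show "q \<in> ?L" by (auto simp: \<P>_def space_pair_measure topspace_coset_topology coset_translate)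
  qed
  moreover have "?R \<in> sets (borel \<Otimes>\<^sub>M borel_of \<T>)"
  proof (rule sets.countable_UN''[OF cP])
    fix P assume "P \<in> \<P>"
    then have "open (fst P)" "open (snd P)" using topological_basis_open[OF B(2)] by (auto simp: \<P>_def)
    then show "fst P \<times> (?p ` snd P) \<in> sets (borel \<Otimes>\<^sub>M borel_of \<T>)"
      by (intro pair_measureI openin_sets_borel_of openin_coset_image borel_open)
  qed
  ultimately show "(\<lambda>p. fst p +o snd p) -` U \<inter> space (borel \<Otimes>\<^sub>M borel_of \<T>)
    \<in> sets (borel \<Otimes>\<^sub>M borel_of \<T>)" by simp
qed

lemma coset_act_measurable [measurable]:
  "(+o) l \<in> measurable (borel_of \<T>) (borel_of \<T>)"
proof -
  have "(\<lambda>y. (l, y)) \<in> measurable (borel_of \<T>) (borel \<Otimes>\<^sub>M borel_of \<T>)"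
    by measurable
  from measurable_comp[OF this coset_act_measurable_pair] show ?thesis by (simp add: comp_def)
qed

text \<open>Integrate the indicator of \<open>N\<close> at \<open>l +o y\<close> over
  \<open>l\<close> and \<open>y\<close>. Integrating in \<open>y\<close> first gives
  \<open>emeasure mY N\<close> for each \<open>l\<close> by invariance; integrating in
  \<open>l\<close> first gives, at the coset of \<open>x\<close>, the Haar measure of the right
  translate of the preimage of \<open>N\<close> by -x. Right translates keep null sets, so vanishing
  passes between the two sides.\<close>

lemma emeasure_quotient_null_iff:
  assumes mY: "prob_measure_on \<T> mY" "invariant_measure (+o) mY"
    and h: "haar_measure m" "sigma_finite_measure m"
    and N: "N \<in> sets (borel_of \<T>)"
  shows "emeasure mY N = 0 \<longleftrightarrow> emeasure m {x. x +o \<Gamma> \<in> N} = 0"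
proof -
  interpret Y: prob_space mY using mY by (simp add: prob_measure_on_def)
  interpret L: sigma_finite_measure m by fact
  interpret LY: pair_sigma_finite m mY ..
  have sY [measurable_cong]: "sets mY = sets (borel_of \<T>)"
    using mY by (simp add: prob_measure_on_def)
  have sL [measurable_cong]: "sets m = sets borel" using h by (simp add: haar_measure_def)
  have spY: "space mY = \<Y>" using sets_eq_imp_space_eq[OF sY] by (simp add: topspace_coset_topology)
  have spL: "space m = UNIV" using sets_eq_imp_space_eq[OF sL] by simp
  have mp: "(\<lambda>p. fst p +o snd p) \<in> measurable (m \<Otimes>\<^sub>M mY) mY"
    using coset_act_measurable_pair measurable_cong_sets[OF sets_pair_measure_cong[OF sL sY] sY] by auto
  let ?f = "\<lambda>l y. indicator N (l +o y) :: ennreal"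
  have [measurable]: "N \<in> sets mY" using N sY by simp
  have "(\<lambda>p. indicator N (fst p +o snd p) :: ennreal) \<in> borel_measurable (m \<Otimes>\<^sub>M mY)"
    using mp by measurable
  then have meas: "(\<lambda>(l, y). ?f l y) \<in> borel_measurable (m \<Otimes>\<^sub>M mY)" by (simp add: case_prod_beta')
  have 1: "(\<integral>\<^sup>+ y. ?f l y \<partial>mY) = emeasure mY N" for l
  proof -
    have am: "(+o) l \<in> measurable mY mY" by measurable
    have "(\<integral>\<^sup>+ y. ?f l y \<partial>mY) = (\<integral>\<^sup>+ y. indicator N y \<partial>distr mY mY ((+o) l))"
      by (subst nn_integral_distr[OF am]) auto
    also have "\<dots> = emeasure mY N" using mY(2) by (simp add: invariant_measure_def)
    finally show ?thesis .
  qed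
  have NL: "{x. x +o \<Gamma> \<in> N} \<in> sets borel" using N by (rule coset_vimage_sets)
  have 2: "(\<integral>\<^sup>+ l. ?f l (x +o \<Gamma>) \<partial>m) = emeasure m {l. l + x \<in> {x. x +o \<Gamma> \<in> N}}" for x
  proof -
    have S: "{l. l + x \<in> {x. x +o \<Gamma> \<in> N}} \<in> sets m"
      using measurable_sets_borel[of "\<lambda>l. l + x" borel, OF _ NL] by (simp add: vimage_def sL)
    have "(\<integral>\<^sup>+ l. ?f l (x +o \<Gamma>) \<partial>m) = (\<integral>\<^sup>+ l. indicator {l. l + x \<in> {x. x +o \<Gamma> \<in> N}} l \<partial>m)"
      by (intro nn_integral_cong) (simp add: coset_translate indicator_def)
    then show ?thesis using nn_integral_indicator[OF S] by simp
  qed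
  have eq: "emeasure mY N * emeasure m UNIV = (\<integral>\<^sup>+ y. \<integral>\<^sup>+ l. ?f l y \<partial>m \<partial>mY)"
    using LY.Fubini'[OF meas] 1 by (simp add: spL)
  show ?thesis
  proof
    assume 0: "emeasure m {x. x +o \<Gamma> \<in> N} = 0"
    have "(\<integral>\<^sup>+ l. ?f l y \<partial>m) = 0" if "y \<in> space mY" for y
    proof -
      have "y \<in> \<Y>" using that spY by simp
      then obtain x where "y = x +o \<Gamma>" by (rule coset_spaceE)
      then show ?thesis using 2[of x] haar_null_right_translate[OF h NL 0] by simp
    qed
    then have "(\<integral>\<^sup>+ y. \<integral>\<^sup>+ l. ?f l y \<partial>m \<partial>mY) = (\<integral>\<^sup>+ y. 0 \<partial>mY)" by (intro nn_integral_cong)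
    then have "emeasure mY N * emeasure m UNIV = 0" unfolding eq by simp
    moreover have "emeasure m UNIV \<noteq> 0" using h by (auto simp: haar_measure_def)
    ultimately show "emeasure mY N = 0" by simp
  next
    assume "emeasure mY N = 0"
    then have "(\<integral>\<^sup>+ y. \<integral>\<^sup>+ l. ?f l y \<partial>m \<partial>mY) = 0" using eq by simp
    then have ae: "AE y in mY. (\<integral>\<^sup>+ l. ?f l y \<partial>m) = 0"
      using LY.Fubini'[OF meas] L.borel_measurable_nn_integral[of "\<lambda>y l. ?f l y" mY]
        measurable_compose[OF measurable_pair_swap' meas]
      by (subst nn_integral_0_iff_AE[symmetric]) (auto simp: case_prod_beta')
    \<comment> \<open>One coset suffices: its right translate of the preimage is null, and
      translating back by a representative gives the preimage itself.\<close>
    have "\<exists>y\<in>space mY. (\<integral>\<^sup>+ l. ?f l y \<partial>m) = 0"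
    proof (rule ccontr)
      assume n: "\<not> ?thesis"
      have "AE y in mY. False" using ae AE_space by eventually_elim (use n in blast)
      then show False by (simp add: Y.AE_False)
    qed
    then obtain x where "(\<integral>\<^sup>+ l. ?f l (x +o \<Gamma>) \<partial>m) = 0" using spY coset_spaceE by metis
    then have 0: "emeasure m {l. l + x \<in> {x. x +o \<Gamma> \<in> N}} = 0" using 2 by simp
    have "{l. l + x \<in> {x. x +o \<Gamma> \<in> N}} \<in> sets borel"
      using measurable_sets_borel[of "\<lambda>l. l + x" borel, OF _ NL] by (simp add: vimage_def)
    from haar_null_right_translate[OF h this 0, of "- x"]
    show "emeasure m {x. x +o \<Gamma> \<in> N} = 0" by (simp add: add.assoc)
  qed
qed

text \<open>A neighbourhood \<open>x + V\<close> with \<open>V\<close> so small that \<open>- V + V\<close> meets \<open>\<Gamma>\<close> only in \<open>0\<close> contains at most one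
  point of \<open>\<Gamma>\<close>.\<close>

lemma closed_of_discrete:
  assumes "discrete \<Gamma>" shows "closed \<Gamma>"
proof -
  obtain N where N: "open N" "N \<inter> \<Gamma> = {0}"
    using assms zero_in unfolding discrete_def isolated_in_def by metis
  have "0 + 0 \<in> N" using N(2) by auto
  then obtain A B where AB: "open A" "open B" "0 \<in> A" "0 \<in> B" "\<And>a b. a \<in> A \<Longrightarrow> b \<in> B \<Longrightarrow> a + b \<in> N"
    using open_add_nbhds[OF N(1)] by metis
  define V where "V = {v. - v \<in> A} \<inter> B"
  have V: "open V" "0 \<in> V" "\<And>v w. v \<in> V \<Longrightarrow> w \<in> V \<Longrightarrow> - v + w \<in> N"
    unfolding V_def using AB open_uminus_group[OF AB(1)] by auto
  have "x \<in> \<Gamma>" if x: "x \<in> closure \<Gamma>" for x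
  proof (rule ccontr)
    assume nx: "x \<notin> \<Gamma>"
    define U where "U = {z. - x + z \<in> V}"
    have U: "open U" "x \<in> U" unfolding U_def using V open_left_translate by auto
    then obtain a where a: "a \<in> \<Gamma>" "a \<in> U"
      using x open_Int_closure_eq_empty[of U \<Gamma>] by blast
    have "open (U - {a})" "x \<in> U - {a}" using U nx a by (auto intro: open_delete)
    then obtain b where b: "b \<in> \<Gamma>" "b \<in> U" "b \<noteq> a"
      using x open_Int_closure_eq_empty[of "U - {a}" \<Gamma>] by blast
    have "- (- x + a) + (- x + b) \<in> N" using a b V(3) unfolding U_def by blast
    moreover have "- (- x + a) + (- x + b) = - a + b" by (simp only: minus_add minus_minus add.assoc add_minus_cancel)
    ultimately have "- a + b \<in> N \<inter> \<Gamma>" using a(1) b(1) add_in minus_in by simp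
    then have "- a + b = 0" using N(2) by simp
    then show False using b(3) by (metis add_minus_cancel add_0_right)
  qed
  then show ?thesis by (metis closure_subset closure_eq subsetI subset_antisym)
qed

text \<open>The tube lemma for the closed condition that -x + k lies in the lattice. It serves the
  miss sets of the Chabauty-Fell topology and the measurability of the singular cosets.\<close>

lemma openin_coset_disjoint:
  assumes cl: "closed \<Gamma>" and K: "compact K"
  shows "openin \<T> {y \<in> \<Y>. y \<inter> K = {}}"
  unfolding openin_coset_topology
proof
  have "open {x. \<forall>k\<in>K. - x + k \<notin> \<Gamma>}"
  proof (subst open_subopen, intro ballI)
    fix x assume x: "x \<in> {x. \<forall>k\<in>K. - x + k \<notin> \<Gamma>}"
    define W where "W = (\<lambda>p::'l\<times>'l. - fst p + snd p) -` (- \<Gamma>)"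
    have oW: "open W" unfolding W_def using cl by (intro open_vimage continuous_intros open_Compl)
    have "{x} \<times> K \<subseteq> W" using x by (auto simp: W_def)
    then obtain X0 where "x \<in> X0" "open X0" "X0 \<times> K \<subseteq> W"
      using Elementary_Topology.tube_lemma[OF K oW] by metis
    then show "\<exists>T. open T \<and> x \<in> T \<and> T \<subseteq> {x. \<forall>k\<in>K. - x + k \<notin> \<Gamma>}"
      by (intro exI[of _ X0]) (auto simp: W_def)
  qed
  moreover have "{x. x +o \<Gamma> \<in> {y \<in> \<Y>. y \<inter> K = {}}} = {x. \<forall>k\<in>K. - x + k \<notin> \<Gamma>}"
    by (auto simp flip: mem_coset)
  ultimately show "open {x. x +o \<Gamma> \<in> {y \<in> \<Y>. y \<inter> K = {}}}" by simp
qed auto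

lemma closed_coset:
  assumes "closed \<Gamma>" "y \<in> \<Y>" shows "closed y"
proof -
  obtain x where x: "y = x +o \<Gamma>" using assms(2) by (rule coset_spaceE)
  have "- y = {z. - x + z \<in> - \<Gamma>}" by (auto simp: x mem_coset)
  then show ?thesis unfolding closed_def using open_left_translate[of "- \<Gamma>" "- x"] assms(1) by (simp add: open_Compl)
qed

end

subsection \<open>Ergodicity of the action on the quotient\<close>

lemma haar_continuous_mp_action:
  fixes m :: "'l::{topological_group_add,t2_space,second_countable_topology} measure"
  assumes "haar_measure m"
  shows "continuous_mp_action euclidean m (+)"
proof
  show s: "sets m = sets (borel_of euclidean)" using assms by (simp add: haar_measure_def borel_of_euclidean)
  show "(+) l \<in> measurable m m" for l
    using measurable_cong_sets[OF s s] by (simp add: borel_of_euclidean)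
  show "distr m m ((+) l) = m" for l using assms by (simp add: haar_measure_def invariant_measure_def)
  show "\<exists>N V. open N \<and> 0 \<in> N \<and> openin euclidean V \<and> x \<in> V \<and> (\<forall>n\<in>N. \<forall>v\<in>V. n + v \<in> U)"
    if "openin euclidean U" "x \<in> U" for x :: 'l and U
  proof -
    have "open U" "0 + x \<in> U" using \<open>openin euclidean U\<close> \<open>x \<in> U\<close> by auto
    then obtain N V where "open N" "open V" "0 \<in> N" "x \<in> V" "\<And>n v. n \<in> N \<Longrightarrow> v \<in> V \<Longrightarrow> n + v \<in> U"
      by (rule open_add_nbhds) (rule that)
    then show ?thesis by auto
  qed
  show "\<exists>\<V>'. \<V>' \<subseteq> \<V> \<and> countable \<V>' \<and> \<Union>\<V>' = \<Union>\<V>" if "\<And>V. V \<in> \<V> \<Longrightarrow> openin euclidean V" for \<V> :: "'l set set"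
    using Lindelof[of \<V>] that by (metis open_openin)
qed

lemma haar_finite_open_nbhd:
  assumes "locally_compact_space (euclidean :: 'l::{topological_group_add,t2_space,second_countable_topology} topology)"
    and "haar_measure (m :: 'l measure)"
  obtains O' where "open O'" "x \<in> O'" "emeasure m O' < \<infinity>"
proof -
  have "\<exists>U K. open U \<and> compact K \<and> x \<in> U \<and> U \<subseteq> K"
    using assms(1) unfolding locally_compact_space_def by simp
  then obtain U K where UK: "open U" "compact K" "x \<in> U" "U \<subseteq> K"
    by metis
  have "emeasure m U \<le> emeasure m K"
    using UK assms(2) by (intro emeasure_mono) (auto simp: haar_measure_def compact_imp_closed)
  also have "\<dots> < \<infinity>" using UK assms(2) by (auto simp: haar_measure_def)
  finally show ?thesis using that UK by blast
qed

text \<open>Countably many open sets of finite measure cover the group, so they cannot all meet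
  \<open>A\<close> in a null set. This brings \<open>A\<close> into the range of
  \<open>almost_fixed_Int\<close>.\<close>

lemma emeasure_pos_Int_open:
  fixes m :: "'l::{topological_group_add,t2_space,second_countable_topology} measure"
  assumes lc: "locally_compact_space (euclidean :: 'l topology)" and h: "haar_measure m"
    and A: "A \<in> sets borel" "emeasure m A \<noteq> 0"
  obtains O' where "open O'" "emeasure m O' < \<infinity>" "emeasure m (A \<inter> O') \<noteq> 0"
proof -
  have s: "sets m = sets borel" using h by (simp add: haar_measure_def)
  let ?\<F> = "{O'. open O' \<and> emeasure m O' < \<infinity>}"
  obtain \<F> where F: "\<F> \<subseteq> ?\<F>" "countable \<F>" "\<Union>\<F> = \<Union>?\<F>"
    using Lindelof[of ?\<F>] by auto
  have "x \<in> \<Union>?\<F>" for x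
    using haar_finite_open_nbhd[OF lc h, of x] by blast
  then have U: "A = (\<Union>O'\<in>\<F>. A \<inter> O')" using F(3) by auto
  have "\<exists>O'\<in>\<F>. emeasure m (A \<inter> O') \<noteq> 0"
  proof (rule ccontr)
    assume n: "\<not> ?thesis"
    have "(\<Union>O'\<in>\<F>. A \<inter> O') \<in> null_sets m"
      using n F A s by (intro null_sets_UN' null_setsI) (auto 0 3)
    then show False using A(2) U by auto
  qed
  then show ?thesis using F(1) that by blast
qed

text \<open>Translating by elements \<open>h\<close> close to a suitable \<open>h\<^sub>0\<close>, one can move a point of \<open>- B\<close> into \<open>- C\<close>;
  by density \<open>h\<close> can be chosen in \<open>D\<close>, contradicting the invariance.\<close>

lemma dense_invariant_null:
  fixes m :: "'l::{topological_group_add,t2_space,second_countable_topology} measure"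
  assumes lc: "locally_compact_space (euclidean :: 'l topology)" and h: "haar_measure m"
    and D: "closure D = UNIV"
    and BC: "B \<in> sets borel" "C \<in> sets borel" "B \<inter> C = {}"
    and inv: "\<And>d x. d \<in> D \<Longrightarrow> x \<in> B \<Longrightarrow> x - d \<in> B"
  shows "emeasure m B = 0 \<or> emeasure m C = 0"
proof (rule ccontr)
  assume "\<not> ?thesis"
  then have pos: "emeasure m B \<noteq> 0" "emeasure m C \<noteq> 0" by auto
  have sf: "sigma_finite_measure m" using lc h by (rule haar_measure_sigma_finite)
  interpret continuous_mp_action euclidean m "(+)" using h by (rule haar_continuous_mp_action)
  interpret pair_sigma_finite m m using sf by (simp add: pair_sigma_finite_def)
  have s [measurable_cong]: "sets m = sets borel" using h by (auto simp: haar_measure_def)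
  have sp: "space m = UNIV" using sets_eq_imp_space_eq[OF s] by simp
  \<comment> \<open>Inversion turns the right translations of \<open>inv\<close> into left
    translations, under which \<open>m\<close> is invariant.\<close>
  define B' where "B' = {x. - x \<in> B}"
  define C' where "C' = {x. - x \<in> C}"
  have [measurable]: "B \<in> sets borel" "C \<in> sets borel" "B' \<in> sets borel" "C' \<in> sets borel"
    using BC measurable_sets_borel[of uminus borel] by (auto simp: vimage_def B'_def C'_def)
  have C'pos: "emeasure m C' \<noteq> 0"
    using haar_null_uminus[OF h sf, of C'] pos(2) unfolding C'_def by auto
  \<comment> \<open>The double integral equals \<open>emeasure m C' * emeasure m B\<close>, which is
    not zero. Hence for some \<open>g\<close> the set \<open>C'\<close> meets \<open>g +o B'\<close>
    in positive measure; \<open>E\<close> below is this overlap moved back into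
    \<open>B'\<close>.\<close>
  let ?f = "\<lambda>g x. indicator C' x * indicator B' (- g + x) :: ennreal"
  have "(\<integral>\<^sup>+ x. \<integral>\<^sup>+ g. ?f g x \<partial>m \<partial>m) = (\<integral>\<^sup>+ g. \<integral>\<^sup>+ x. ?f g x \<partial>m \<partial>m)"
    by (intro Fubini'[symmetric]) measurable
  moreover have "(\<integral>\<^sup>+ g. ?f g x \<partial>m) = indicator C' x * emeasure m B" for x
  proof -
    have "(\<integral>\<^sup>+ g. ?f g x \<partial>m) = indicator C' x * (\<integral>\<^sup>+ g. indicator B' (- g + x) \<partial>m)"
      by (rule nn_integral_cmult) measurable
    also have "(\<integral>\<^sup>+ g. indicator B' (- g + x) \<partial>m) = (\<integral>\<^sup>+ g. indicator {g. - x + g \<in> B} g \<partial>m)"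
      by (intro nn_integral_cong) (simp add: indicator_def B'_def minus_add)
    also have "\<dots> = emeasure m {g. - x + g \<in> B}"
      by (rule nn_integral_indicator) measurable
    also have "\<dots> = emeasure m B" by (rule haar_emeasure_translate[OF h]) measurable
    finally show ?thesis .
  qed
  moreover have "(\<integral>\<^sup>+ x. indicator C' x * emeasure m B \<partial>m) = emeasure m C' * emeasure m B"
    by (subst nn_integral_multc) (auto simp: s)
  ultimately have "(\<integral>\<^sup>+ g. \<integral>\<^sup>+ x. ?f g x \<partial>m \<partial>m) = emeasure m C' * emeasure m B"
    by simp
  then have "(\<integral>\<^sup>+ g. \<integral>\<^sup>+ x. ?f g x \<partial>m \<partial>m) \<noteq> 0"
    using C'pos pos by (simp only: mult_eq_0_iff) simp
  then have "\<exists>g. (\<integral>\<^sup>+ x. ?f g x \<partial>m) \<noteq> 0"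
    by (rule contrapos_np) simp
  then obtain g where g: "(\<integral>\<^sup>+ x. ?f g x \<partial>m) \<noteq> 0" by blast
  define E where "E = {x. x \<in> B' \<and> g + x \<in> C'}"
  have [measurable]: "E \<in> sets borel"
  proof -
    have "(\<lambda>x. g + x) -` C' \<in> sets borel" using measurable_sets_borel[of "(+) g" borel C'] by simp
    then have "B' \<inter> (\<lambda>x. g + x) -` C' \<in> sets borel" by auto
    moreover have "E = B' \<inter> (\<lambda>x. g + x) -` C'" by (auto simp: E_def)
    ultimately show ?thesis by simp
  qed
  have "(\<integral>\<^sup>+ x. ?f g x \<partial>m) = (\<integral>\<^sup>+ x. indicator {x. - g + x \<in> E} x \<partial>m)"
    by (intro nn_integral_cong) (auto simp: indicator_def E_def simp flip: add.assoc)
  also have "\<dots> = emeasure m {x. - g + x \<in> E}" by (rule nn_integral_indicator) measurable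
  also have "\<dots> = emeasure m E" by (rule haar_emeasure_translate[OF h]) measurable
  finally have "emeasure m E \<noteq> 0" using g by simp
  then obtain O' where O': "open O'" "emeasure m O' < \<infinity>" "emeasure m (E \<inter> O') \<noteq> 0"
    using emeasure_pos_Int_open[OF lc h, of E] \<open>E \<in> sets borel\<close> by blast
  define A where "A = {x. g + x \<in> C'}"
  have A[measurable]: "A \<in> sets m" unfolding A_def using measurable_sets_borel[of "(+) g" borel C'] by (simp add: vimage_def s)
  have O's[measurable]: "O' \<in> sets m" using O' s by simp
  have Es[measurable]: "E \<in> sets m" by (simp add: s)
  have af: "almost_fixed (A \<inter> O')" using O' A by (intro almost_fixed_Int) auto
  have Efin: "emeasure m (E \<inter> O') < \<infinity>"
    using le_less_trans[OF emeasure_mono[of "E \<inter> O'" O' m] O'(2)] O's by auto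
  have "\<exists>e>0. ennreal e < emeasure m (E \<inter> O')"
  proof (cases "emeasure m (E \<inter> O')" rule: ennreal_cases)
    case (real r)
    then have "r > 0" using O'(3) by (cases "r = 0") auto
    then show ?thesis using real by (intro exI[of _ "r / 2"]) (auto intro!: ennreal_lessI)
  qed (use Efin in auto)
  then obtain e where e: "e > 0" "ennreal e < emeasure m (E \<inter> O')" by blast
  obtain N where N: "open N" "0 \<in> N"
    "\<And>n. n \<in> N \<Longrightarrow> emeasure m (A \<inter> O' - ((+) n -` (A \<inter> O') \<inter> space m)) \<le> ennreal e"
    by (rule almost_fixedD[OF af e(1)]) (rule that)
  have "open {z. - g + z \<in> N}" using N(1) by (rule open_left_translate)
  moreover have "g \<in> {z. - g + z \<in> N}" using N(2) by simp
  ultimately obtain d where d: "d \<in> D" "- g + d \<in> N"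
    using D open_Int_closure_eq_empty[of "{z. - g + z \<in> N}" D] by blast
  define n where "n = - g + d"
  have dn: "d = g + n" by (simp add: n_def flip: add.assoc)
  \<comment> \<open>Translation by \<open>n\<close> loses at most \<open>e\<close> of
    \<open>A \<inter> O'\<close>, which is less than the measure of its subset
    \<open>E \<inter> O'\<close>; so some point of \<open>E\<close> stays in
    \<open>A\<close>.\<close>
  have "\<not> E \<inter> O' \<subseteq> A \<inter> O' - ((+) n -` (A \<inter> O') \<inter> space m)"
  proof
    assume "E \<inter> O' \<subseteq> A \<inter> O' - ((+) n -` (A \<inter> O') \<inter> space m)"
    then have "emeasure m (E \<inter> O') \<le> emeasure m (A \<inter> O' - ((+) n -` (A \<inter> O') \<inter> space m))"
      by (rule emeasure_mono) measurable
    with N(3)[of n] d e show False by (auto simp: n_def)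
  qed
  then obtain x where x: "x \<in> E" "n + x \<in> A" by (auto simp: E_def A_def sp)
  then have "- x \<in> B" "- (d + x) \<in> C" by (auto simp: E_def A_def B'_def C'_def dn add.assoc)
  moreover have "- (d + x) = - x - d" by (simp add: minus_add)
  ultimately show False using inv[OF d(1)] BC(3) by auto
qed

section \<open>The cut-and-project setting and ergodicity of the first factor\<close>

locale cut_project =
  fixes \<Gamma> :: "('g::{topological_group_add,t2_space,second_countable_topology}
                \<times> 'h::{topological_group_add,t2_space,second_countable_topology}) set"
    and mG :: "'g measure" and mH :: "'h measure" and mY :: "('g \<times> 'h) set measure"
  assumes lcG: "locally_compact_space (euclidean :: 'g topology)"
    and lcH: "locally_compact_space (euclidean :: 'h topology)"
    and haarG: "haar_measure mG" and haarH: "haar_measure mH"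
    and scheme: "cut_and_project_scheme \<Gamma>"
    and probY: "prob_measure_on (coset_topology \<Gamma>) mY" and invY: "invariant_measure (+o) mY"

sublocale cut_project \<subseteq> coset_quotient \<Gamma>
  using scheme by unfold_locales (simp add: cut_and_project_scheme_def group_lattice_def)

sublocale cut_project \<subseteq> Y: prob_space mY
  using probY by (simp add: prob_measure_on_def)

sublocale cut_project \<subseteq> G: sigma_finite_measure mG
  using lcG haarG by (rule haar_measure_sigma_finite)

sublocale cut_project \<subseteq> H: sigma_finite_measure mH
  using lcH haarH by (rule haar_measure_sigma_finite)

sublocale cut_project \<subseteq> GH: pair_sigma_finite mG mH ..

context cut_project
begin

lemma sets_mY [measurable_cong]: "sets mY = sets (borel_of \<T>)"
  using probY by (simp add: prob_measure_on_def)

lemma space_mY: "space mY = \<Y>"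
  using sets_eq_imp_space_eq[OF sets_mY] by (simp add: topspace_coset_topology)

lemma sets_mG [measurable_cong]: "sets mG = sets borel" and sets_mH [measurable_cong]: "sets mH = sets borel"
  using haarG haarH by (auto simp: haar_measure_def)

lemma space_mG: "space mG = UNIV"
  using sets_eq_imp_space_eq[OF sets_mG] by simp

lemma sets_mGH: "sets (mG \<Otimes>\<^sub>M mH) = sets borel"
  using sets_pair_measure_cong[OF sets_mG sets_mH] unfolding borel_prod .

lemma haarGH: "haar_measure (mG \<Otimes>\<^sub>M mH)" "sigma_finite_measure (mG \<Otimes>\<^sub>M mH)"
  using haar_measure_pair[OF haarG haarH G.sigma_finite_measure_axioms H.sigma_finite_measure_axioms] by auto

lemma emeasure_mY_null_iff:
  "N \<in> sets mY \<Longrightarrow> emeasure mY N = 0 \<longleftrightarrow> emeasure (mG \<Otimes>\<^sub>M mH) {x. x +o \<Gamma> \<in> N} = 0"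
  by (rule emeasure_quotient_null_iff[OF probY invY haarGH]) (simp add: sets_mY)

lemma dense_snd: "closure (snd ` \<Gamma>) = UNIV"
  using scheme by (simp add: cut_and_project_scheme_def)

sublocale act: continuous_mp_action \<T> mY "(+o)"
proof
  show "sets mY = sets (borel_of \<T>)" by (rule sets_mY)
  show "(+o) l \<in> measurable mY mY" for l by measurable
  show "distr mY mY ((+o) l) = mY" for l using invY unfolding invariant_measure_def by blast
  show "\<exists>N V. open N \<and> 0 \<in> N \<and> openin \<T> V \<and> x \<in> V \<and> (\<forall>n\<in>N. \<forall>v\<in>V. n +o v \<in> U)"
    if "openin \<T> U" "x \<in> U" for x U
  proof -
    have "0 +o x \<in> U" "x \<in> \<Y>"
      using openin_subset[OF \<open>openin \<T> U\<close>] \<open>x \<in> U\<close> by (auto simp: topspace_coset_topology)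
    then show ?thesis
      using coset_act_nbhds[OF \<open>openin \<T> U\<close>, of 0 x] by metis
  qed
qed (rule Lindelof_coset)

text \<open>The preimage \<open>L\<close> of \<open>A\<close> is almost invariant under left
  translation by the first factor, so by Fubini almost every slice \<open>sec h\<close> is null or
  conull. Right invariance of \<open>L\<close> under the lattice makes the set of \<open>h\<close>
  with null slice invariant under a dense set of translations, and
  \<open>dense_invariant_null\<close> leaves only one of the two kinds.\<close>

lemma ergodic:
  assumes A: "A \<in> sets mY"
    and inv: "\<And>g. emeasure mY (sym_diff (param_act g -` A \<inter> space mY) A) = 0"
  shows "emeasure mY A = 0 \<or> emeasure mY (space mY - A) = 0"
proof -
  define L where "L = {x. x +o \<Gamma> \<in> A}"
  have L: "L \<in> sets borel" unfolding L_def using A by (intro coset_vimage_sets) (simp add: sets_mY)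
  then have LGH: "L \<in> sets (mG \<Otimes>\<^sub>M mH)" by (simp add: sets_mGH)
  note [measurable] = L
  define sec where "sec h = {g. (g, h) \<in> L}" for h
  have sec_sets [measurable]: "sec h \<in> sets borel" for h
    using measurable_sets_borel[of "\<lambda>g. (g, h)" borel, OF _ L] by (simp add: sec_def vimage_def)
  have csec_sets [measurable]: "- sec h \<in> sets borel" for h using sec_sets[of h] by simp
  let ?f = "\<lambda>g x. (if ((g, 0) + x \<in> L) \<noteq> (x \<in> L) then 1 else 0) :: ennreal"
  interpret GL: pair_sigma_finite mG "mG \<Otimes>\<^sub>M mH"
    using haarGH(2) G.sigma_finite_measure_axioms by (simp add: pair_sigma_finite_def)
  have "(\<integral>\<^sup>+ x. ?f g x \<partial>(mG \<Otimes>\<^sub>M mH)) = 0" for g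
  proof -
    let ?N = "sym_diff (param_act g -` A \<inter> space mY) A"
    have pm: "param_act g \<in> measurable mY mY" unfolding param_act_def[abs_def] by measurable
    have "?N \<in> sets mY" using measurable_sets[OF pm A] A by auto
    then have 0: "emeasure (mG \<Otimes>\<^sub>M mH) {x. x +o \<Gamma> \<in> ?N} = 0" using inv[of g] emeasure_mY_null_iff by simp
    have eq: "{x. x +o \<Gamma> \<in> ?N} = {x. ((g, 0) + x \<in> L) \<noteq> (x \<in> L)}"
      by (auto simp: L_def param_act_def coset_translate space_mY)
    have "{x. ((g, 0) + x \<in> L) \<noteq> (x \<in> L)} \<in> sets (mG \<Otimes>\<^sub>M mH)"
      unfolding eq[symmetric] sets_mGH
      by (rule coset_vimage_sets) (use \<open>?N \<in> sets mY\<close> in \<open>simp add: sets_mY\<close>)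
    then have "(\<integral>\<^sup>+ x. indicator {x. ((g, 0) + x \<in> L) \<noteq> (x \<in> L)} x \<partial>(mG \<Otimes>\<^sub>M mH)) = 0"
      using 0 unfolding eq by (subst nn_integral_indicator)
    then show ?thesis by (simp add: indicator_def of_bool_def)
  qed
  moreover have fm: "(\<lambda>(g, x). ?f g x) \<in> borel_measurable (mG \<Otimes>\<^sub>M (mG \<Otimes>\<^sub>M mH))"
  proof -
    have "(\<lambda>p::'g \<times> 'g \<times> 'h. (fst p, 0) + snd p) \<in> borel_measurable borel"
      by (intro borel_measurable_continuous_onI continuous_intros)
    moreover have "(snd :: 'g \<times> 'g \<times> 'h \<Rightarrow> _) \<in> borel_measurable borel"
      by (intro borel_measurable_continuous_onI continuous_intros)
    ultimately have "sym_diff ((\<lambda>p::'g \<times> 'g \<times> 'h. (fst p, 0) + snd p) -` L) (snd -` L) \<in> sets borel" (is "?S \<in> _")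
      using L measurable_sets_borel[of _ borel L] by (intro sets.Un sets.Diff) auto
    then have "(indicator ?S :: _ \<Rightarrow> ennreal) \<in> borel_measurable borel" by (rule borel_measurable_indicator)
    moreover have "indicator ?S = (\<lambda>p::'g \<times> 'g \<times> 'h. ?f (fst p) (snd p))"
      by (auto simp: indicator_def fun_eq_iff)
    ultimately have "(\<lambda>p::'g \<times> 'g \<times> 'h. ?f (fst p) (snd p)) \<in> borel_measurable borel"
      by simp
    moreover have s: "sets (mG \<Otimes>\<^sub>M (mG \<Otimes>\<^sub>M mH)) = sets borel"
      using sets_pair_measure_cong[OF sets_mG sets_mGH] unfolding borel_prod .
    ultimately show ?thesis unfolding case_prod_beta' measurable_cong_sets[OF s refl] by blast
  qed
  ultimately have "(\<integral>\<^sup>+ x. \<integral>\<^sup>+ g. ?f g x \<partial>mG \<partial>(mG \<Otimes>\<^sub>M mH)) = 0"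
    using GL.Fubini'[OF fm] by simp
  moreover have "(\<lambda>x. \<integral>\<^sup>+ g. ?f g x \<partial>mG) \<in> borel_measurable (mG \<Otimes>\<^sub>M mH)"
    using measurable_compose[OF measurable_pair_swap' fm]
    by (intro G.borel_measurable_nn_integral) (simp add: case_prod_beta')
  ultimately have "AE x in mG \<Otimes>\<^sub>M mH. (\<integral>\<^sup>+ g. ?f g x \<partial>mG) = 0"
    by (simp add: nn_integral_0_iff_AE)
  then have aeG: "AE a in mG. AE h in mH. (\<integral>\<^sup>+ g. ?f g (a, h) \<partial>mG) = 0"
    by (rule GH.AE_pair)
  have nF: "\<not> (AE a in mG. False)"
    using haarG by (auto simp: AE_iff_null space_mG haar_measure_def null_sets_def)
  \<comment> \<open>A single reference point \<open>a\<close>: for almost all \<open>h\<close>,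
    membership of \<open>(b, h)\<close> in \<open>L\<close> agrees for almost all \<open>b\<close>
    with that of \<open>(a, h)\<close>.\<close>
  have "\<exists>a. AE h in mH. (\<integral>\<^sup>+ g. ?f g (a, h) \<partial>mG) = 0"
  proof (rule ccontr)
    assume n: "\<not> ?thesis"
    have "AE a in mG. False" using aeG by eventually_elim (use n in blast)
    with nF show False by blast
  qed
  then obtain a where a: "AE h in mH. (\<integral>\<^sup>+ g. ?f g (a, h) \<partial>mG) = 0" by blast
  have dich: "AE h in mH. emeasure mG (sec h) = 0 \<or> emeasure mG (- sec h) = 0"
    using a
  proof eventually_elim
    case (elim h)
    \<comment> \<open>The exceptional set of the slice over \<open>h\<close>: it is
      \<open>sec h\<close> or its complement according to whether \<open>(a, h)\<close> lies in
      \<open>L\<close>.\<close>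
    define S where "S = {b. (b \<in> sec h) \<noteq> ((a, h) \<in> L)}"
    have S: "S \<in> sets borel"
      unfolding S_def using sec_sets[of h] csec_sets[of h] by (cases "(a, h) \<in> L") (auto simp: Compl_eq)
    have Sa: "{g. g + a \<in> S} \<in> sets borel"
      using measurable_sets_borel[of "\<lambda>g. g + a" borel, OF _ S] by (simp add: vimage_def)
    have "(\<integral>\<^sup>+ g. ?f g (a, h) \<partial>mG) = (\<integral>\<^sup>+ g. indicator {g. g + a \<in> S} g \<partial>mG)"
      by (intro nn_integral_cong) (auto simp: S_def sec_def indicator_def)
    also have "\<dots> = emeasure mG {g. g + a \<in> S}"
      using Sa by (intro nn_integral_indicator) (simp add: sets_mG)
    finally have "emeasure mG {g. g + a \<in> S} = 0" using elim by simp
    from haar_null_right_translate[OF haarG G.sigma_finite_measure_axioms Sa this, of "- a"]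
    have "emeasure mG S = 0" by (simp add: add.assoc)
    moreover have "S = sec h \<or> S = - sec h" unfolding S_def by auto
    ultimately show ?case by auto
  qed
  define B where "B = {h. emeasure mG (sec h) = 0}"
  define C where "C = {h. emeasure mG (- sec h) = 0}"
  have sec_vimage: "(\<lambda>g. (g, h)) -` L = sec h" for h by (auto simp: sec_def)
  have csec_vimage: "(\<lambda>g. (g, h)) -` (- L) = - sec h" for h by (auto simp: sec_def)
  have B: "B \<in> sets borel"
  proof -
    have "(\<lambda>h. emeasure mG (sec h)) \<in> borel_measurable borel"
      using GH.measurable_emeasure_Pair2[OF LGH] unfolding sec_vimage measurable_cong_sets[OF sets_mH refl] .
    then show ?thesis unfolding B_def by measurable
  qed
  have C: "C \<in> sets borel"
  proof -
    have "- L \<in> sets (mG \<Otimes>\<^sub>M mH)" using L by (auto simp: sets_mGH)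
    then have "(\<lambda>h. emeasure mG (- sec h)) \<in> borel_measurable borel"
      using GH.measurable_emeasure_Pair2 unfolding csec_vimage[symmetric] measurable_cong_sets[OF sets_mH refl, symmetric] by blast
    then show ?thesis unfolding C_def by measurable
  qed
  have BC: "B \<inter> C = {}"
  proof -
    { fix h assume "h \<in> B" "h \<in> C"
      then have "emeasure mG (sec h \<union> - sec h) = 0"
        using sec_sets[of h] csec_sets[of h] by (intro emeasure_Un_null_set[THEN trans]) (auto simp: B_def C_def null_sets_def sets_mG)
      then have False using haarG by (auto simp: haar_measure_def) }
    then show ?thesis by blast
  qed
  have Binv: "h - d \<in> B" if "d \<in> snd ` \<Gamma>" "h \<in> B" for d h
  proof -
    obtain c where c: "(c, d) \<in> \<Gamma>" using \<open>d \<in> snd ` \<Gamma>\<close> by auto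
    \<comment> \<open>Adding the lattice element \<open>(c, d)\<close> on the right does not change
      the coset, so the slice over \<open>h - d\<close> is a right translate of the slice over
      \<open>h\<close>.\<close>
    have "(g, h - d) \<in> L \<longleftrightarrow> (g + c, h) \<in> L" for g
      using coset_add_right[OF c, of "(g, h - d)"] by (simp add: L_def)
    then have "sec (h - d) = {g. g + c \<in> sec h}" by (auto simp: sec_def)
    then show ?thesis
      using haar_null_right_translate[OF haarG G.sigma_finite_measure_axioms sec_sets, of h c] \<open>h \<in> B\<close>
      by (simp add: B_def)
  qed
  have "emeasure mH B = 0 \<or> emeasure mH C = 0"
    using dense_invariant_null[OF lcH haarH dense_snd B C BC] Binv by blast
  then show ?thesis
  proof
    assume "emeasure mH B = 0"
    then have "AE h in mH. h \<notin> B" using B by (intro AE_not_in) (auto simp: null_sets_def sets_mH)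
    then have "AE h in mH. emeasure mG (- sec h) = 0"
      using dich by eventually_elim (auto simp: B_def)
    then have "(\<integral>\<^sup>+ h. emeasure mG ((\<lambda>g. (g, h)) -` (- L)) \<partial>mH) = (\<integral>\<^sup>+ h. 0 \<partial>mH)"
      unfolding csec_vimage by (intro nn_integral_cong_AE) auto
    then have "emeasure (mG \<Otimes>\<^sub>M mH) (- L) = 0"
      using L by (subst GH.emeasure_pair_measure_alt2) (auto simp: sets_mGH)
    moreover have "- L = {x. x +o \<Gamma> \<in> space mY - A}" by (auto simp: L_def space_mY)
    ultimately show ?thesis using emeasure_mY_null_iff[of "space mY - A"] A by simp
  next
    assume "emeasure mH C = 0"
    then have "AE h in mH. h \<notin> C" using C by (intro AE_not_in) (auto simp: null_sets_def sets_mH)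
    then have "AE h in mH. emeasure mG (sec h) = 0"
      using dich by eventually_elim (auto simp: C_def)
    then have "(\<integral>\<^sup>+ h. emeasure mG ((\<lambda>g. (g, h)) -` L) \<partial>mH) = (\<integral>\<^sup>+ h. 0 \<partial>mH)"
      unfolding sec_vimage by (intro nn_integral_cong_AE) auto
    then have "emeasure (mG \<Otimes>\<^sub>M mH) L = 0"
      using LGH by (subst GH.emeasure_pair_measure_alt2) auto
    then show ?thesis using emeasure_mY_null_iff[OF A] by (simp add: L_def)
  qed
qed

end

subsection \<open>Unique stationarity of the quotient\<close>

text \<open>Passing from \<open>A\<close> to \<open>B\<close> trades \<open>A - B\<close> for
  \<open>B - A\<close>, of equal \<open>M\<close>-measure. The density exceeds 1 on the former and
  is at most 1 on the latter, so the trade never gains, and it breaks even only if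
  \<open>A - B\<close> is null.\<close>

lemma density_superlevel_maximal:
  assumes [measurable]: "f \<in> borel_measurable M" "B \<in> sets M"
    and fin: "finite_measure M" and finf: "finite_measure (density M f)"
    and A: "A = {x \<in> space M. f x > 1}" and eq: "emeasure M B = emeasure M A"
  shows "emeasure (density M f) B \<le> emeasure (density M f) A"
    and "emeasure (density M f) B = emeasure (density M f) A \<Longrightarrow> emeasure M (sym_diff B A) = 0"
proof -
  interpret finite_measure M by fact
  interpret F: finite_measure "density M f" by fact
  have [measurable]: "A \<in> sets M" unfolding A by measurable
  have sym: "emeasure M (A - B) = emeasure M (B - A)"
  proof -
    have "emeasure M (A - B) + emeasure M (A \<inter> B) = emeasure M A"
      by (subst plus_emeasure) (auto intro: arg_cong[where f="emeasure M"])
    also have "\<dots> = emeasure M (B - A) + emeasure M (A \<inter> B)"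
      unfolding eq[symmetric] by (subst plus_emeasure) (auto intro: arg_cong[where f="emeasure M"])
    finally show ?thesis using emeasure_finite[of "A \<inter> B"] by (simp add: ennreal_add_left_cancel add.commute)
  qed
  have ind: "emeasure M X = (\<integral>\<^sup>+ x. indicator X x \<partial>M)" if "X \<in> sets M" for X using that by simp
  have den: "emeasure (density M f) X = (\<integral>\<^sup>+ x. f x * indicator X x \<partial>M)" if "X \<in> sets M" for X
    using that by (simp add: emeasure_density)
  have 1: "emeasure (density M f) (B - A) \<le> emeasure M (B - A)"
  proof -
    have "B \<subseteq> space M" by (rule sets.sets_into_space) measurable
    then have "(\<integral>\<^sup>+ x. f x * indicator (B - A) x \<partial>M) \<le> (\<integral>\<^sup>+ x. indicator (B - A) x \<partial>M)"
      by (intro nn_integral_mono) (auto simp: A indicator_def not_less)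
    then show ?thesis by (simp add: ind[of "B - A"] den[of "B - A"] del: nn_integral_indicator)
  qed
  have ord: "AE x in M. indicator (A - B) x \<le> f x * indicator (A - B) x"
    by (intro AE_I2) (auto simp: A indicator_def)
  have 2: "emeasure M (A - B) \<le> emeasure (density M f) (A - B)"
    by (subst ind, simp, subst den, simp, intro nn_integral_mono) (auto simp: A indicator_def)
  have A': "emeasure (density M f) A = emeasure (density M f) (A - B) + emeasure (density M f) (A \<inter> B)"
    by (subst plus_emeasure) (auto intro: arg_cong[where f="emeasure (density M f)"])
  have B': "emeasure (density M f) B = emeasure (density M f) (B - A) + emeasure (density M f) (A \<inter> B)"
    by (subst plus_emeasure) (auto intro: arg_cong[where f="emeasure (density M f)"])
  show "emeasure (density M f) B \<le> emeasure (density M f) A"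
    unfolding A' B' using 1 2 sym by (intro add_right_mono) auto
  assume "emeasure (density M f) B = emeasure (density M f) A"
  then have "emeasure (density M f) (B - A) = emeasure (density M f) (A - B)"
    unfolding A' B' using F.emeasure_finite[of "A \<inter> B"] by (simp add: ennreal_add_left_cancel add.commute)
  then have le: "emeasure (density M f) (A - B) \<le> emeasure M (A - B)" using 1 sym by simp
  \<comment> \<open>With \<open>ord\<close>, a failure on a set of positive measure would make the
    second integral strictly larger, against \<open>le\<close>. Since \<open>f\<close> exceeds 1 on
    all of \<open>A - B\<close>, the bound forces this set to be null.\<close>
  have "AE x in M. f x * indicator (A - B) x \<le> indicator (A - B) x"
  proof (rule ccontr)
    assume n: "\<not> ?thesis"
    have "(\<integral>\<^sup>+ x. indicator (A - B) x \<partial>M) < (\<integral>\<^sup>+ x. f x * indicator (A - B) x \<partial>M)"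
      by (rule nn_integral_less[OF _ _ _ ord n]) auto
    moreover have "(\<integral>\<^sup>+ x. indicator (A - B) x \<partial>M) = emeasure M (A - B)"
      by (rule ind[symmetric]) measurable
    moreover have "(\<integral>\<^sup>+ x. f x * indicator (A - B) x \<partial>M) = emeasure (density M f) (A - B)"
      by (rule den[symmetric]) measurable
    ultimately show False using le by (simp only: not_le[symmetric] not_True_eq_False)
  qed
  then have "AE x in M. x \<notin> A - B"
  proof eventually_elim
    case (elim x)
    show ?case
    proof
      assume x: "x \<in> A - B"
      then have "f x \<le> 1" using elim by simp
      with x show False by (auto simp: A)
    qed
  qed
  then have "A - B \<in> null_sets M" by (subst AE_iff_null_sets) auto
  then have 0: "emeasure M (A - B) = 0" by auto
  have "emeasure M (sym_diff B A) = emeasure M (B - A) + emeasure M (A - B)"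
    by (subst plus_emeasure) auto
  then show "emeasure M (sym_diff B A) = 0" using 0 sym by simp
qed

text \<open>Maximum principle: the translates of a superlevel set \<open>A\<close> of the density have the same
  \<open>M\<close>-measure as \<open>A\<close> and hence at most the same measure under
  \<open>density M f\<close>; stationarity forces equality.\<close>

lemma stationary_superlevel_invariant:
  assumes f: "f \<in> borel_measurable M" and fin: "prob_space M" and finf: "prob_space (density M f)"
    and \<mu>: "prob_space \<mu>"
    and act: "\<And>g. act g \<in> measurable M M" "\<And>g. distr M M (act g) = M"
    and A: "A = {x \<in> space M. f x > 1}"
    and meas: "(\<lambda>g. emeasure (density M f) (act g -` A \<inter> space M)) \<in> borel_measurable \<mu>"
    and stat: "(\<integral>\<^sup>+ g. emeasure (density M f) (act g -` A \<inter> space M) \<partial>\<mu>) = emeasure (density M f) A"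
  shows "AE g in \<mu>. emeasure M (sym_diff (act g -` A \<inter> space M) A) = 0"
proof -
  interpret M: prob_space M by fact
  interpret F: prob_space "density M f" by fact
  interpret \<mu>: prob_space \<mu> by fact
  note [measurable] = f
  have AS: "A \<in> sets M" unfolding A by measurable
  have S: "act g -` A \<inter> space M \<in> sets M" for g using act(1) AS by (rule measurable_sets)
  have eq: "emeasure M (act g -` A \<inter> space M) = emeasure M A" for g
    using emeasure_distr[OF act(1) AS] act(2) by metis
  note D = density_superlevel_maximal[OF f S M.finite_measure_axioms F.finite_measure_axioms A eq]
  let ?e = "\<lambda>g. emeasure (density M f) (act g -` A \<inter> space M)"
  have "AE g in \<mu>. emeasure (density M f) A \<le> ?e g"
  proof (rule ccontr)
    assume n: "\<not> ?thesis"
    have "(\<integral>\<^sup>+ g. ?e g \<partial>\<mu>) < (\<integral>\<^sup>+ g. emeasure (density M f) A \<partial>\<mu>)"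
    proof (rule nn_integral_less[OF meas _ _ _ n])
      show "(\<integral>\<^sup>+ g. ?e g \<partial>\<mu>) \<noteq> \<infinity>" unfolding stat using F.emeasure_finite[of A] by simp
      show "AE g in \<mu>. ?e g \<le> emeasure (density M f) A" using D(1) by (intro AE_I2)
    qed simp
    then show False by (simp add: stat \<mu>.emeasure_space_1)
  qed
  then show ?thesis
    by eventually_elim (intro D(2) antisym D(1))
qed

text \<open>The measure \<open>\<delta> g\<close> of the symmetric difference is subadditive and
  symmetric in \<open>g\<close>, so its zeros form a subgroup; smallness near the identity makes
  that subgroup closed. Every neighbourhood of a point of the support has positive
  \<open>\<mu>\<close>-measure and hence contains a zero, so the subgroup contains the
  support.\<close>

lemma closed_subgroup_of_invariance:
  fixes act :: "'l::topological_group_add \<Rightarrow> 'a \<Rightarrow> 'a"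
  assumes act: "\<And>g. act g \<in> measurable M M" "\<And>g. distr M M (act g) = M"
    and act_add: "\<And>g h x. x \<in> space M \<Longrightarrow> act (g + h) x = act g (act h x)" "\<And>x. x \<in> space M \<Longrightarrow> act 0 x = x"
    and A: "A \<in> sets M"
    and small: "\<And>e. e > 0 \<Longrightarrow> \<exists>N. open N \<and> 0 \<in> N \<and> (\<forall>n\<in>N. emeasure M (sym_diff (act n -` A \<inter> space M) A) \<le> ennreal e)"
    and \<mu>: "sets \<mu> = sets borel" "AE g in \<mu>. emeasure M (sym_diff (act g -` A \<inter> space M) A) = 0"
    and gen: "add_subgroup hull (measure_support \<mu>) = UNIV"
  shows "emeasure M (sym_diff (act g -` A \<inter> space M) A) = 0"
proof -
  define E where "E g = sym_diff (act g -` A \<inter> space M) A" for g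
  define \<delta> where "\<delta> g = emeasure M (E g)" for g
  have ES [measurable]: "E g \<in> sets M" for g
    unfolding E_def using measurable_sets[OF act(1) A] A by auto
  have pres: "emeasure M (act g -` X \<inter> space M) = emeasure M X" if "X \<in> sets M" for g X
    using emeasure_distr[OF act(1) that] act(2) by metis
  have sp: "act g x \<in> space M" if "x \<in> space M" for g x using measurable_space[OF act(1) that] .
  have AsubS: "A \<subseteq> space M" using A by (rule sets.sets_into_space)
  have sub: "\<delta> (s + t) \<le> \<delta> s + \<delta> t" for s t
  proof -
    have "E (s + t) \<subseteq> (act t -` E s \<inter> space M) \<union> E t"
      using AsubS act_add(1) sp by (auto simp: E_def)
    then have "\<delta> (s + t) \<le> emeasure M ((act t -` E s \<inter> space M) \<union> E t)"
      unfolding \<delta>_def using measurable_sets[OF act(1) ES] by (intro emeasure_mono) auto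
    also have "\<dots> \<le> emeasure M (act t -` E s \<inter> space M) + emeasure M (E t)"
      using measurable_sets[OF act(1) ES] by (intro emeasure_subadditive) auto
    finally show ?thesis unfolding \<delta>_def by (simp add: pres)
  qed
  have neg: "\<delta> (- s) = \<delta> s" for s
  proof -
    have "act s (act (- s) x) = x" if "x \<in> space M" for x
      using act_add(1)[OF that, of s "- s"] act_add(2)[OF that] by simp
    then have "E (- s) = act (- s) -` E s \<inter> space M"
      using AsubS sp by (auto simp: E_def)
    then show ?thesis unfolding \<delta>_def by (simp add: pres)
  qed
  define S where "S = {g. \<delta> g = 0}"
  have "add_subgroup S"
  proof -
    have "E 0 = {}" using AsubS act_add(2) by (auto simp: E_def)
    then have "\<delta> 0 = 0" by (simp add: \<delta>_def)
    moreover have "\<delta> (x + y) = 0" if "\<delta> x = 0" "\<delta> y = 0" for x y using sub[of x y] that by simp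
    ultimately show ?thesis by (auto simp: add_subgroup_def S_def neg)
  qed
  moreover have "measure_support \<mu> \<subseteq> S"
  proof
    fix x assume x: "x \<in> measure_support \<mu>"
    have "\<delta> x \<le> ennreal e" if e: "e > 0" for e
    proof -
      obtain N where N: "open N" "0 \<in> N" "\<forall>n\<in>N. \<delta> n \<le> ennreal e"
        using small[OF e] unfolding \<delta>_def E_def by blast
      have "open {z. z + - x \<in> N}" using N(1) by (rule open_right_translate)
      moreover have "x \<in> {z. z + - x \<in> N}" using N(2) by simp
      ultimately have pos: "0 < emeasure \<mu> {z. z + - x \<in> N}" and op: "{z. z + - x \<in> N} \<in> sets \<mu>"
        using x \<mu>(1) unfolding measure_support_def by auto
      have "\<exists>z. z + - x \<in> N \<and> \<delta> z = 0"
      proof (rule ccontr)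
        assume n: "\<not> ?thesis"
        have "AE z in \<mu>. z \<notin> {z. z + - x \<in> N}"
          using \<mu>(2) by eventually_elim (use n in \<open>auto simp: \<delta>_def E_def\<close>)
        then have "emeasure \<mu> {z. z + - x \<in> N} = 0"
          using op AE_iff_null_sets null_setsD1 by blast
        with pos show False by simp
      qed
      then obtain z where z: "z + - x \<in> N" "\<delta> z = 0" by blast
      \<comment> \<open>The point \<open>x\<close> differs from a zero \<open>z\<close> of
        \<open>\<delta>\<close> by an element of \<open>N\<close>, so subadditivity bounds
        \<open>\<delta> x\<close> by \<open>e\<close>.\<close>
      have "x = - (z + - x) + z" by (simp add: minus_add add.assoc)
      then have "\<delta> x \<le> \<delta> (- (z + - x)) + \<delta> z" using sub by metis
      also have "\<dots> = \<delta> (z + - x)" unfolding neg using z(2) by simp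
      also have "\<dots> \<le> ennreal e" using z(1) N(3) by blast
      finally show ?thesis .
    qed
    then have "\<delta> x \<le> 0" using ennreal_le_epsilon[of 0 "\<delta> x"] by simp
    then show "x \<in> S" by (simp add: S_def)
  qed
  ultimately have "add_subgroup hull (measure_support \<mu>) \<subseteq> S" by (intro hull_minimal)
  then show ?thesis using gen by (auto simp: S_def \<delta>_def E_def)
qed

section \<open>Convolution and stationary measures on the coset space\<close>

context cut_project
begin

lemma act_vimage_param: "param_act g -` B \<inter> \<Y> = (+o) (g, 0) -` B \<inter> \<Y>"
  by (auto simp: param_act_def)

lemma kernel_measurable:
  assumes \<eta>: "prob_measure_on \<T> \<eta>" and B: "B \<in> sets (borel_of \<T>)"
  shows "(\<lambda>l. emeasure \<eta> ((+o) l -` B \<inter> \<Y>)) \<in> borel_measurable borel"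
proof -
  interpret prob_space \<eta> using \<eta> by (simp add: prob_measure_on_def)
  have s: "sets \<eta> = sets (borel_of \<T>)" using \<eta> by (simp add: prob_measure_on_def)
  have mp: "(\<lambda>p. fst p +o snd p) \<in> measurable (borel \<Otimes>\<^sub>M \<eta>) (borel_of \<T>)"
    using coset_act_measurable_pair unfolding measurable_cong_sets[OF sets_pair_measure_cong[OF refl s] refl] .
  define Q where "Q = (\<lambda>p. fst p +o snd p) -` B \<inter> space (borel \<Otimes>\<^sub>M \<eta>)"
  have "Q \<in> sets (borel \<Otimes>\<^sub>M \<eta>)" unfolding Q_def using mp B by (rule measurable_sets)
  then have "(\<lambda>l. emeasure \<eta> (Pair l -` Q)) \<in> borel_measurable borel" by (rule measurable_emeasure_Pair)
  moreover have "Pair l -` Q = (+o) l -` B \<inter> \<Y>" for l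
    using sets_eq_imp_space_eq[OF s] by (auto simp: Q_def space_pair_measure topspace_coset_topology)
  ultimately show ?thesis by simp
qed

text \<open>Slice by slice: \<open>mG\<close>-almost every slice of \<open>E\<close> is
  \<open>mH\<close>-null, and absolute continuity is applied to the base first and then to the
  slice.\<close>

lemma null_product_smoothing:
  assumes \<mu>: "sets \<mu> = sets borel" "prob_space \<mu>" "absolutely_continuous mG \<mu>"
    and \<rho>: "sets \<rho> = sets borel" "prob_space \<rho>" "absolutely_continuous mH \<rho>"
    and E: "E \<in> sets borel" "emeasure (mG \<Otimes>\<^sub>M mH) E = 0"
  shows "emeasure (\<mu> \<Otimes>\<^sub>M \<rho>) E = 0"
proof -
  interpret \<mu>: prob_space \<mu> by fact
  interpret \<rho>: prob_space \<rho> by fact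
  interpret pair_sigma_finite \<mu> \<rho> ..
  have EGH: "E \<in> sets (mG \<Otimes>\<^sub>M mH)" using E by (simp add: sets_mGH)
  have E\<mu>: "E \<in> sets (\<mu> \<Otimes>\<^sub>M \<rho>)" using E sets_pair_measure_cong[OF \<mu>(1) \<rho>(1)] unfolding borel_prod by simp
  have "(\<integral>\<^sup>+ g. emeasure mH (Pair g -` E) \<partial>mG) = 0"
    using E(2) H.emeasure_pair_measure_alt[OF EGH] by simp
  then have "AE g in mG. emeasure mH (Pair g -` E) = 0"
    using H.measurable_emeasure_Pair[OF EGH] by (simp add: nn_integral_0_iff_AE)
  then have "AE g in \<mu>. emeasure mH (Pair g -` E) = 0"
    using absolutely_continuous_AE[OF _ \<mu>(3)] \<mu>(1) sets_mG by simp
  then have "AE g in \<mu>. emeasure \<rho> (Pair g -` E) = 0"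
  proof eventually_elim
    case (elim g)
    have "Pair g -` E \<in> sets mH" using EGH by (rule sets_Pair1)
    then show ?case using elim \<rho>(3) by (auto simp: absolutely_continuous_def null_sets_def)
  qed
  then have "(\<integral>\<^sup>+ g. emeasure \<rho> (Pair g -` E) \<partial>\<mu>) = (\<integral>\<^sup>+ g. 0 \<partial>\<mu>)" by (rule nn_integral_cong_AE)
  then show ?thesis using \<rho>.emeasure_pair_measure_alt[OF E\<mu>] by simp
qed

text \<open>The convolution with \<open>\<eta>\<close> of \<open>\<rho>\<close> placed on the second
  factor; this is the average over a neighbourhood in \<open>H\<close> when \<open>\<rho>\<close> is
  uniform there.\<close>

definition smoothing :: "'h measure \<Rightarrow> ('g \<times> 'h) set measure \<Rightarrow> ('g \<times> 'h) set measure" where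
  "smoothing \<rho> \<eta> = distr (\<rho> \<Otimes>\<^sub>M \<eta>) mY (\<lambda>p. (0, fst p) +o snd p)"

lemma smoothing:
  assumes \<eta>: "prob_measure_on \<T> \<eta>"
    and \<rho>: "sets \<rho> = sets borel" "prob_space \<rho>"
  shows "prob_measure_on \<T> (smoothing \<rho> \<eta>)"
    and "B \<in> sets mY \<Longrightarrow> emeasure (smoothing \<rho> \<eta>) B = (\<integral>\<^sup>+ h. emeasure \<eta> ((+o) (0, h) -` B \<inter> \<Y>) \<partial>\<rho>)"
proof -
  interpret \<eta>: prob_space \<eta> using \<eta> by (simp add: prob_measure_on_def)
  interpret \<rho>: prob_space \<rho> by fact
  interpret pair_prob_space \<rho> \<eta> ..
  have s: "sets \<eta> = sets (borel_of \<T>)" using \<eta> by (simp add: prob_measure_on_def)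
  have sp: "space \<eta> = \<Y>" "space \<rho> = UNIV"
    using sets_eq_imp_space_eq[OF s] sets_eq_imp_space_eq[OF \<rho>(1)] by (auto simp: topspace_coset_topology)
  have "(\<lambda>h::'h. (0::'g, h)) \<in> borel_measurable borel"
    by (intro borel_measurable_continuous_onI continuous_intros)
  then have "(\<lambda>h::'h. (0::'g, h)) \<in> borel_measurable \<rho>" unfolding measurable_cong_sets[OF \<rho>(1) refl] .
  then have "(\<lambda>p. (0::'g, fst p)) \<in> borel_measurable (\<rho> \<Otimes>\<^sub>M \<eta>)"
    using measurable_compose[OF measurable_fst] by blast
  then have "(\<lambda>p. ((0::'g, fst p), snd p)) \<in> measurable (\<rho> \<Otimes>\<^sub>M \<eta>) (borel \<Otimes>\<^sub>M borel_of \<T>)"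
    using measurable_snd[of \<rho> \<eta>] unfolding measurable_cong_sets[OF refl s]
    by (rule measurable_Pair)
  from measurable_compose[OF this coset_act_measurable_pair]
  have mp: "(\<lambda>p. (0, fst p) +o snd p) \<in> measurable (\<rho> \<Otimes>\<^sub>M \<eta>) mY"
    unfolding measurable_cong_sets[OF refl sets_mY] by simp
  then show "prob_measure_on \<T> (smoothing \<rho> \<eta>)"
    unfolding prob_measure_on_def smoothing_def using sets_mY by (auto intro: prob_space_distr)
  assume B: "B \<in> sets mY"
  let ?Q = "(\<lambda>p. (0, fst p) +o snd p) -` B \<inter> space (\<rho> \<Otimes>\<^sub>M \<eta>)"
  have "emeasure (smoothing \<rho> \<eta>) B = emeasure (\<rho> \<Otimes>\<^sub>M \<eta>) ?Q"
    unfolding smoothing_def using mp B by (rule emeasure_distr)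
  also have "\<dots> = (\<integral>\<^sup>+ h. emeasure \<eta> (Pair h -` ?Q) \<partial>\<rho>)"
    by (rule \<eta>.emeasure_pair_measure_alt[OF measurable_sets[OF mp B]])
  also have "\<dots> = (\<integral>\<^sup>+ h. emeasure \<eta> ((+o) (0, h) -` B \<inter> \<Y>) \<partial>\<rho>)"
    by (intro nn_integral_cong arg_cong[where f="emeasure \<eta>"]) (auto simp: space_pair_measure sp)
  finally show "emeasure (smoothing \<rho> \<eta>) B = (\<integral>\<^sup>+ h. emeasure \<eta> ((+o) (0, h) -` B \<inter> \<Y>) \<partial>\<rho>)" .
qed

lemma stationary_measureD:
  assumes \<eta>: "prob_measure_on \<T> \<eta>" "stationary_measure param_act \<mu> \<eta>" and B: "B \<in> sets mY"
  shows "(\<integral>\<^sup>+ g. emeasure \<eta> ((+o) (g, 0) -` B \<inter> \<Y>) \<partial>\<mu>) = emeasure \<eta> B"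
proof -
  have s: "sets \<eta> = sets (borel_of \<T>)" using \<eta> by (simp add: prob_measure_on_def)
  have sp: "space \<eta> = \<Y>"
    using sets_eq_imp_space_eq[OF s] by (auto simp: topspace_coset_topology)
  have "param_act g \<in> measurable \<eta> \<eta>" for g
    unfolding measurable_cong_sets[OF s s] param_act_def[abs_def] by measurable
  then have eq: "emeasure (distr \<eta> \<eta> (param_act g)) B = emeasure \<eta> ((+o) (g, 0) -` B \<inter> \<Y>)" for g
    using B by (subst emeasure_distr) (auto simp: s sets_mY sp act_vimage_param)
  have "B \<in> sets \<eta>" using B by (simp add: s sets_mY)
  with \<eta>(2) have "(\<integral>\<^sup>+ g. emeasure (distr \<eta> \<eta> (param_act g)) B \<partial>\<mu>) = emeasure \<eta> B"
    unfolding stationary_measure_def by blast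
  then show ?thesis unfolding eq .
qed

lemma act_vimage_vimage:
  "(+o) l -` ((+o) k -` B \<inter> \<Y>) \<inter> \<Y> = (+o) (k + l) -` B \<inter> \<Y>"
  by (rule set_eqI, simp add: set_plus_rearrange2) (use coset_translate_space in blast)

text \<open>Both identities are Fubini for the kernel in \<open>(g, h)\<close>, since translations
  by \<open>(g, 0)\<close> and \<open>(0, h)\<close> commute. The second one writes the smoothing as
  the convolution of \<open>\<eta>\<close> with \<open>\<mu> \<Otimes>\<^sub>M \<rho>\<close>:
  stationarity supplies the average over the first factor that \<open>\<rho>\<close> does not
  see.\<close>

lemma smoothing_stationary:
  assumes \<eta>: "prob_measure_on \<T> \<eta>" "stationary_measure param_act \<mu> \<eta>"
    and \<rho>: "sets \<rho> = sets borel" "prob_space \<rho>"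
    and \<mu>: "sets \<mu> = sets borel" "prob_space \<mu>"
    and B: "B \<in> sets mY"
  shows "(\<integral>\<^sup>+ g. emeasure (smoothing \<rho> \<eta>) ((+o) (g, 0) -` B \<inter> \<Y>) \<partial>\<mu>) = emeasure (smoothing \<rho> \<eta>) B"
    and "(\<integral>\<^sup>+ l. emeasure \<eta> ((+o) l -` B \<inter> \<Y>) \<partial>(\<mu> \<Otimes>\<^sub>M \<rho>)) = emeasure (smoothing \<rho> \<eta>) B"
proof -
  interpret \<mu>: prob_space \<mu> by fact
  interpret \<rho>: prob_space \<rho> by fact
  interpret pair_prob_space \<mu> \<rho> ..
  let ?k = "\<lambda>g h. emeasure \<eta> ((+o) (g, h) -` B \<inter> \<Y>)"
  have s: "sets (\<mu> \<Otimes>\<^sub>M \<rho>) = sets borel" using sets_pair_measure_cong[OF \<mu>(1) \<rho>(1)] unfolding borel_prod .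
  have "(\<lambda>l. emeasure \<eta> ((+o) l -` B \<inter> \<Y>)) \<in> borel_measurable (\<mu> \<Otimes>\<^sub>M \<rho>)"
    unfolding measurable_cong_sets[OF s refl] using \<eta>(1) B by (intro kernel_measurable) (simp_all add: sets_mY)
  then have meas: "(\<lambda>(g, h). ?k g h) \<in> borel_measurable (\<mu> \<Otimes>\<^sub>M \<rho>)" by (simp add: case_prod_beta')
  have Bl: "(+o) l -` B \<inter> \<Y> \<in> sets mY" for l
    using act.act_vimage_sets[OF B] by (simp add: space_mY)
  have "emeasure (smoothing \<rho> \<eta>) ((+o) (g, 0) -` B \<inter> \<Y>) = (\<integral>\<^sup>+ h. ?k g h \<partial>\<rho>)" for g
    unfolding smoothing(2)[OF \<eta>(1) \<rho> Bl] act_vimage_vimage by simp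
  moreover have st: "(\<integral>\<^sup>+ g. ?k g h \<partial>\<mu>) = emeasure \<eta> ((+o) (0, h) -` B \<inter> \<Y>)" for h
    using stationary_measureD[OF \<eta> Bl, of "(0, h)"] unfolding act_vimage_vimage by simp
  moreover note Fubini'[OF meas] smoothing(2)[OF \<eta>(1) \<rho> B]
  ultimately show 1: "(\<integral>\<^sup>+ g. emeasure (smoothing \<rho> \<eta>) ((+o) (g, 0) -` B \<inter> \<Y>) \<partial>\<mu>) = emeasure (smoothing \<rho> \<eta>) B"
    by simp
  show "(\<integral>\<^sup>+ l. emeasure \<eta> ((+o) l -` B \<inter> \<Y>) \<partial>(\<mu> \<Otimes>\<^sub>M \<rho>)) = emeasure (smoothing \<rho> \<eta>) B"
    using nn_integral_snd[OF meas] st smoothing(2)[OF \<eta>(1) \<rho> B] by (simp add: case_prod_beta')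
qed

text \<open>In the convolution with \<open>\<mu> \<Otimes>\<^sub>M \<rho>\<close>, fix the coset and
  integrate over the group first. The group elements that move the coset of \<open>x\<close> into
  the null set \<open>N\<close> form a right translate of a Haar-null set, which is also null for
  \<open>\<mu> \<Otimes>\<^sub>M \<rho>\<close>. So each inner integral vanishes, whatever
  \<open>\<eta>\<close> is.\<close>

lemma smoothing_absolutely_continuous:
  assumes \<eta>: "prob_measure_on \<T> \<eta>" "stationary_measure param_act \<mu> \<eta>"
    and \<rho>: "sets \<rho> = sets borel" "prob_space \<rho>" "absolutely_continuous mH \<rho>"
    and \<mu>: "sets \<mu> = sets borel" "prob_space \<mu>" "absolutely_continuous mG \<mu>"
  shows "absolutely_continuous mY (smoothing \<rho> \<eta>)"
  unfolding absolutely_continuous_def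
proof
  interpret \<mu>: prob_space \<mu> by fact
  interpret \<rho>: prob_space \<rho> by fact
  interpret \<eta>: prob_space \<eta> using \<eta> by (simp add: prob_measure_on_def)
  interpret \<mu>\<rho>: pair_prob_space \<mu> \<rho> ..
  interpret P: pair_sigma_finite "\<mu> \<Otimes>\<^sub>M \<rho>" \<eta> ..
  have s\<eta>: "sets \<eta> = sets (borel_of \<T>)" using \<eta> by (simp add: prob_measure_on_def)
  have sp: "space \<eta> = \<Y>"
    using sets_eq_imp_space_eq[OF s\<eta>] by (auto simp: topspace_coset_topology)
  have s: "sets (\<mu> \<Otimes>\<^sub>M \<rho>) = sets borel" using sets_pair_measure_cong[OF \<mu>(1) \<rho>(1)] unfolding borel_prod .
  have spL: "space (\<mu> \<Otimes>\<^sub>M \<rho>) = UNIV" "space \<mu> = UNIV" "space \<rho> = UNIV"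
    using sets_eq_imp_space_eq[OF s] sets_eq_imp_space_eq[OF \<mu>(1)] sets_eq_imp_space_eq[OF \<rho>(1)] by simp_all
  fix N assume "N \<in> null_sets mY"
  then have N: "N \<in> sets mY" "emeasure mY N = 0" by auto
  define L where "L = {x. x +o \<Gamma> \<in> N}"
  have L: "L \<in> sets borel" unfolding L_def using N(1) by (intro coset_vimage_sets) (simp add: sets_mY)
  have L0: "emeasure (mG \<Otimes>\<^sub>M mH) L = 0" using N emeasure_mY_null_iff unfolding L_def by simp
  have mp: "(\<lambda>p. fst p +o snd p) \<in> measurable ((\<mu> \<Otimes>\<^sub>M \<rho>) \<Otimes>\<^sub>M \<eta>) mY"
    using coset_act_measurable_pair unfolding measurable_cong_sets[OF sets_pair_measure_cong[OF s s\<eta>] sets_mY] .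
  define Q where "Q = (\<lambda>p. fst p +o snd p) -` N \<inter> space ((\<mu> \<Otimes>\<^sub>M \<rho>) \<Otimes>\<^sub>M \<eta>)"
  have Q: "Q \<in> sets ((\<mu> \<Otimes>\<^sub>M \<rho>) \<Otimes>\<^sub>M \<eta>)" unfolding Q_def using mp N(1) by (rule measurable_sets)
  have "emeasure (smoothing \<rho> \<eta>) N = (\<integral>\<^sup>+ l. emeasure \<eta> ((+o) l -` N \<inter> \<Y>) \<partial>(\<mu> \<Otimes>\<^sub>M \<rho>))"
    using smoothing_stationary(2)[OF \<eta> \<rho>(1,2) \<mu>(1,2) N(1)] by simp
  also have "\<dots> = (\<integral>\<^sup>+ l. emeasure \<eta> (Pair l -` Q) \<partial>(\<mu> \<Otimes>\<^sub>M \<rho>))"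
    by (intro nn_integral_cong arg_cong[where f="emeasure \<eta>"]) (auto simp: Q_def space_pair_measure sp spL)
  also have "\<dots> = emeasure ((\<mu> \<Otimes>\<^sub>M \<rho>) \<Otimes>\<^sub>M \<eta>) Q"
    using Q by (rule \<eta>.emeasure_pair_measure_alt[symmetric])
  also have "\<dots> = (\<integral>\<^sup>+ y. emeasure (\<mu> \<Otimes>\<^sub>M \<rho>) ((\<lambda>l. (l, y)) -` Q) \<partial>\<eta>)"
    using Q by (rule P.emeasure_pair_measure_alt2)
  also have "\<dots> = (\<integral>\<^sup>+ y. 0 \<partial>\<eta>)"
  proof (rule nn_integral_cong)
    fix y assume y: "y \<in> space \<eta>"
    then obtain x where x: "y = x +o \<Gamma>" using sp coset_spaceE by metis
    have "(\<lambda>l. (l, y)) -` Q = {l. l + x \<in> L}"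
      using y by (auto simp: Q_def space_pair_measure spL L_def x coset_translate)
    moreover have "emeasure (\<mu> \<Otimes>\<^sub>M \<rho>) {l. l + x \<in> L} = 0"
    proof (rule null_product_smoothing[OF \<mu> \<rho>])
      show "{l. l + x \<in> L} \<in> sets borel"
        using measurable_sets_borel[of "\<lambda>l. l + x" borel, OF _ L] by (simp add: vimage_def)
      show "emeasure (mG \<Otimes>\<^sub>M mH) {l. l + x \<in> L} = 0"
        using haarGH L L0 by (rule haar_null_right_translate)
    qed
    ultimately show "emeasure (\<mu> \<Otimes>\<^sub>M \<rho>) ((\<lambda>l. (l, y)) -` Q) = 0" by simp
  qed
  finally have "emeasure (smoothing \<rho> \<eta>) N = 0" by simp
  moreover have "sets (smoothing \<rho> \<eta>) = sets mY" by (simp add: smoothing_def)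
  ultimately show "N \<in> null_sets (smoothing \<rho> \<eta>)" using N by (simp add: null_sets_def)
qed

lemma small_sym_diff:
  assumes "A \<in> sets mY" "e > 0"
  obtains N where "open N" "0 \<in> N" "\<And>n. n \<in> N \<Longrightarrow> emeasure mY (sym_diff (param_act n -` A \<inter> space mY) A) \<le> ennreal e"
proof -
  have "openin \<T> (\<Y>)"
    using openin_topspace[of "coset_topology \<Gamma>"] by (simp add: topspace_coset_topology)
  moreover have "emeasure mY (\<Y>) < \<infinity>" by (simp add: Y.emeasure_eq_measure)
  moreover have "A \<subseteq> \<Y>" using assms(1) sets.sets_into_space space_mY by metis
  ultimately obtain N where N: "open N" "0 \<in> N"
    "\<And>n. n \<in> N \<Longrightarrow> emeasure mY (sym_diff ((+o) n -` A \<inter> space mY) A) \<le> ennreal e"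
    using act.act_sym_diff_small[OF _ _ assms(1) _ assms(2)] by metis
  have "open ((\<lambda>g::'g. (g, 0::'h)) -` N)" by (intro open_vimage N(1) continuous_intros)
  moreover have "0 \<in> (\<lambda>g::'g. (g, 0::'h)) -` N" using N(2) by (simp add: zero_prod_def)
  ultimately show ?thesis
    using that[of "(\<lambda>g::'g. (g, 0::'h)) -` N"] N(3) by (simp add: space_mY act_vimage_param)
qed

text \<open>The superlevel set \<open>A\<close> is invariant, hence null or conull. If it were
  conull, the density would have integral above 1. So the density is at most 1 almost everywhere,
  and two probability measures with \<open>\<eta>\<close> below \<open>mY\<close> on every set agree
  by taking complements.\<close>

lemma stationary_absolutely_continuous_unique:
  assumes \<mu>: "admissible mG \<mu>" and \<eta>: "prob_measure_on \<T> \<eta>"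
    and ac: "absolutely_continuous mY \<eta>"
    and stat: "\<And>B. B \<in> sets mY \<Longrightarrow> (\<integral>\<^sup>+ g. emeasure \<eta> ((+o) (g, 0) -` B \<inter> \<Y>) \<partial>\<mu>) = emeasure \<eta> B"
  shows "\<eta> = mY"
proof -
  interpret \<eta>: prob_space \<eta> using \<eta> by (simp add: prob_measure_on_def)
  interpret \<mu>: prob_space \<mu> using \<mu> by (simp add: admissible_def)
  have s: "sets \<eta> = sets mY" using \<eta> by (simp add: prob_measure_on_def sets_mY)
  have s\<mu>: "sets \<mu> = sets borel" using \<mu> by (simp add: admissible_def)
  define f where "f = RN_deriv mY \<eta>"
  have f [measurable]: "f \<in> borel_measurable mY" by (simp add: f_def)
  have d: "density mY f = \<eta>" unfolding f_def using ac s by (rule Y.density_RN_deriv)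
  define A where "A = {x \<in> space mY. f x > 1}"
  have A: "A \<in> sets mY" unfolding A_def by measurable
  have pm: "param_act g \<in> measurable mY mY" for g unfolding param_act_def[abs_def] by measurable
  have pd: "distr mY mY (param_act g) = mY" for g
    using invY unfolding invariant_measure_def param_act_def[abs_def] by blast
  have "(\<lambda>l. emeasure \<eta> ((+o) l -` A \<inter> \<Y>)) \<in> borel_measurable borel"
    using \<eta> A by (intro kernel_measurable) (simp_all add: sets_mY)
  moreover have "(\<lambda>g::'g. (g, 0::'h)) \<in> borel_measurable borel"
    by (intro borel_measurable_continuous_onI continuous_intros)
  ultimately have km: "(\<lambda>g. emeasure \<eta> ((+o) (g, 0) -` A \<inter> \<Y>)) \<in> borel_measurable \<mu>"
    unfolding measurable_cong_sets[OF s\<mu> refl] by (rule measurable_compose[rotated])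
  have aeg: "AE g in \<mu>. emeasure mY (sym_diff (param_act g -` A \<inter> space mY) A) = 0"
    by (rule stationary_superlevel_invariant[OF f _ _ _ pm pd A_def])
      (simp_all add: d Y.prob_space_axioms \<eta>.prob_space_axioms \<mu>.prob_space_axioms space_mY act_vimage_param km stat A)
  have "emeasure mY (sym_diff (param_act g -` A \<inter> space mY) A) = 0" for g
  proof (rule closed_subgroup_of_invariance[OF pm pd _ _ A _ s\<mu> aeg])
    show "\<exists>N. open N \<and> 0 \<in> N \<and> (\<forall>n\<in>N. emeasure mY (sym_diff (param_act n -` A \<inter> space mY) A) \<le> ennreal e)"
      if "e > 0" for e using small_sym_diff[OF A \<open>e > 0\<close>] by metis
    show "add_subgroup hull measure_support \<mu> = UNIV" using \<mu> by (simp add: admissible_def)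
    show "param_act (g + h) x = param_act g (param_act h x)" for g h and x :: "('g \<times> 'h) set"
      by (simp add: param_act_def set_plus_rearrange2)
    show "param_act 0 x = x" for x :: "('g \<times> 'h) set" by (simp add: param_act_def flip: zero_prod_def)
  qed
  then have "emeasure mY A = 0 \<or> emeasure mY (space mY - A) = 0" by (rule ergodic[OF A])
  moreover have "emeasure mY (space mY - A) \<noteq> 0"
  proof
    assume 0: "emeasure mY (space mY - A) = 0"
    have "AE x in mY. x \<notin> space mY - A" using 0 A by (intro AE_not_in) (auto simp: null_sets_def)
    then have gt: "AE x in mY. f x > 1" using AE_space by eventually_elim (auto simp: A_def)
    have "(\<integral>\<^sup>+ x. 1 \<partial>mY) < (\<integral>\<^sup>+ x. f x \<partial>mY)"
    proof (rule nn_integral_less)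
      show "AE x in mY. 1 \<le> f x" using gt by eventually_elim simp
      show "\<not> (AE x in mY. f x \<le> 1)"
      proof
        assume "AE x in mY. f x \<le> 1"
        then have "AE x in mY. False" using gt by eventually_elim simp
        then show False by (simp add: Y.AE_False)
      qed
    qed (auto simp: Y.emeasure_space_1)
    moreover have "(\<integral>\<^sup>+ x. f x \<partial>mY) = emeasure \<eta> (space mY)"
      unfolding d[symmetric] by (subst emeasure_density) (auto intro!: nn_integral_cong)
    ultimately show False
      using \<eta>.emeasure_space_1 Y.emeasure_space_1 sets_eq_imp_space_eq[OF s] by simp
  qed
  ultimately have "emeasure mY A = 0" by blast
  then have "AE x in mY. x \<notin> A" using A by (intro AE_not_in) (auto simp: null_sets_def)
  then have le1: "AE x in mY. f x \<le> 1" using AE_space by eventually_elim (auto simp: A_def)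
  have le: "emeasure \<eta> B \<le> emeasure mY B" if B: "B \<in> sets mY" for B
  proof -
    have "emeasure \<eta> B = (\<integral>\<^sup>+ x. f x * indicator B x \<partial>mY)"
      unfolding d[symmetric] using B by (simp add: emeasure_density)
    also have "\<dots> \<le> (\<integral>\<^sup>+ x. indicator B x \<partial>mY)"
      using le1 by (intro nn_integral_mono_AE, eventually_elim) (auto simp: indicator_def)
    finally show ?thesis using B by simp
  qed
  show "\<eta> = mY"
  proof (rule measure_eqI[OF s])
    fix B assume B: "B \<in> sets \<eta>"
    have "\<eta>.prob B \<le> Y.prob B" "\<eta>.prob (space \<eta> - B) \<le> Y.prob (space mY - B)"
      using le[of B] le[of "space mY - B"] B s sets_eq_imp_space_eq[OF s]
      by (auto simp: \<eta>.emeasure_eq_measure Y.emeasure_eq_measure)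
    then have "\<eta>.prob B = Y.prob B"
      using \<eta>.prob_compl[of B] Y.prob_compl[of B] B s by simp
    then show "emeasure \<eta> B = emeasure mY B" by (simp add: \<eta>.emeasure_eq_measure Y.emeasure_eq_measure)
  qed
qed

text \<open>The averages of \<open>\<eta>\<close> over arbitrarily small neighbourhoods in
  \<open>H\<close> all equal \<open>mY\<close>. An open set is exhausted by sets \<open>W k\<close>
  that small shifts keep inside it; this compares \<open>\<eta>\<close> and \<open>mY\<close> on
  open sets, which determine both.\<close>

lemma stationary_unique:
  assumes \<mu>: "admissible mG \<mu>" and \<eta>: "prob_measure_on \<T> \<eta>" "stationary_measure param_act \<mu> \<eta>"
  shows "\<eta> = mY"
proof -
  interpret \<eta>: prob_space \<eta> using \<eta> by (simp add: prob_measure_on_def)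
  interpret \<mu>: prob_space \<mu> using \<mu> by (simp add: admissible_def)
  have s\<mu>: "sets \<mu> = sets borel" using \<mu> by (simp add: admissible_def)
  have s: "sets \<eta> = sets mY" using \<eta> by (simp add: prob_measure_on_def sets_mY)
  have sp: "space \<eta> = \<Y>" using sets_eq_imp_space_eq[OF s] by (simp add: space_mY)
  have avg: "\<exists>\<rho>. prob_space \<rho> \<and> (AE h in \<rho>. h \<in> O') \<and>
      (\<forall>B\<in>sets mY. (\<integral>\<^sup>+ h. emeasure \<eta> ((+o) (0, h) -` B \<inter> \<Y>) \<partial>\<rho>) = emeasure mY B)"
    if O: "open O'" "0 \<in> O'" for O' :: "'h set"
  proof -
    obtain O2 where O2: "open O2" "0 \<in> O2" "emeasure mH O2 < \<infinity>"
      using haar_finite_open_nbhd[OF lcH haarH] by blast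
    \<comment> \<open>Cutting down to finite Haar measure makes the uniform probability on
      \<open>V\<close> available; it is absolutely continuous and lives on
      \<open>O'\<close>.\<close>
    define V where "V = O' \<inter> O2"
    have V: "open V" "V \<noteq> {}" "V \<in> sets mH" using O O2 by (auto simp: V_def sets_mH)
    have "emeasure mH V \<le> emeasure mH O2" unfolding V_def using O2 by (intro emeasure_mono) (auto simp: sets_mH)
    then have fin: "emeasure mH V \<noteq> \<infinity>" "emeasure mH V < \<infinity>" using O2(3) by auto
    have pos: "emeasure mH V \<noteq> 0" using haarH V by (auto simp: haar_measure_def)
    define \<rho> where "\<rho> = uniform_measure mH V"
    have \<rho>: "sets \<rho> = sets borel" "prob_space \<rho>"
      unfolding \<rho>_def using pos fin by (auto simp: sets_mH intro!: prob_space_uniform_measure)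
    have ac: "absolutely_continuous mH \<rho>"
      unfolding absolutely_continuous_def
    proof
      fix N assume N: "N \<in> null_sets mH"
      then have "V \<inter> N \<in> null_sets mH" using V(3) by (rule null_set_Int1)
      then show "N \<in> null_sets \<rho>"
        using N V(3) unfolding \<rho>_def by (auto simp: null_sets_def)
    qed
    note sm = smoothing[OF \<eta>(1) \<rho>]
    have "smoothing \<rho> \<eta> = mY"
    proof (rule stationary_absolutely_continuous_unique[OF \<mu> sm(1)])
      show "absolutely_continuous mY (smoothing \<rho> \<eta>)"
        using \<mu> unfolding admissible_def
        by (intro smoothing_absolutely_continuous[OF \<eta> \<rho> ac s\<mu> \<mu>.prob_space_axioms]) blast
    qed (rule smoothing_stationary(1)[OF \<eta> \<rho> s\<mu> \<mu>.prob_space_axioms])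
    then have "(\<integral>\<^sup>+ h. emeasure \<eta> ((+o) (0, h) -` B \<inter> \<Y>) \<partial>\<rho>) = emeasure mY B" if "B \<in> sets mY" for B
      using sm(2)[OF that] by simp
    moreover have "AE h in \<rho>. h \<in> O'"
      unfolding \<rho>_def using V(3) by (intro AE_uniform_measureI AE_I2) (auto simp: V_def)
    ultimately show ?thesis using \<rho>(2) by blast
  qed
  have open_eq: "emeasure \<eta> U = emeasure mY U" if U: "openin \<T> U" for U
  proof -
    obtain V :: "nat \<Rightarrow> ('g \<times> 'h) set set" and N :: "nat \<Rightarrow> ('g \<times> 'h) set" where
      V: "\<And>i. openin \<T> (V i)" and N: "\<And>i. open (N i)" "\<And>i. 0 \<in> N i"
      and UV: "U = (\<Union>i. V i)" and NV: "\<And>i n v. n \<in> N i \<Longrightarrow> v \<in> V i \<Longrightarrow> n +o v \<in> U"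
      by (rule act.almost_fixed_open_aux[OF U]) (rule that)
    have Us: "U \<in> sets mY" using U by (simp add: sets_mY openin_sets_borel_of)
    have Vs: "V i \<in> sets mY" for i using V by (simp add: sets_mY openin_sets_borel_of)
    define W where "W k = (\<Union>i<k. V i)" for k :: nat
    have Ws: "W k \<in> sets mY" for k unfolding W_def using Vs by auto
    have both: "emeasure \<eta> (W k) \<le> emeasure mY U \<and> emeasure mY (W k) \<le> emeasure \<eta> U" for k
    proof -
      define M where "M = (\<Inter>i<k. N i)"
      have M: "open M" "0 \<in> M" unfolding M_def using N by auto
      have MW: "n +o y \<in> U" if "n \<in> M" "y \<in> W k" for n y
        using that NV unfolding M_def W_def by blast
      \<comment> \<open>Both signs occur: \<open>h\<close> moves \<open>W k\<close> into
        \<open>U\<close> in the first estimate, and \<open>- h\<close> returns a point of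
        \<open>W k\<close> to a point of \<open>U\<close> in the second.\<close>
      define O' where "O' = (\<lambda>h::'h. (0::'g, h)) -` M \<inter> (\<lambda>h::'h. (0::'g, - h)) -` M"
      have "open O'" unfolding O'_def by (intro open_Int open_vimage M(1) continuous_intros)
      moreover have "0 \<in> O'" using M(2) by (simp add: O'_def zero_prod_def)
      ultimately obtain \<rho> where \<rho>: "prob_space \<rho>" "AE h in \<rho>. h \<in> O'"
        "\<And>B. B \<in> sets mY \<Longrightarrow> (\<integral>\<^sup>+ h. emeasure \<eta> ((+o) (0, h) -` B \<inter> \<Y>) \<partial>\<rho>) = emeasure mY B"
        using avg by blast
      interpret \<rho>: prob_space \<rho> by fact
      have "emeasure \<eta> (W k) = (\<integral>\<^sup>+ h. emeasure \<eta> (W k) \<partial>\<rho>)" by (simp add: \<rho>.emeasure_space_1)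
      also have "\<dots> \<le> (\<integral>\<^sup>+ h. emeasure \<eta> ((+o) (0, h) -` U \<inter> \<Y>) \<partial>\<rho>)"
        using \<rho>(2)
      proof (intro nn_integral_mono_AE, eventually_elim)
        case (elim h)
        have "W k \<subseteq> (+o) (0, h) -` U \<inter> \<Y>"
          using elim MW[of "(0, h)"] sets.sets_into_space[OF Ws] by (auto simp: O'_def space_mY)
        then show ?case using act.act_vimage_sets[OF Us] by (intro emeasure_mono) (auto simp: s space_mY)
      qed
      also have "\<dots> = emeasure mY U" by (rule \<rho>(3)[OF Us])
      finally have 1: "emeasure \<eta> (W k) \<le> emeasure mY U" .
      have "emeasure mY (W k) = (\<integral>\<^sup>+ h. emeasure \<eta> ((+o) (0, h) -` W k \<inter> \<Y>) \<partial>\<rho>)"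
        by (rule \<rho>(3)[OF Ws, symmetric])
      also have "\<dots> \<le> (\<integral>\<^sup>+ h. emeasure \<eta> U \<partial>\<rho>)"
        using \<rho>(2)
      proof (intro nn_integral_mono_AE, eventually_elim)
        case (elim h)
        have "y \<in> U" if "(0, h) +o y \<in> W k" for y
          using elim MW[OF _ that, of "(0, - h)"] by (simp add: O'_def set_plus_rearrange2 flip: zero_prod_def)
        then show ?case using Us by (intro emeasure_mono) (auto simp: s)
      qed
      also have "\<dots> = emeasure \<eta> U" by (simp add: \<rho>.emeasure_space_1)
      finally show ?thesis using 1 by simp
    qed
    have lim: "(SUP k. emeasure M (W k)) = emeasure M U" if "sets M = sets mY" for M
    proof -
      have "(SUP k. emeasure M (W k)) = emeasure M (\<Union>k. W k)"
        using Ws that by (intro SUP_emeasure_incseq) (auto simp: W_def incseq_def intro: less_le_trans)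
      also have "(\<Union>k. W k) = U" unfolding W_def UV by auto
      finally show ?thesis .
    qed
    show ?thesis
    proof (rule antisym)
      show "emeasure \<eta> U \<le> emeasure mY U"
        unfolding lim[OF s, symmetric] using both by (intro SUP_least) simp
      show "emeasure mY U \<le> emeasure \<eta> U"
        unfolding lim[OF refl, symmetric] using both by (intro SUP_least) simp
    qed
  qed
  show ?thesis
  proof (rule measure_eqI_generator_eq[where E="{U. openin \<T> U}" and \<Omega>="\<Y>" and A="\<lambda>_. \<Y>"])
    show "Int_stable {U. openin \<T> U}" by (auto simp: Int_stable_def)
    show "{U. openin \<T> U} \<subseteq> Pow (\<Y>)" by (auto simp: openin_coset_topology)
    show "sets \<eta> = sigma_sets (\<Y>) {U. openin \<T> U}"
      "sets mY = sigma_sets (\<Y>) {U. openin \<T> U}"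
      by (simp_all add: s sets_mY sets_borel_of topspace_coset_topology)
    have "openin \<T> (\<Y>)"
      using openin_topspace[of "coset_topology \<Gamma>"] by (simp add: topspace_coset_topology)
    then show "range (\<lambda>_. \<Y>) \<subseteq> {U. openin \<T> U}" by auto
    show "emeasure \<eta> X = emeasure mY X" if "X \<in> {U. openin \<T> U}" for X
      using that open_eq by simp
    show "emeasure \<eta> (\<Y>) \<noteq> \<infinity>" by simp
  qed simp
qed

text \<open>Sigma-finiteness gives a strictly positive integrable function. Normalized, it is a
  density whose measure charges every nonempty open set, so the support is the whole group.\<close>

lemma ex_admissible: "\<exists>\<mu>. admissible mG \<mu>"
proof -
  obtain f where f: "f \<in> borel_measurable mG" "integral\<^sup>N mG f \<noteq> \<infinity>" "\<And>x. 0 < f x \<and> f x < \<infinity>"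
    using G.Ex_finite_integrable_function space_mG by auto
  note [measurable] = f(1)
  let ?I = "integral\<^sup>N mG f"
  have nF: "\<not> (AE a in mG. a \<notin> U)" if "open U" "U \<noteq> {}" for U
  proof
    assume "AE a in mG. a \<notin> U"
    then have "U \<in> null_sets mG" using that by (subst AE_iff_null_sets) (auto simp: sets_mG)
    then have "emeasure mG U = 0" by (rule null_setsD1)
    then show False using haarG that by (auto simp: haar_measure_def)
  qed
  have I: "?I \<noteq> 0"
  proof
    assume "?I = 0"
    then have "AE x in mG. f x = 0" by (simp add: nn_integral_0_iff_AE)
    then have "AE x in mG. x \<notin> UNIV" by eventually_elim (use f(3) in \<open>auto simp: less_le\<close>)
    with nF[of UNIV] show False by simp
  qed
  define \<mu> where "\<mu> = density mG (\<lambda>x. f x / ?I)"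
  have sets: "sets \<mu> = sets borel" by (simp add: \<mu>_def sets_mG)
  have "emeasure \<mu> (space \<mu>) = (\<integral>\<^sup>+ x. f x / ?I \<partial>mG)"
    unfolding \<mu>_def by (subst emeasure_density) (auto intro!: nn_integral_cong)
  also have "\<dots> = 1" using I f(2) by (subst nn_integral_divide) (auto simp: ennreal_divide_self less_top)
  finally have "prob_space \<mu>" by (rule prob_spaceI)
  moreover have "absolutely_continuous mG \<mu>"
    unfolding \<mu>_def by (intro absolutely_continuousI_density) measurable
  moreover have "measure_support \<mu> = UNIV"
  proof -
    have "0 < emeasure \<mu> U" if U: "open U" "U \<noteq> {}" for U
    proof (rule ccontr)
      assume "\<not> 0 < emeasure \<mu> U"
      then have "U \<in> null_sets \<mu>" using U sets by (auto simp: null_sets_def)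
      then have "AE x in mG. x \<in> U \<longrightarrow> f x / ?I = 0" unfolding \<mu>_def by (subst (asm) null_sets_density_iff) auto
      then have "AE x in mG. x \<notin> U"
        by eventually_elim (use f in \<open>auto simp: less_le ennreal_divide_eq_0_iff\<close>)
      with nF[OF U] show False by simp
    qed
    then show ?thesis unfolding measure_support_def by auto
  qed
  moreover have "add_subgroup hull (UNIV :: 'g set) = UNIV" using hull_subset[of UNIV add_subgroup] by auto
  ultimately show ?thesis using sets unfolding admissible_def by auto
qed

end

subsection \<open>The Chabauty--Fell topology\<close>

lemma chabauty_fell_topspace: "topspace chabauty_fell = {C. closed C}"
proof -
  have "\<Union>({{C. closed C \<and> C \<inter> V \<noteq> {}} | V. open V} \<union> {{C. closed C \<and> C \<inter> K = {}} | K. compact K})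
    = {C :: 'a set. closed C}" (is "\<Union>?S = _")
  proof
    show "\<Union>?S \<subseteq> {C. closed C}" by blast
    have "{C. closed C \<and> C \<inter> {} = {}} \<in> ?S" by blast
    then show "{C :: 'a set. closed C} \<subseteq> \<Union>?S" by (intro subsetI UnionI) auto
  qed
  then show ?thesis unfolding chabauty_fell_def by simp
qed

lemma chabauty_fell_hit: "open V \<Longrightarrow> openin chabauty_fell {C. closed C \<and> C \<inter> V \<noteq> {}}"
  unfolding chabauty_fell_def by (intro topology_generated_by_Basis) blast

lemma chabauty_fell_miss: "compact K \<Longrightarrow> openin chabauty_fell {C. closed C \<and> C \<inter> K = {}}"
  unfolding chabauty_fell_def by (intro topology_generated_by_Basis) blast

text \<open>A compact neighbourhood \<open>K\<close> of \<open>x\<close> disjoint from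
  \<open>D\<close> separates: \<open>C\<close> hits the open set inside \<open>K\<close>, and
  \<open>D\<close> misses \<open>K\<close>. This is where local compactness makes the topology
  Hausdorff.\<close>

lemma chabauty_fell_separate_aux:
  fixes C D :: "'a::t2_space set"
  assumes lc: "locally_compact_space (euclidean :: 'a topology)" and CD: "closed C" "closed D" and x: "x \<in> C" "x \<notin> D"
  obtains S T where "openin chabauty_fell S" "openin chabauty_fell T" "C \<in> S" "D \<in> T" "S \<inter> T = {}"
proof -
  have "neighbourhood_base_of (compactin euclidean) (euclidean :: 'a topology)"
    using lc hausdorff
    by (subst locally_compact_space_neighbourhood_base[symmetric]) (auto simp: Hausdorff_space_def disjnt_def)
  moreover have "openin euclidean (- D)" "x \<in> - D" using CD(2) x(2) by auto
  ultimately have "\<exists>U K. openin euclidean U \<and> compactin euclidean K \<and> x \<in> U \<and> U \<subseteq> K \<and> K \<subseteq> - D"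
    unfolding neighbourhood_base_of by blast
  then have "\<exists>U K. open U \<and> compact K \<and> x \<in> U \<and> U \<subseteq> K \<and> K \<subseteq> - D" by simp
  then obtain U K where UK: "open U" "compact K" "x \<in> U" "U \<subseteq> K" "K \<subseteq> - D" by metis
  show ?thesis
  proof (rule that[OF chabauty_fell_hit[OF UK(1)] chabauty_fell_miss[OF UK(2)]])
    show "C \<in> {C. closed C \<and> C \<inter> U \<noteq> {}}" using CD x UK by blast
    show "D \<in> {C. closed C \<and> C \<inter> K = {}}" using CD UK by blast
    show "{C. closed C \<and> C \<inter> U \<noteq> {}} \<inter> {C. closed C \<and> C \<inter> K = {}} = {}" using UK by blast
  qed
qed

lemma chabauty_fell_separate:
  fixes C D :: "'a::t2_space set"
  assumes lc: "locally_compact_space (euclidean :: 'a topology)" and CD: "closed C" "closed D" "C \<noteq> D"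
  obtains S T where "openin chabauty_fell S" "openin chabauty_fell T" "C \<in> S" "D \<in> T" "S \<inter> T = {}"
proof -
  consider x where "x \<in> C" "x \<notin> D" | x where "x \<in> D" "x \<notin> C" using CD(3) by blast
  then show ?thesis
  proof cases
    case 1
    then show ?thesis using chabauty_fell_separate_aux[OF lc CD(1,2)] that by metis
  next
    case 2
    obtain S T where "openin chabauty_fell S" "openin chabauty_fell T" "D \<in> S" "C \<in> T" "S \<inter> T = {}"
      by (rule chabauty_fell_separate_aux[OF lc CD(2,1) 2]) (rule that)
    then show ?thesis using that[of T S] by blast
  qed
qed

text \<open>Preimages of subbasic sets are subbasic: hitting \<open>V\<close> or missing
  \<open>K\<close> after translation by \<open>k\<close> means hitting or missing the set translated
  by \<open>- k\<close> before it.\<close>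

lemma continuous_map_chabauty_translate:
  fixes k :: "'g::topological_group_add"
  shows "continuous_map chabauty_fell chabauty_fell ((+o) k)"
proof -
  let ?S = "{{C. closed C \<and> C \<inter> V \<noteq> {}} | V. open V} \<union> {{C. closed C \<and> C \<inter> K = {}} | K :: 'g set. compact K}"
  have im: "l +o C = (+) l ` C" for l :: 'g and C by (auto simp: elt_set_plus_def)
  have cl: "closed (k +o C)" if "closed C" for C :: "'g set"
  proof -
    have "- (k +o C) = {x. - k + x \<in> - C}" by (auto simp: mem_translate_iff)
    then show ?thesis using open_left_translate[of "- C" "- k"] that by (simp add: closed_def)
  qed
  have int: "(k +o C) \<inter> A = {} \<longleftrightarrow> C \<inter> (- k +o A) = {}" for C A :: "'g set"
  proof -
    have "(k +o C) \<inter> A = {} \<longleftrightarrow> (\<forall>c\<in>C. k + c \<notin> A)" by (auto simp: elt_set_plus_def)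
    moreover have "C \<inter> (- k +o A) = {} \<longleftrightarrow> (\<forall>c\<in>C. k + c \<notin> A)" by (auto simp: mem_translate_iff)
    ultimately show ?thesis by simp
  qed
  have "continuous_map chabauty_fell (topology_generated_by ?S) ((+o) k)"
    unfolding continuous_on_generated_topo_iff
  proof (intro conjI allI impI)
    fix U assume "U \<in> ?S"
    then consider V where "open V" "U = {C. closed C \<and> C \<inter> V \<noteq> {}}"
      | K where "compact K" "U = {C. closed C \<and> C \<inter> K = {}}" by blast
    then show "openin chabauty_fell ((+o) k -` U \<inter> topspace chabauty_fell)"
    proof cases
      case 1
      have "open (- k +o V)"
      proof -
        have "- k +o V = {x. k + x \<in> V}" by (auto simp: mem_translate_iff)
        then show ?thesis using open_left_translate[OF 1(1)] by simp
      qed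
      moreover have "(+o) k -` U \<inter> topspace chabauty_fell = {C. closed C \<and> C \<inter> (- k +o V) \<noteq> {}}"
        using cl by (auto simp: 1 int chabauty_fell_topspace)
      ultimately show ?thesis by (simp add: chabauty_fell_hit)
    next
      case 2
      have "compact (- k +o K)"
        unfolding im using 2(1) by (auto intro!: compact_continuous_image continuous_intros)
      moreover have "(+o) k -` U \<inter> topspace chabauty_fell = {C. closed C \<and> C \<inter> (- k +o K) = {}}"
        using cl by (auto simp: 2 int chabauty_fell_topspace)
      ultimately show ?thesis by (simp add: chabauty_fell_miss)
    qed
  next
    have "topspace (topology_generated_by ?S) = {C. closed C}"
      using chabauty_fell_topspace[where 'a='g] unfolding chabauty_fell_def .
    then show "(+o) k ` topspace chabauty_fell \<subseteq> \<Union>?S"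
      using cl unfolding topology_generated_by_topspace chabauty_fell_topspace by auto
  qed
  then show ?thesis unfolding chabauty_fell_def .
qed

subsection \<open>The parametrization map\<close>

locale model_hull = cut_project \<Gamma> mG mH mY
  for \<Gamma> :: "('g::{topological_group_add,t2_space,second_countable_topology}
                \<times> 'h::{topological_group_add,t2_space,second_countable_topology}) set"
    and mG :: "'g measure" and mH :: "'h measure" and mY +
  fixes W :: "'h set" and P :: "'g set" and \<beta> :: "'g set \<Rightarrow> ('g \<times> 'h) set"
  assumes window: "regular_window mH \<Gamma> W"
    and P_def: "P = model_set \<Gamma> W"
    and beta: "parametrization_map \<Gamma> P \<beta>"
begin

lemma discrete_lattice: "discrete \<Gamma>"
  using scheme by (simp add: cut_and_project_scheme_def group_lattice_def)

lemma closed_lattice: "closed \<Gamma>"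
  using discrete_lattice by (rule closed_of_discrete)

lemma compact_W: "compact W" and interior_W: "interior W \<noteq> {}" and null_frontier: "emeasure mH (frontier W) = 0"
  using window by (auto simp: regular_window_def)

lemma closed_W: "closed W" using compact_W by (rule compact_imp_closed)

lemma coset_rep: "x \<in> y \<Longrightarrow> y \<in> \<Y> \<Longrightarrow> x +o \<Gamma> = y"
  by (elim coset_spaceE, hypsubst, rule coset_eqI)

lemma dense_meets:
  assumes "open A" "a \<in> A" shows "\<exists>c\<in>\<Gamma>. snd c \<in> A"
proof -
  have "A \<inter> closure (snd ` \<Gamma>) \<noteq> {}" using assms dense_snd by blast
  then have "A \<inter> snd ` \<Gamma> \<noteq> {}" using open_Int_closure_eq_empty[OF assms(1)] by simp
  then show ?thesis by blast
qed

text \<open>For the coset of \<open>(g, h)\<close> this is the translate by \<open>g\<close> of the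
  model set with window \<open>- h +o W\<close>. Reading it off from the coset as a set makes it
  independent of the representative.\<close>

definition window_points :: "('g \<times> 'h) set \<Rightarrow> 'g set" where
  "window_points y = fst ` {x \<in> y. snd x \<in> W}"

definition singular :: "('g \<times> 'h) set set" where
  "singular = {y \<in> \<Y>. \<exists>x\<in>y. snd x \<in> frontier W}"

text \<open>Translates of \<open>W\<close> stay compact, so regularity is a condition on the
  frontier alone, and the frontier of \<open>- h +o W\<close> meets the projected lattice exactly
  when the coset of \<open>(g, h)\<close> has a point over the frontier of \<open>W\<close>.\<close>

lemma nonsingular_eq: "nonsingular_params \<Gamma> W = \<Y> - singular"
proof -
  have fr: "frontier (- h +o W) \<inter> snd ` \<Gamma> = {} \<longleftrightarrow> (g, h) +o \<Gamma> \<notin> singular" for g h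
  proof -
    have "(\<exists>x\<in>(g, h) +o \<Gamma>. snd x \<in> frontier W) \<longleftrightarrow> (\<exists>c\<in>\<Gamma>. h + snd c \<in> frontier W)"
      unfolding bex_translate_iff by simp
    moreover have "frontier (- h +o W) \<inter> snd ` \<Gamma> = {} \<longleftrightarrow> \<not> (\<exists>c\<in>\<Gamma>. h + snd c \<in> frontier W)"
      unfolding frontier_translate by (force simp: mem_translate_iff)
    ultimately show ?thesis by (simp add: singular_def)
  qed
  have co: "compact (- h +o W)" for h
  proof -
    have "- h +o W = (+) (- h) ` W" by (auto simp: elt_set_plus_def)
    then show ?thesis using compact_W by (auto intro!: compact_continuous_image continuous_intros)
  qed
  have "lattice_regular \<Gamma> (- h +o W) \<longleftrightarrow> (g, h) +o \<Gamma> \<notin> singular" for g h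
    unfolding lattice_regular_def using fr co by simp
  then have "nonsingular_params \<Gamma> W = {(g, h) +o \<Gamma> | g h. (g, h) +o \<Gamma> \<notin> singular}"
    unfolding nonsingular_params_def by simp
  then show ?thesis by (auto simp: coset_space_def)
qed

lemma window_points_lattice: "window_points \<Gamma> = P"
proof -
  have "inj_on fst \<Gamma>" using scheme by (simp add: cut_and_project_scheme_def)
  then have "star_map \<Gamma> (fst x) = snd x" if "x \<in> \<Gamma>" for x
    using that by (simp add: star_map_def)
  then show ?thesis by (auto simp: P_def model_set_def window_points_def)
qed

lemma window_points_act: "window_points (param_act g y) = g +o window_points y"
proof -
  have "param_act g y = (+) (g, 0) ` y"
    by (auto simp: param_act_def elt_set_plus_def)
  then have "{x \<in> param_act g y. snd x \<in> W} = (+) (g, 0) ` {x \<in> y. snd x \<in> W}" by auto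
  moreover have "g +o fst ` X = fst ` (+) (g, 0) ` X" for X :: "('g \<times> 'h) set"
    by (auto simp: elt_set_plus_def image_image image_iff)
  ultimately show ?thesis unfolding window_points_def by simp
qed

lemma closed_window_points: "y \<in> \<Y> \<Longrightarrow> closed (window_points y)"
  unfolding window_points_def by (rule closed_fst_image_compact[OF closed_coset[OF closed_lattice] compact_W])

text \<open>Density of the projected lattice puts a point of every coset over the interior of
  \<open>W\<close>. Hence the candidate inverse of \<open>\<beta>\<close> never takes the value
  removed from the hull.\<close>

lemma window_points_nonempty:
  assumes "y \<in> \<Y>" shows "window_points y \<noteq> {}"
proof -
  obtain x where x: "y = x +o \<Gamma>" using assms by (rule coset_spaceE)
  have "open {d. snd x + d \<in> interior W}" by (intro open_left_translate) simp
  moreover obtain w where w: "w \<in> interior W" using interior_W by blast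
  moreover have "- snd x + w \<in> {d. snd x + d \<in> interior W}" using w by simp
  ultimately obtain c where "c \<in> \<Gamma>" "snd x + snd c \<in> interior W"
    using dense_meets by blast
  then have c: "c \<in> \<Gamma>" "snd x + snd c \<in> W" using interior_subset[of W] by auto
  then have "x + c \<in> {z \<in> y. snd z \<in> W}" by (auto simp: x)
  then show ?thesis unfolding window_points_def by blast
qed

text \<open>A point of a nonsingular coset over \<open>W\<close> lies over the interior of \<open>W\<close> and is stable under perturbation.\<close>

lemma window_points_continuous:
  assumes y: "y \<in> \<Y>" "y \<notin> singular" and S: "openin chabauty_fell S" "window_points y \<in> S"
  shows "\<exists>B. openin \<T> B \<and> y \<in> B \<and> (\<forall>z\<in>B. window_points z \<in> S)"
  using openin_topology_generated_by[OF S(1)[unfolded chabauty_fell_def]] S(2)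
proof induction
  case Empty
  then show ?case by simp
next
  case (Int a b)
  then obtain A B where "openin \<T> A" "y \<in> A" "\<forall>z\<in>A. window_points z \<in> a"
    "openin \<T> B" "y \<in> B" "\<forall>z\<in>B. window_points z \<in> b" by auto
  then show ?case by (intro exI[of _ "A \<inter> B"]) auto
next
  case (UN K)
  from UN.prems obtain k where k: "k \<in> K" "window_points y \<in> k" by auto
  obtain B where B: "openin \<T> B" "y \<in> B" "\<forall>z\<in>B. window_points z \<in> k"
    using UN.IH[OF k] by auto
  show ?case using B k(1) by (intro exI[of _ B]) auto
next
  case (Basis s)
  from Basis(1) consider V where "open V" "s = {C. closed C \<and> C \<inter> V \<noteq> {}}"
    | K where "compact K" "s = {C. closed C \<and> C \<inter> K = {}}" by auto
  then show ?case
  proof cases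
    case 1
    then obtain x where x: "x \<in> y" "fst x \<in> V" "snd x \<in> W"
      using Basis(2) by (auto simp: window_points_def)
    have "snd x \<notin> frontier W" using y x by (auto simp: singular_def)
    then have "snd x \<in> interior W" using x(3) closed_W by (simp add: frontier_def)
    define B where "B = (\<lambda>x. x +o \<Gamma>) ` (V \<times> interior W)"
    have "openin \<T> B"
      unfolding B_def using 1 by (intro openin_coset_image open_Times) auto
    moreover have "y \<in> B"
    proof -
      have "x +o \<Gamma> = y" using y(1) x(1) by (intro coset_rep)
      then show ?thesis unfolding B_def using x \<open>snd x \<in> interior W\<close>
        by (intro image_eqI[of _ _ x]) (auto simp: mem_Times_iff)
    qed
    moreover have "window_points z \<in> s" if "z \<in> B" for z
    proof -
      obtain x' where x': "z = x' +o \<Gamma>" "x' \<in> V \<times> interior W" using \<open>z \<in> B\<close> unfolding B_def by blast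
      then have "fst x' \<in> window_points z" "fst x' \<in> V"
        using coset_self[of x'] interior_subset[of W] by (auto simp: window_points_def intro!: image_eqI[of _ fst x'])
      then show ?thesis using closed_window_points[of z] x'(1) by (auto simp: 1)
    qed
    ultimately show ?thesis by blast
  next
    case 2
    \<comment> \<open>Missing \<open>K\<close> means that the coset avoids the compact set
      \<open>K \<times> W\<close>, which is an open condition on cosets.\<close>
    define B where "B = {z \<in> \<Y>. z \<inter> (K \<times> W) = {}}"
    have "openin \<T> B"
      unfolding B_def using 2 compact_W by (intro openin_coset_disjoint[OF closed_lattice] compact_Times)
    moreover have "y \<in> B" using y Basis(2) 2 by (force simp: B_def window_points_def)
    moreover have "window_points z \<in> s" if "z \<in> B" for z
      using that closed_window_points[of z] by (auto simp: B_def 2 window_points_def)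
    ultimately show ?thesis by blast
  qed
qed

text \<open>Sigma-compactness of the first factor: a coset is singular when it meets one of
  countably many compact sets \<open>K \<times> frontier W\<close>, and meeting a compact set is a
  closed condition.\<close>

lemma singular_sets: "singular \<in> sets mY"
proof -
  obtain \<K> :: "'g set set" where K: "countable \<K>" "\<And>K. K \<in> \<K> \<Longrightarrow> compact K" "\<Union>\<K> = UNIV"
    by (rule locally_compact_countable_cover[OF lcG]) (rule that)
  have "W \<inter> frontier W = frontier W" using frontier_subset_closed[OF closed_W] by (rule Int_absorb1)
  then have cf: "compact (frontier W)" using compact_Int_closed[OF compact_W frontier_closed[of W]] by (rule subst)
  have "singular = (\<Union>K\<in>\<K>. \<Y> - {y \<in> \<Y>. y \<inter> (K \<times> frontier W) = {}})" (is "_ = ?R")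
  proof (intro equalityI subsetI)
    fix y assume y: "y \<in> singular"
    then obtain x where x: "x \<in> y" "snd x \<in> frontier W" by (auto simp: singular_def)
    have "fst x \<in> \<Union>\<K>" by (simp add: K(3))
    then obtain K where "K \<in> \<K>" "fst x \<in> K" by (rule UnionE)
    then have "x \<in> y \<inter> (K \<times> frontier W)" using x by (simp add: mem_Times_iff)
    then show "y \<in> ?R" using \<open>K \<in> \<K>\<close> y by (auto simp: singular_def)
  next
    fix y assume "y \<in> ?R"
    then obtain x where "y \<in> \<Y>" "x \<in> y" "snd x \<in> frontier W" by auto
    then show "y \<in> singular" unfolding singular_def by blast
  qed
  moreover have "?R \<in> sets mY"
  proof (rule sets.countable_UN''[OF K(1)])
    fix K assume "K \<in> \<K>"
    then have "openin \<T> {y \<in> \<Y>. y \<inter> (K \<times> frontier W) = {}}"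
      using K(2) cf by (intro openin_coset_disjoint[OF closed_lattice] compact_Times) auto
    then have "{y \<in> \<Y>. y \<inter> (K \<times> frontier W) = {}} \<in> sets mY"
      by (simp add: sets_mY openin_sets_borel_of)
    then show "\<Y> - {y \<in> \<Y>. y \<inter> (K \<times> frontier W) = {}} \<in> sets mY"
      unfolding space_mY[symmetric] by (rule sets.compl_sets)
  qed
  ultimately show ?thesis by simp
qed

text \<open>The preimage in the group is the union, over the countable lattice, of right translates
  of the strip over the frontier of \<open>W\<close>, which is null in the product Haar
  measure.\<close>

lemma emeasure_singular: "emeasure mY singular = 0"
proof -
  have F: "(UNIV :: 'g set) \<times> frontier W \<in> sets borel" by (intro borel_closed closed_Times) auto
  have F0: "emeasure (mG \<Otimes>\<^sub>M mH) (UNIV \<times> frontier W) = 0"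
    using null_frontier by (subst H.emeasure_pair_measure_Times) (auto simp: sets_mG sets_mH)
  have "{x. x +o \<Gamma> \<in> singular} = (\<Union>c\<in>\<Gamma>. {x. x + c \<in> UNIV \<times> frontier W})"
    by (auto simp: singular_def bex_translate_iff mem_Times_iff)
  also have "\<dots> \<in> null_sets (mG \<Otimes>\<^sub>M mH)"
  proof (rule null_sets_UN'[OF discrete_countable[OF discrete_lattice]])
    fix c :: "'g \<times> 'h"
    have "{x. x + c \<in> UNIV \<times> frontier W} \<in> sets borel"
      using measurable_sets_borel[of "\<lambda>x. x + c" borel, OF _ F] by (simp add: vimage_def)
    then show "{x. x + c \<in> UNIV \<times> frontier W} \<in> null_sets (mG \<Otimes>\<^sub>M mH)"
      using haar_null_right_translate[OF haarGH F F0] by (simp add: null_sets_def sets_mGH)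
  qed
  finally show ?thesis using emeasure_mY_null_iff[OF singular_sets] by (simp add: null_setsD1)
qed

section \<open>The punctured hull and the closed graph of the parametrization map\<close>

abbreviation "phull \<equiv> punctured_hull P"

text \<open>An open box in the preimage contains a point whose second coordinate is that of a
  lattice element; subtracting this element on the right leaves second coordinate 0 and the same
  coset.\<close>

lemma orbit_dense:
  assumes "openin \<T> B" "y \<in> B"
  shows "\<exists>g. param_act g \<Gamma> \<in> B"
proof -
  have o: "open {x. x +o \<Gamma> \<in> B}" using assms(1) by (rule openin_coset_vimage)
  have "y \<in> \<Y>" using assms by (auto simp: openin_coset_topology)
  then obtain x where "x \<in> {x. x +o \<Gamma> \<in> B}" using assms(2) coset_spaceE by blast
  then obtain U V where UV: "open U" "open V" "x \<in> U \<times> V" "U \<times> V \<subseteq> {x. x +o \<Gamma> \<in> B}"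
    using open_prod_elim[OF o] by metis
  then obtain c where c: "c \<in> \<Gamma>" "snd c \<in> V" using dense_meets[of V "snd x"] by (auto simp: mem_Times_iff)
  have "(fst x, snd c) +o \<Gamma> \<in> B" using UV c(2) by (auto simp: mem_Times_iff)
  moreover have "(fst x, snd c) = (fst x - fst c, 0) + c" by (simp add: prod_eq_iff)
  then have "(fst x, snd c) +o \<Gamma> = param_act (fst x - fst c) \<Gamma>"
    using coset_add_right[OF c(1)] by (simp add: param_act_def)
  ultimately show ?thesis by metis
qed

lemma lattice_coset: "\<Gamma> \<in> \<Y>"
  using coset_in_space[of 0] by (simp only: coset_zero)

lemma orbit_window_points: "g +o P = window_points (param_act g \<Gamma>)"
  by (simp add: window_points_act window_points_lattice)

lemma param_act_coset: "y \<in> \<Y> \<Longrightarrow> param_act g y \<in> \<Y>"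
  unfolding param_act_def by (rule coset_translate_space)

lemma hull_nonempty: "Q \<in> phull \<Longrightarrow> Q \<noteq> {}" and hull_closed: "Q \<in> phull \<Longrightarrow> closed Q"
  and hull_approx: "Q \<in> phull \<Longrightarrow> openin chabauty_fell S \<Longrightarrow> Q \<in> S \<Longrightarrow> \<exists>g. g +o P \<in> S"
  by (auto simp: punctured_hull_def hull_of_def in_closure_of chabauty_fell_topspace)

lemma hullI:
  assumes "closed Q" "Q \<noteq> {}" "\<And>S. openin chabauty_fell S \<Longrightarrow> Q \<in> S \<Longrightarrow> \<exists>g. g +o P \<in> S"
  shows "Q \<in> phull"
  using assms by (auto simp: punctured_hull_def hull_of_def in_closure_of chabauty_fell_topspace)

lemma orbit_hull: "g +o P \<in> phull"
  by (rule hullI)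
    (use closed_window_points window_points_nonempty param_act_coset lattice_coset in \<open>auto simp: orbit_window_points\<close>)

lemma beta_measurable: "\<beta> \<in> measurable (borel_of (punctured_hull_topology P)) (borel_of \<T>)"
  and beta_equivariant: "Q \<in> phull \<Longrightarrow> \<beta> (g +o Q) = param_act g (\<beta> Q)"
  and beta_closed_graph: "closedin (prod_topology (punctured_hull_topology P) \<T>) {(Q, \<beta> Q) | Q. Q \<in> phull}"
  and beta_P: "\<beta> P = \<Gamma>"
  using beta unfolding parametrization_map_def by (auto simp flip: zero_prod_def)

lemma topspace_hull: "topspace (punctured_hull_topology P) = phull"
  unfolding punctured_hull_topology_def using hull_closed by (auto simp: chabauty_fell_topspace)

lemma beta_coset: "Q \<in> phull \<Longrightarrow> \<beta> Q \<in> \<Y>"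
  using measurable_space[OF beta_measurable, of Q] by (simp add: topspace_hull topspace_coset_topology)

lemma beta_orbit: "\<beta> (g +o P) = param_act g \<Gamma>"
  using beta_equivariant[of P g] orbit_hull[of 0] beta_P by (simp add: elt_set_plus_def)

text \<open>The complement of the closed graph contains a box around \<open>(Q, z)\<close>.\<close>

lemma graph_separation:
  assumes "Q \<in> phull" "z \<in> \<Y>" "\<beta> Q \<noteq> z"
  obtains S B where "openin chabauty_fell S" "Q \<in> S" "openin \<T> B" "z \<in> B"
    "\<And>R. R \<in> phull \<Longrightarrow> R \<in> S \<Longrightarrow> \<beta> R \<notin> B"
proof -
  let ?X = "prod_topology (punctured_hull_topology P) \<T>"
  let ?G = "{(Q, \<beta> Q) | Q. Q \<in> phull}"
  have "openin ?X (topspace ?X - ?G)" using beta_closed_graph by (simp add: closedin_def)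
  moreover have "(Q, z) \<in> topspace ?X - ?G"
    using assms by (auto simp: topspace_hull topspace_coset_topology)
  ultimately obtain A B where AB: "openin (punctured_hull_topology P) A" "openin \<T> B"
    "Q \<in> A" "z \<in> B" "A \<times> B \<subseteq> topspace ?X - ?G"
    unfolding openin_prod_topology_alt by meson
  obtain S where S: "openin chabauty_fell S" "A = S \<inter> phull"
    using AB(1) unfolding punctured_hull_topology_def openin_subtopology by blast
  show ?thesis
  proof (rule that[OF S(1) _ AB(2,4)])
    show "Q \<in> S" using S AB by blast
    show "\<beta> R \<notin> B" if "R \<in> phull" "R \<in> S" for R
      using AB(5) S(2) that by blast
  qed
qed

text \<open>Near a nonsingular \<open>y\<close> there are orbit points whose cosets approach
  \<open>y\<close> and whose model sets simultaneously approach \<open>window_points y\<close>. On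
  the orbit \<open>\<beta>\<close> is known, so the limit pair lies in its closed graph.\<close>

lemma window_points_hull:
  assumes y: "y \<in> \<Y>" "y \<notin> singular"
  shows "window_points y \<in> phull" "\<beta> (window_points y) = y"
proof -
  have approx: "\<exists>g. g +o P \<in> S \<and> param_act g \<Gamma> \<in> B"
    if S: "openin chabauty_fell S" "window_points y \<in> S" and B: "openin \<T> B" "y \<in> B" for S B
  proof -
    obtain B' where B': "openin \<T> B'" "y \<in> B'" "\<forall>z\<in>B'. window_points z \<in> S"
      using window_points_continuous[OF y S] by blast
    then obtain g where "param_act g \<Gamma> \<in> B \<inter> B'"
      using orbit_dense[OF openin_Int[OF B(1) B'(1)]] B(2) by blast
    then show ?thesis using B'(3) orbit_window_points by auto
  qed
  show h: "window_points y \<in> phull"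
  proof (rule hullI)
    show "\<exists>g. g +o P \<in> S" if "openin chabauty_fell S" "window_points y \<in> S" for S
      using approx[OF that, of "\<Y>"] y(1) openin_topspace[of "coset_topology \<Gamma>"]
      by (auto simp: topspace_coset_topology)
  qed (use y closed_window_points window_points_nonempty in auto)
  show "\<beta> (window_points y) = y"
  proof (rule ccontr)
    assume "\<beta> (window_points y) \<noteq> y"
    then obtain S B where SB: "openin chabauty_fell S" "window_points y \<in> S" "openin \<T> B" "y \<in> B"
      "\<And>R. R \<in> phull \<Longrightarrow> R \<in> S \<Longrightarrow> \<beta> R \<notin> B"
      using graph_separation[OF h y(1)] by metis
    obtain g where "g +o P \<in> S" "param_act g \<Gamma> \<in> B" using approx[OF SB(1-4)] by blast
    then show False using SB(5)[OF orbit_hull] beta_orbit by auto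
  qed
qed

text \<open>If \<open>g +o P\<close> is close to a nonempty \<open>Q\<close>, then \<open>param_act g \<Gamma>\<close> meets the compact set \<open>K \<times> W\<close> for a
  compact neighbourhood \<open>K\<close> of a point of \<open>Q\<close>. This compactness turns the closed graph into continuity.\<close>

lemma beta_approx:
  assumes Q: "Q \<in> phull" and S: "openin chabauty_fell S" "Q \<in> S" and B: "openin \<T> B" "\<beta> Q \<in> B"
  shows "\<exists>g. g +o P \<in> S \<and> param_act g \<Gamma> \<in> B"
proof -
  obtain q where q: "q \<in> Q" using hull_nonempty[OF Q] by blast
  have "\<exists>V K. open V \<and> compact K \<and> q \<in> V \<and> V \<subseteq> K"
    using lcG unfolding locally_compact_space_def by simp
  then obtain V K where VK: "open V" "compact K" "q \<in> V" "V \<subseteq> K" by metis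
  \<comment> \<open>At the coset \<open>\<beta> Q\<close> the given \<open>S\<close> and
    \<open>B\<close> serve. At any other coset the separation of the graph makes the implication
    vacuous: no orbit point near \<open>Q\<close> has its coset near that of
    \<open>x\<close>.\<close>
  have "\<exists>S' B'. openin chabauty_fell S' \<and> Q \<in> S' \<and> openin \<T> B' \<and> x +o \<Gamma> \<in> B' \<and>
      (\<forall>g. g +o P \<in> S' \<longrightarrow> param_act g \<Gamma> \<in> B' \<longrightarrow> g +o P \<in> S \<and> param_act g \<Gamma> \<in> B)" for x
  proof (cases "\<beta> Q = x +o \<Gamma>")
    case True
    then show ?thesis using S B by (intro exI[of _ S] exI[of _ B]) auto
  next
    case False
    obtain S' B' where "openin chabauty_fell S'" "Q \<in> S'" "openin \<T> B'" "x +o \<Gamma> \<in> B'"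
      "\<And>R. R \<in> phull \<Longrightarrow> R \<in> S' \<Longrightarrow> \<beta> R \<notin> B'"
      using graph_separation[OF Q coset_in_space False] by metis
    then show ?thesis using orbit_hull beta_orbit by (intro exI[of _ S'] exI[of _ B']) metis
  qed
  then obtain S' B' where SB: "\<And>x. openin chabauty_fell (S' x)" "\<And>x. Q \<in> S' x"
    "\<And>x. openin \<T> (B' x)" "\<And>x. x +o \<Gamma> \<in> B' x"
    "\<And>x g. g +o P \<in> S' x \<Longrightarrow> param_act g \<Gamma> \<in> B' x \<Longrightarrow> g +o P \<in> S \<and> param_act g \<Gamma> \<in> B"
    by metis
  have "compact (K \<times> W)" using VK compact_W by (intro compact_Times)
  moreover have "K \<times> W \<subseteq> (\<Union>x. {z. z +o \<Gamma> \<in> B' x})" using SB(4) by fast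
  ultimately obtain F where F: "finite F" "K \<times> W \<subseteq> (\<Union>x\<in>F. {z. z +o \<Gamma> \<in> B' x})"
    using openin_coset_vimage[OF SB(3)] by (elim compactE_image) auto
  define S2 where "S2 = {C. closed C \<and> C \<inter> V \<noteq> {}} \<inter> (\<Inter>x\<in>F. S' x)"
  have "openin chabauty_fell S2"
  \<comment> \<open>The intersection over an empty \<open>F\<close> is the universe, which is not
    open in a topology on closed sets; in that case \<open>S2\<close> is just the hit set.\<close>
  proof (cases "F = {}")
    case False
    then show ?thesis unfolding S2_def using F(1) SB(1)
      by (intro openin_Int chabauty_fell_hit VK(1) openin_Inter) auto
  qed (simp add: S2_def chabauty_fell_hit VK)
  moreover have "Q \<in> S2" unfolding S2_def using SB(2) hull_closed[OF Q] q VK by auto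
  ultimately obtain g where g: "g +o P \<in> S2" using hull_approx[OF Q] by blast
  then obtain x where x: "x \<in> param_act g \<Gamma>" "fst x \<in> V" "snd x \<in> W"
    unfolding S2_def orbit_window_points by (auto simp: window_points_def)
  then have "x \<in> K \<times> W" using VK by (auto simp: mem_Times_iff)
  then obtain z where z: "z \<in> F" "x +o \<Gamma> \<in> B' z" using F(2) by blast
  have "x +o \<Gamma> = param_act g \<Gamma>"
    using x(1) param_act_coset[OF lattice_coset, of g] by (rule coset_rep)
  then show ?thesis using SB(5)[of g z] z g unfolding S2_def by auto
qed

text \<open>By \<open>beta_approx\<close> some orbit point is near \<open>Q\<close> while its coset
  is near \<open>\<beta> Q\<close>. Continuity of \<open>window_points\<close> at the nonsingular
  \<open>\<beta> Q\<close> puts the same orbit point near \<open>window_points (\<beta> Q)\<close>,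
  and the topology is Hausdorff.\<close>

lemma beta_inverse:
  assumes Q: "Q \<in> phull" and ns: "\<beta> Q \<notin> singular"
  shows "window_points (\<beta> Q) = Q"
proof (rule ccontr)
  assume "window_points (\<beta> Q) \<noteq> Q"
  then obtain S T where ST: "openin chabauty_fell S" "openin chabauty_fell T" "window_points (\<beta> Q) \<in> S" "Q \<in> T" "S \<inter> T = {}"
    using chabauty_fell_separate[OF lcG closed_window_points[OF beta_coset[OF Q]] hull_closed[OF Q]] by metis
  obtain B where B: "openin \<T> B" "\<beta> Q \<in> B" "\<forall>z\<in>B. window_points z \<in> S"
    using window_points_continuous[OF beta_coset[OF Q] ns ST(1,3)] by blast
  obtain g where "g +o P \<in> T" "param_act g \<Gamma> \<in> B" using beta_approx[OF Q ST(2,4) B(1,2)] by blast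
  then show False using B(3) ST(5) orbit_window_points by auto
qed

end

subsection \<open>Square-integrable functions\<close>

lemma L2_funD: "f \<in> L2_fun M \<Longrightarrow> f \<in> borel_measurable M" "f \<in> L2_fun M \<Longrightarrow> integrable M (\<lambda>x. (cmod (f x))\<^sup>2)"
  by (auto simp: L2_fun_def)

lemma L2_fun_add:
  assumes f: "f \<in> L2_fun M" and k: "k \<in> L2_fun M" shows "(\<lambda>x. f x + k x) \<in> L2_fun M"
proof -
  note [measurable] = L2_funD(1)[OF f] L2_funD(1)[OF k]
  have le: "(cmod (a + b))\<^sup>2 \<le> 2 * (cmod a)\<^sup>2 + 2 * (cmod b)\<^sup>2" for a b :: complex
  proof -
    have "(cmod (a + b))\<^sup>2 \<le> (cmod a + cmod b)\<^sup>2" by (intro power_mono norm_triangle_ineq) auto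
    also have "\<dots> \<le> 2 * (cmod a)\<^sup>2 + 2 * (cmod b)\<^sup>2"
      using sum_squares_bound[of "cmod a" "cmod b"] by (simp add: power2_sum)
    finally show ?thesis .
  qed
  have "integrable M (\<lambda>x. (cmod (f x + k x))\<^sup>2)"
  proof (rule Bochner_Integration.integrable_bound)
    show "integrable M (\<lambda>x. 2 * (cmod (f x))\<^sup>2 + 2 * (cmod (k x))\<^sup>2)"
      using L2_funD(2)[OF f] L2_funD(2)[OF k] by (intro Bochner_Integration.integrable_add integrable_mult_right)
    show "(\<lambda>x. (cmod (f x + k x))\<^sup>2) \<in> borel_measurable M" by measurable
    show "AE x in M. norm ((cmod (f x + k x))\<^sup>2) \<le> norm (2 * (cmod (f x))\<^sup>2 + 2 * (cmod (k x))\<^sup>2)"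
      using le by (intro AE_I2) simp
  qed
  then show ?thesis by (simp add: L2_fun_def)
qed

lemma L2_fun_scale: "f \<in> L2_fun M \<Longrightarrow> (\<lambda>x. c * f x) \<in> L2_fun M"
  by (auto simp: L2_fun_def norm_mult power_mult_distrib)

lemma L2_rel_iff: "(f, k) \<in> L2_rel M \<longleftrightarrow> f \<in> L2_fun M \<and> k \<in> L2_fun M \<and> (AE x in M. f x = k x)"
  by (simp add: L2_rel_def)

lemma equiv_L2_rel: "equiv (L2_fun M) (L2_rel M)"
proof (rule equivI)
  show "refl_on (L2_fun M) (L2_rel M)" by (auto simp: refl_on_def L2_rel_iff)
  show "sym (L2_rel M)" by (rule symI) (auto simp: L2_rel_iff elim: AE_mp)
  show "trans (L2_rel M)"
  proof (rule transI)
    fix f g h assume "(f, g) \<in> L2_rel M" "(g, h) \<in> L2_rel M"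
    then have m: "f \<in> L2_fun M" "h \<in> L2_fun M" and ae: "AE x in M. f x = g x" "AE x in M. g x = h x"
      by (auto simp: L2_rel_iff)
    from ae have "AE x in M. f x = h x" by eventually_elim simp
    with m show "(f, h) \<in> L2_rel M" by (simp add: L2_rel_iff)
  qed
qed (auto simp: L2_rel_iff)

lemma borel_measurable_cnj [measurable]: "f \<in> borel_measurable M \<Longrightarrow> (\<lambda>x. cnj (f x)) \<in> borel_measurable M"
  using measurable_compose[OF _ borel_measurable_continuous_onI[of cnj]] continuous_on_cnj[OF continuous_on_id] by blast

abbreviation L2_class :: "'a measure \<Rightarrow> ('a \<Rightarrow> complex) \<Rightarrow> ('a \<Rightarrow> complex) set" where
  "L2_class M f \<equiv> L2_rel M `` {f}"

lemma L2_class_self: "f \<in> L2_fun M \<Longrightarrow> f \<in> L2_class M f"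
  by (simp add: L2_rel_iff)

lemma L2_class_eqI: "f \<in> L2_fun M \<Longrightarrow> g \<in> L2_fun M \<Longrightarrow> (AE x in M. f x = g x) \<Longrightarrow> L2_class M f = L2_class M g"
  by (rule equiv_class_eq[OF equiv_L2_rel]) (simp add: L2_rel_iff)

lemma L2_classI: "f \<in> L2_fun M \<Longrightarrow> L2_class M f \<in> L2 M"
  unfolding L2_def by (rule quotientI)

lemma L2E:
  assumes "u \<in> L2 M" obtains f where "f \<in> L2_fun M" "u = L2_class M f"
  using assms unfolding L2_def by (rule quotientE)

text \<open>Operations on classes are unions over all representatives; once the result is
  independent of the representative, the union collapses to a single class.\<close>

lemma L2_class_UN:
  assumes "f \<in> L2_fun M" "\<And>g. g \<in> L2_class M f \<Longrightarrow> X g = X f"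
  shows "(\<Union>g\<in>L2_class M f. X g) = X f"
  using L2_class_self[OF assms(1)] assms(2) by blast

lemma L2_add_class:
  assumes f: "f \<in> L2_fun M" and k: "k \<in> L2_fun M"
  shows "L2_add M (L2_class M f) (L2_class M k) = L2_class M (\<lambda>x. f x + k x)"
proof -
  have eq: "L2_class M (\<lambda>x. f' x + k' x) = L2_class M (\<lambda>x. f x + k x)"
    if "f' \<in> L2_class M f" "k' \<in> L2_class M k" for f' k'
  proof (rule L2_class_eqI)
    have "AE x in M. f x = f' x" "AE x in M. k x = k' x" using that by (auto simp: L2_rel_iff)
    then show "AE x in M. f' x + k' x = f x + k x" by eventually_elim simp
  qed (use that f k in \<open>auto simp: L2_rel_iff intro: L2_fun_add\<close>)
  have "(\<Union>k'\<in>L2_class M k. L2_class M (\<lambda>x. f' x + k' x)) = L2_class M (\<lambda>x. f x + k x)" if "f' \<in> L2_class M f" for f'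
    using eq[OF that] L2_class_self[OF k] by blast
  then show ?thesis unfolding L2_add_def using L2_class_self[OF f] by blast
qed

lemma L2_scale_class:
  assumes f: "f \<in> L2_fun M" shows "L2_scale M c (L2_class M f) = L2_class M (\<lambda>x. c * f x)"
  unfolding L2_scale_def
proof (rule L2_class_UN[OF f])
  fix g assume g: "g \<in> L2_class M f"
  then have "AE x in M. f x = g x" by (simp add: L2_rel_iff)
  then have "AE x in M. c * g x = c * f x" by eventually_elim simp
  then show "L2_class M (\<lambda>x. c * g x) = L2_class M (\<lambda>x. c * f x)"
    using g f by (intro L2_class_eqI L2_fun_scale) (auto simp: L2_rel_iff)
qed

lemma L2_inner_class:
  assumes f: "f \<in> L2_fun M" and k: "k \<in> L2_fun M"
  shows "L2_inner M (L2_class M f) (L2_class M k) = (LINT x|M. f x * cnj (k x))"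
proof -
  have eq: "(LINT x|M. f' x * cnj (k' x)) = (LINT x|M. f x * cnj (k x))"
    if "f' \<in> L2_class M f" "k' \<in> L2_class M k" for f' k'
  proof (rule integral_cong_AE)
    have [measurable]: "f' \<in> borel_measurable M" "k' \<in> borel_measurable M" "f \<in> borel_measurable M" "k \<in> borel_measurable M"
      using that f k by (auto simp: L2_rel_iff L2_fun_def)
    show "(\<lambda>x. f' x * cnj (k' x)) \<in> borel_measurable M" "(\<lambda>x. f x * cnj (k x)) \<in> borel_measurable M"
      by measurable
    have "AE x in M. f x = f' x" "AE x in M. k x = k' x" using that by (auto simp: L2_rel_iff)
    then show "AE x in M. f' x * cnj (k' x) = f x * cnj (k x)" by eventually_elim simp
  qed
  have "(\<Union>f'\<in>L2_class M f. \<Union>k'\<in>L2_class M k. {LINT x|M. f' x * cnj (k' x)}) = {LINT x|M. f x * cnj (k x)}"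
    using eq L2_class_self[OF f] L2_class_self[OF k] by blast
  then show ?thesis unfolding L2_inner_def by simp
qed

lemma L2_dist_class:
  assumes f: "f \<in> L2_fun M" and k: "k \<in> L2_fun M"
  shows "L2_dist M (L2_class M f) (L2_class M k) = sqrt (LINT x|M. (cmod (f x - k x))\<^sup>2)"
proof -
  have m: "(\<lambda>x. f x + - 1 * k x) \<in> L2_fun M" using f k by (intro L2_fun_add L2_fun_scale)
  have "(LINT x|M. (f x + - 1 * k x) * cnj (f x + - 1 * k x)) = (LINT x|M. complex_of_real ((cmod (f x - k x))\<^sup>2))"
    by (intro Bochner_Integration.integral_cong) (simp_all only: complex_norm_square, simp_all)
  then have "L2_inner M (L2_class M (\<lambda>x. f x + - 1 * k x)) (L2_class M (\<lambda>x. f x + - 1 * k x))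
    = complex_of_real (LINT x|M. (cmod (f x - k x))\<^sup>2)"
    using L2_inner_class[OF m m] by (simp only: integral_complex_of_real)
  then show ?thesis
    unfolding L2_dist_def Let_def L2_scale_class[OF k] L2_add_class[OF f L2_fun_scale[OF k]] by simp
qed

lemma L2_fun_comp:
  assumes \<phi>: "\<phi> \<in> measurable M N" "distr M N \<phi> = N" and f: "f \<in> L2_fun N"
  shows "f \<circ> \<phi> \<in> L2_fun M"
proof -
  note fm = L2_funD(1)[OF f]
  have "integrable (distr M N \<phi>) (\<lambda>x. (cmod (f x))\<^sup>2)" using L2_funD(2)[OF f] \<phi>(2) by simp
  then have "integrable M (\<lambda>x. (cmod (f (\<phi> x)))\<^sup>2)"
    using fm by (subst (asm) integrable_distr_eq[OF \<phi>(1)]) auto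
  then show ?thesis using measurable_comp[OF \<phi>(1) fm] by (simp add: L2_fun_def)
qed

lemma AE_comp:
  assumes \<phi>: "\<phi> \<in> measurable M N" "distr M N \<phi> = N" and "AE y in N. P y"
  shows "AE x in M. P (\<phi> x)"
  using assms(3) AE_distrD[OF \<phi>(1), of P] unfolding \<phi>(2) by blast

lemma L2_pullback_class:
  assumes \<phi>: "\<phi> \<in> measurable M N" "distr M N \<phi> = N" and f: "f \<in> L2_fun N"
  shows "L2_pullback M \<phi> (L2_class N f) = L2_class M (f \<circ> \<phi>)"
  unfolding L2_pullback_def
proof (rule L2_class_UN[OF f])
  fix g assume g: "g \<in> L2_class N f"
  then have "AE y in N. f y = g y" by (simp add: L2_rel_iff)
  from AE_comp[OF \<phi> this] have "AE x in M. (g \<circ> \<phi>) x = (f \<circ> \<phi>) x" by eventually_elim simp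
  then show "L2_class M (g \<circ> \<phi>) = L2_class M (f \<circ> \<phi>)"
    using g f by (intro L2_class_eqI L2_fun_comp[OF \<phi>]) (auto simp: L2_rel_iff)
qed

text \<open>Covers the Koopman operators, with \<open>act (- k)\<close> and \<open>act k\<close> as
  the two maps, and later \<open>\<beta>\<close> with its section. Inverses up to null sets suffice
  because the vectors are almost-everywhere classes.\<close>

lemma L2_unitary_pullback:
  assumes \<phi>: "\<phi> \<in> measurable M N" "distr M N \<phi> = N" and \<psi>: "\<psi> \<in> measurable N M" "distr N M \<psi> = M"
    and inv: "AE x in M. \<psi> (\<phi> x) = x" "AE y in N. \<phi> (\<psi> y) = y"
  shows "L2_unitary N M (L2_pullback M \<phi>)"
  unfolding L2_unitary_def
proof (intro conjI ballI allI)
  show "bij_betw (L2_pullback M \<phi>) (L2 N) (L2 M)"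
  proof (rule bij_betw_byWitness[where f'="L2_pullback N \<psi>"])
    have "L2_pullback N \<psi> (L2_pullback M \<phi> u) = u" if u: "u \<in> L2 N" for u
    proof -
      obtain f where f: "f \<in> L2_fun N" "u = L2_class N f" using u by (rule L2E)
      have "AE y in N. (f \<circ> \<phi> \<circ> \<psi>) y = f y" using inv(2) by eventually_elim simp
      then show ?thesis
        by (simp add: f L2_pullback_class[OF \<phi>] L2_pullback_class[OF \<psi>] L2_fun_comp[OF \<phi>] L2_fun_comp[OF \<psi>] L2_class_eqI)
    qed
    then show "\<forall>u\<in>L2 N. L2_pullback N \<psi> (L2_pullback M \<phi> u) = u" by blast
    have "L2_pullback M \<phi> (L2_pullback N \<psi> u) = u" if u: "u \<in> L2 M" for u
    proof -
      obtain f where f: "f \<in> L2_fun M" "u = L2_class M f" using u by (rule L2E)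
      have "AE y in M. (f \<circ> \<psi> \<circ> \<phi>) y = f y" using inv(1) by eventually_elim simp
      then show ?thesis
        by (simp add: f L2_pullback_class[OF \<phi>] L2_pullback_class[OF \<psi>] L2_fun_comp[OF \<phi>] L2_fun_comp[OF \<psi>] L2_class_eqI)
    qed
    then show "\<forall>u\<in>L2 M. L2_pullback M \<phi> (L2_pullback N \<psi> u) = u" by blast
    show "L2_pullback M \<phi> ` L2 N \<subseteq> L2 M"
      by (auto elim!: L2E simp: L2_pullback_class[OF \<phi>] intro!: L2_classI L2_fun_comp[OF \<phi>])
    show "L2_pullback N \<psi> ` L2 M \<subseteq> L2 N"
      by (auto elim!: L2E simp: L2_pullback_class[OF \<psi>] intro!: L2_classI L2_fun_comp[OF \<psi>])
  qed
next
  fix u v assume "u \<in> L2 N" "v \<in> L2 N"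
  then obtain f k where f: "f \<in> L2_fun N" "u = L2_class N f" and k: "k \<in> L2_fun N" "v = L2_class N k"
    by (metis L2E)
  note c = L2_fun_comp[OF \<phi>]
  show "L2_pullback M \<phi> (L2_add N u v) = L2_add M (L2_pullback M \<phi> u) (L2_pullback M \<phi> v)"
    by (simp add: f k L2_add_class L2_fun_add c L2_pullback_class[OF \<phi>] comp_def[of "\<lambda>x. f x + k x"])
  have "(LINT y|N. f y * cnj (k y)) = (LINT y|distr M N \<phi>. f y * cnj (k y))" by (simp add: \<phi>(2))
  also have "\<dots> = (LINT x|M. f (\<phi> x) * cnj (k (\<phi> x)))"
  proof (rule integral_distr[OF \<phi>(1)])
    note [measurable] = L2_funD(1)[OF f(1)] L2_funD(1)[OF k(1)]
    show "(\<lambda>y. f y * cnj (k y)) \<in> borel_measurable N" by measurable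
  qed
  finally show "L2_inner M (L2_pullback M \<phi> u) (L2_pullback M \<phi> v) = L2_inner N u v"
    by (simp add: f k L2_inner_class c L2_pullback_class[OF \<phi>])
next
  fix c u assume "u \<in> L2 N"
  then obtain f where f: "f \<in> L2_fun N" "u = L2_class N f" by (rule L2E)
  show "L2_pullback M \<phi> (L2_scale N c u) = L2_scale M c (L2_pullback M \<phi> u)"
    by (simp add: f L2_scale_class L2_fun_scale L2_fun_comp[OF \<phi>] L2_pullback_class[OF \<phi>] comp_def[of "\<lambda>x. c * f x"])
qed

subsection \<open>Koopman representations\<close>

text \<open>The condition \<open>small\<close> is strong continuity tested on indicator functions:
  the measure of the symmetric difference is the squared distance between an indicator and its
  translate.\<close>

locale small_translation_action = prob_space M
  for M :: "'a measure" +
  fixes act :: "'k::topological_group_add \<Rightarrow> 'a \<Rightarrow> 'a"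
  assumes act_measurable: "act k \<in> measurable M M" and act_distr: "distr M M (act k) = M"
    and act_add: "x \<in> space M \<Longrightarrow> act (k + l) x = act k (act l x)"
    and act_zero: "x \<in> space M \<Longrightarrow> act 0 x = x"
    and small: "A \<in> sets M \<Longrightarrow> e > 0 \<Longrightarrow>
      \<exists>N. open N \<and> 0 \<in> N \<and> (\<forall>n\<in>N. emeasure M (sym_diff (act n -` A \<inter> space M) A) \<le> ennreal e)"
begin

lemma act_space: "x \<in> space M \<Longrightarrow> act k x \<in> space M"
  using act_measurable by (rule measurable_space)

text \<open>Where \<open>s\<close> changes value under the translation, the point lies in the
  symmetric difference belonging to the level set of \<open>s x\<close>, and the change is at most
  twice a bound on the values. Only finitely many level sets occur.\<close>

lemma simple_displacement:
  fixes s :: "'a \<Rightarrow> complex"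
  assumes s: "simple_function M s" and e: "e > 0"
  shows "\<exists>N. open N \<and> 0 \<in> N \<and> (\<forall>n\<in>N. (\<integral>\<^sup>+ x. ennreal ((cmod (s (act n x) - s x))\<^sup>2) \<partial>M) \<le> ennreal e)"
proof -
  define R where "R = s ` space M"
  have fin: "finite R" using s unfolding R_def by (rule simple_functionD)
  define A where "A c = s -` {c} \<inter> space M" for c
  have A: "A c \<in> sets M" for c unfolding A_def using s by (rule simple_functionD)
  define C where "C = (\<Sum>c\<in>R. cmod c)"
  have C: "cmod c \<le> C" if "c \<in> R" for c unfolding C_def using fin that by (intro member_le_sum) auto
  have C0: "C \<ge> 0" unfolding C_def by (intro sum_nonneg) auto
  \<comment> \<open>The sum over the level sets will be at most
    \<open>(2 * C)\<^sup>2 * card R\<close> times \<open>e / D\<close>; the added 1 keeps the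
    divisor positive when \<open>s\<close> vanishes.\<close>
  define D where "D = (2 * C)\<^sup>2 * card R + 1"
  have D: "D > 0" unfolding D_def by (intro add_nonneg_pos mult_nonneg_nonneg) auto
  have "\<exists>N. \<forall>c. open (N c) \<and> 0 \<in> N c \<and> (\<forall>n\<in>N c. emeasure M (sym_diff (act n -` A c \<inter> space M) (A c)) \<le> ennreal (e / D))"
    using small[OF A] e D by (intro choice allI) simp
  then obtain N where N: "\<And>c. open (N c)" "\<And>c. 0 \<in> N c"
    "\<And>c n. n \<in> N c \<Longrightarrow> emeasure M (sym_diff (act n -` A c \<inter> space M) (A c)) \<le> ennreal (e / D)" by metis
  have "(\<integral>\<^sup>+ x. ennreal ((cmod (s (act n x) - s x))\<^sup>2) \<partial>M) \<le> ennreal e" if n: "n \<in> (\<Inter>c\<in>R. N c)" for n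
  proof -
    let ?S = "\<lambda>c. sym_diff (act n -` A c \<inter> space M) (A c)"
    have S: "?S c \<in> sets M" for c using A measurable_sets[OF act_measurable A] by auto
    have "ennreal ((cmod (s (act n x) - s x))\<^sup>2) \<le> (\<Sum>c\<in>R. ennreal ((2 * C)\<^sup>2) * indicator (?S c) x)"
      if x: "x \<in> space M" for x
    proof (cases "s (act n x) = s x")
      case False
      have R: "s x \<in> R" "s (act n x) \<in> R" unfolding R_def using x act_space by auto
      have "x \<in> ?S (s x)" using x False by (auto simp: A_def)
      then have "ennreal ((2 * C)\<^sup>2) = ennreal ((2 * C)\<^sup>2) * indicator (?S (s x)) x" by simp
      also have "\<dots> \<le> (\<Sum>c\<in>R. ennreal ((2 * C)\<^sup>2) * indicator (?S c) x)"
        using fin R(1) by (intro member_le_sum) auto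
      finally have le: "ennreal ((2 * C)\<^sup>2) \<le> (\<Sum>c\<in>R. ennreal ((2 * C)\<^sup>2) * indicator (?S c) x)" .
      have "cmod (s (act n x) - s x) \<le> 2 * C"
        using norm_triangle_ineq4[of "s (act n x)" "s x"] C[OF R(1)] C[OF R(2)] by linarith
      then have "(cmod (s (act n x) - s x))\<^sup>2 \<le> (2 * C)\<^sup>2" by (intro power_mono) auto
      then have "ennreal ((cmod (s (act n x) - s x))\<^sup>2) \<le> ennreal ((2 * C)\<^sup>2)" by (rule ennreal_leI)
      with le show ?thesis by (rule order_trans[rotated])
    qed simp
    then have "(\<integral>\<^sup>+ x. ennreal ((cmod (s (act n x) - s x))\<^sup>2) \<partial>M)
        \<le> (\<integral>\<^sup>+ x. (\<Sum>c\<in>R. ennreal ((2 * C)\<^sup>2) * indicator (?S c) x) \<partial>M)"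
      by (rule nn_integral_mono)
    also have "\<dots> = (\<Sum>c\<in>R. ennreal ((2 * C)\<^sup>2) * emeasure M (?S c))"
      using S by (subst nn_integral_sum) (auto intro!: sum.cong nn_integral_cmult_indicator)
    also have "\<dots> \<le> (\<Sum>c\<in>R. ennreal ((2 * C)\<^sup>2) * ennreal (e / D))"
      using n N(3) by (intro sum_mono mult_left_mono) auto
    also have "\<dots> = ennreal (card R * ((2 * C)\<^sup>2 * (e / D)))"
      by (simp only: sum_constant ennreal_of_nat_eq_real_of_nat ennreal_mult' of_nat_0_le_iff zero_le_power2)
    also have "\<dots> \<le> ennreal e"
    proof (rule ennreal_leI)
      have "card R * ((2 * C)\<^sup>2 * (e / D)) = e * (((2 * C)\<^sup>2 * card R) / D)" by simp
      also have "\<dots> \<le> e * 1" using e D by (intro mult_left_mono) (auto simp: D_def divide_le_eq_1)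
      finally show "card R * ((2 * C)\<^sup>2 * (e / D)) \<le> e" by simp
    qed
    finally show ?thesis .
  qed
  then show ?thesis using N fin by (intro exI[of _ "\<Inter>c\<in>R. N c"]) auto
qed

lemma simple_approximation:
  assumes f: "f \<in> L2_fun M" and e: "e > 0"
  obtains s where "simple_function M s" "(\<integral>\<^sup>+ x. ennreal ((cmod (s x - f x))\<^sup>2) \<partial>M) \<le> ennreal e"
proof -
  have fm [measurable]: "f \<in> borel_measurable M" using f by (rule L2_funD)
  obtain F where F: "\<And>i. simple_function M (F i)" "\<And>x. x \<in> space M \<Longrightarrow> (\<lambda>i. F i x) \<longlonglongrightarrow> f x"
    "\<And>i x. x \<in> space M \<Longrightarrow> dist (F i x) 0 \<le> 2 * dist (f x) 0"
    using borel_measurable_implies_sequence_metric[OF fm, of 0] by blast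
  have [measurable]: "F i \<in> borel_measurable M" for i using F(1) by (rule borel_measurable_simple_function)
  have "(\<lambda>i. \<integral>\<^sup>+ x. ennreal ((cmod (F i x - f x))\<^sup>2) \<partial>M) \<longlonglongrightarrow> (\<integral>\<^sup>+ x. 0 \<partial>M)"
  \<comment> \<open>The approximants are bounded by twice the modulus of \<open>f\<close>, so the
    difference is at most three times it, and 9 is the square of 3.\<close>
  proof (rule nn_integral_dominated_convergence[where w="\<lambda>x. ennreal (9 * (cmod (f x))\<^sup>2)"])
    show "AE x in M. ennreal ((cmod (F i x - f x))\<^sup>2) \<le> ennreal (9 * (cmod (f x))\<^sup>2)" for i
    proof (intro AE_I2 ennreal_leI)
      fix x assume "x \<in> space M"
      then have "cmod (F i x - f x) \<le> 3 * cmod (f x)"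
        using F(3)[of x i] norm_triangle_ineq4[of "F i x" "f x"] by simp
      then have "(cmod (F i x - f x))\<^sup>2 \<le> (3 * cmod (f x))\<^sup>2" by (intro power_mono) auto
      then show "(cmod (F i x - f x))\<^sup>2 \<le> 9 * (cmod (f x))\<^sup>2" by (simp add: power_mult_distrib)
    qed
    have "(\<integral>\<^sup>+ x. ennreal (9 * (cmod (f x))\<^sup>2) \<partial>M) = ennreal (LINT x|M. 9 * (cmod (f x))\<^sup>2)"
      using L2_funD(2)[OF f] by (intro nn_integral_eq_integral) auto
    then show "(\<integral>\<^sup>+ x. ennreal (9 * (cmod (f x))\<^sup>2) \<partial>M) < \<infinity>" by simp
    show "AE x in M. (\<lambda>i. ennreal ((cmod (F i x - f x))\<^sup>2)) \<longlonglongrightarrow> 0"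
    proof (intro AE_I2)
      fix x assume "x \<in> space M"
      then have "(\<lambda>i. ennreal ((cmod (F i x - f x))\<^sup>2)) \<longlonglongrightarrow> ennreal ((cmod (f x - f x))\<^sup>2)"
        using F(2) by (intro tendsto_intros) auto
      then show "(\<lambda>i. ennreal ((cmod (F i x - f x))\<^sup>2)) \<longlonglongrightarrow> 0" by simp
    qed
  qed measurable
  then have "eventually (\<lambda>i. (\<integral>\<^sup>+ x. ennreal ((cmod (F i x - f x))\<^sup>2) \<partial>M) < ennreal e) sequentially"
    using e by (intro order_tendstoD(2)[where y="\<integral>\<^sup>+ x. 0 \<partial>M"]) auto
  then obtain i where "(\<integral>\<^sup>+ x. ennreal ((cmod (F i x - f x))\<^sup>2) \<partial>M) < ennreal e"
    by (auto simp: eventually_sequentially)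
  then show ?thesis using that[OF F(1)[of i]] by simp
qed

text \<open>Applied with \<open>a\<close> and \<open>d\<close> the values of \<open>f\<close> at the
  translated point and at the point, and \<open>b\<close> and \<open>c\<close> those of a simple
  function approximating \<open>f\<close>. The factor 3 comes from squaring a sum of three
  terms.\<close>

lemma square_triangle3: "(cmod (a - d))\<^sup>2 \<le> 3 * ((cmod (b - a))\<^sup>2 + (cmod (b - c))\<^sup>2 + (cmod (c - d))\<^sup>2)"
proof -
  have "cmod (a - d) \<le> cmod (b - a) + cmod (b - c) + cmod (c - d)"
  proof -
    have "a - d = - (b - a) + (b - c) + (c - d)" by simp
    then have "cmod (a - d) \<le> cmod (- (b - a) + (b - c)) + cmod (c - d)" by (metis norm_triangle_ineq)
    also have "cmod (- (b - a) + (b - c)) \<le> cmod (b - a) + cmod (b - c)"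
      using norm_triangle_ineq[of "- (b - a)" "b - c"] by (simp only: norm_minus_cancel)
    finally show ?thesis by simp
  qed
  then have "(cmod (a - d))\<^sup>2 \<le> (cmod (b - a) + cmod (b - c) + cmod (c - d))\<^sup>2" by (intro power_mono) auto
  also have "\<dots> \<le> 3 * ((cmod (b - a))\<^sup>2 + (cmod (b - c))\<^sup>2 + (cmod (c - d))\<^sup>2)"
    using sum_squares_bound[of "cmod (b - a)" "cmod (b - c)"] sum_squares_bound[of "cmod (b - a)" "cmod (c - d)"]
      sum_squares_bound[of "cmod (b - c)" "cmod (c - d)"]
    by (simp add: power2_eq_square algebra_simps)
  finally show ?thesis .
qed

lemma displacement:
  assumes f: "f \<in> L2_fun M" and e: "e > 0"
  shows "\<exists>N. open N \<and> 0 \<in> N \<and> (\<forall>n\<in>N. (LINT x|M. (cmod (f (act n x) - f x))\<^sup>2) \<le> e)"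
proof -
  \<comment> \<open>Three error terms, each bounded by \<open>e / 9\<close>, with the factor 3 of
    \<open>square_triangle3\<close>. The error at the translated point equals the one at the point
    because \<open>act n\<close> preserves the measure.\<close>
  have e9: "e / 9 > 0" using e by simp
  have fm [measurable]: "f \<in> borel_measurable M" using f by (rule L2_funD)
  obtain s where s: "simple_function M s" and sf: "(\<integral>\<^sup>+ x. ennreal ((cmod (s x - f x))\<^sup>2) \<partial>M) \<le> ennreal (e / 9)"
    using simple_approximation[OF f e9] by blast
  have [measurable]: "s \<in> borel_measurable M" using s by (rule borel_measurable_simple_function)
  note [measurable] = act_measurable
  obtain N where N: "open N" "0 \<in> N"
    "\<And>n. n \<in> N \<Longrightarrow> (\<integral>\<^sup>+ x. ennreal ((cmod (s (act n x) - s x))\<^sup>2) \<partial>M) \<le> ennreal (e / 9)"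
    using simple_displacement[OF s e9] by blast
  have "(LINT x|M. (cmod (f (act n x) - f x))\<^sup>2) \<le> e" if n: "n \<in> N" for n
  proof -
    have "(\<integral>\<^sup>+ x. ennreal ((cmod (s (act n x) - f (act n x)))\<^sup>2) \<partial>M)
      = (\<integral>\<^sup>+ y. ennreal ((cmod (s y - f y))\<^sup>2) \<partial>distr M M (act n))"
      by (rule nn_integral_distr[OF act_measurable, symmetric]) measurable
    then have 1: "(\<integral>\<^sup>+ x. ennreal ((cmod (s (act n x) - f (act n x)))\<^sup>2) \<partial>M) \<le> ennreal (e / 9)"
      using sf by (simp add: act_distr)
    have "(\<integral>\<^sup>+ x. ennreal ((cmod (f (act n x) - f x))\<^sup>2) \<partial>M) \<le>
      (\<integral>\<^sup>+ x. 3 * (ennreal ((cmod (s (act n x) - f (act n x)))\<^sup>2) + ennreal ((cmod (s (act n x) - s x))\<^sup>2)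
         + ennreal ((cmod (s x - f x))\<^sup>2)) \<partial>M)"
    proof (rule nn_integral_mono)
      fix x
      have "ennreal ((cmod (f (act n x) - f x))\<^sup>2) \<le> ennreal (3 * ((cmod (s (act n x) - f (act n x)))\<^sup>2
          + (cmod (s (act n x) - s x))\<^sup>2 + (cmod (s x - f x))\<^sup>2))"
        by (intro ennreal_leI square_triangle3)
      then show "ennreal ((cmod (f (act n x) - f x))\<^sup>2) \<le> 3 * (ennreal ((cmod (s (act n x) - f (act n x)))\<^sup>2)
          + ennreal ((cmod (s (act n x) - s x))\<^sup>2) + ennreal ((cmod (s x - f x))\<^sup>2))"
        by (simp add: ennreal_mult ennreal_plus)
    qed
    also have "\<dots> = 3 * ((\<integral>\<^sup>+ x. ennreal ((cmod (s (act n x) - f (act n x)))\<^sup>2) \<partial>M)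
        + (\<integral>\<^sup>+ x. ennreal ((cmod (s (act n x) - s x))\<^sup>2) \<partial>M) + (\<integral>\<^sup>+ x. ennreal ((cmod (s x - f x))\<^sup>2) \<partial>M))"
      by (simp add: nn_integral_cmult nn_integral_add)
    also have "\<dots> \<le> 3 * (ennreal (e / 9) + ennreal (e / 9) + ennreal (e / 9))"
      using 1 N(3)[OF n] sf by (intro mult_left_mono add_mono) auto
    also have "\<dots> = ennreal e"
      using e by (simp add: ennreal_mult'[symmetric] ennreal_numeral[symmetric] del: ennreal_numeral flip: ennreal_plus)
    finally have "(\<integral>\<^sup>+ x. ennreal ((cmod (f (act n x) - f x))\<^sup>2) \<partial>M) \<le> ennreal e" .
    then show ?thesis
      using e by (subst integral_eq_nn_integral) (auto intro!: enn2real_leI)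
  qed
  then show ?thesis using N by blast
qed

lemma koopman_class:
  assumes "f \<in> L2_fun M" shows "koopman act M k (L2_class M f) = L2_class M (f \<circ> act (- k))"
  unfolding koopman_def using act_measurable act_distr assms by (rule L2_pullback_class)

lemma koopman_unitary: "L2_unitary M M (koopman act M k)"
  unfolding koopman_def
proof (rule L2_unitary_pullback[OF act_measurable act_distr act_measurable act_distr])
  show "AE x in M. act k (act (- k) x) = x" "AE x in M. act (- k) (act k x) = x"
    using act_zero by (auto intro!: AE_I2 simp flip: act_add)
qed

lemma koopman_rep: "L2_unitary_rep M (koopman act M)"
  unfolding L2_unitary_rep_def
proof (intro conjI allI ballI)
  show "L2_unitary M M (koopman act M k)" for k by (rule koopman_unitary)
  note comp = L2_fun_comp[OF act_measurable act_distr]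
  fix u assume "u \<in> L2 M"
  then obtain f where f: "f \<in> L2_fun M" "u = L2_class M f" by (rule L2E)
  have [measurable]: "f \<in> borel_measurable M" using f(1) by (rule L2_funD)
  show "koopman act M 0 u = u"
    unfolding f(2) koopman_class[OF f(1)] using act_zero f(1) comp[OF f(1)]
    by (intro L2_class_eqI) auto
  show "koopman act M (k + l) u = koopman act M k (koopman act M l u)" for k l
    unfolding f(2) koopman_class[OF f(1)] koopman_class[OF comp[OF f(1)]] using comp f(1)
    by (intro L2_class_eqI AE_I2) (auto simp: minus_add act_add simp del: add_uminus_conv_diff)
  fix k
  \<comment> \<open>Substituting \<open>act k x\<close> for \<open>x\<close> reduces continuity at
    \<open>k\<close> to the displacement of \<open>f\<close> by \<open>- l + k\<close>, which is
    near the identity when \<open>l\<close> is near \<open>k\<close>.\<close>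
  have dist: "L2_dist M (koopman act M l u) (koopman act M k u) = sqrt (LINT x|M. (cmod (f (act (- l + k) x) - f x))\<^sup>2)" for l
  proof -
    note [measurable] = act_measurable
    have "(LINT x|M. (cmod (f (act (- l) x) - f (act (- k) x)))\<^sup>2)
      = (LINT x|distr M M (act k). (cmod (f (act (- l) x) - f (act (- k) x)))\<^sup>2)" by (simp add: act_distr)
    also have "\<dots> = (LINT x|M. (cmod (f (act (- l) (act k x)) - f (act (- k) (act k x))))\<^sup>2)"
      by (rule integral_distr[OF act_measurable]) measurable
    also have "\<dots> = (LINT x|M. (cmod (f (act (- l + k) x) - f x))\<^sup>2)"
      by (intro Bochner_Integration.integral_cong) (simp_all add: act_zero flip: act_add)
    finally show ?thesis
      unfolding f(2) koopman_class[OF f(1)] using L2_dist_class[OF comp[OF f(1)] comp[OF f(1)]] by simp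
  qed
  show "((\<lambda>l. L2_dist M (koopman act M l u) (koopman act M k u)) \<longlongrightarrow> 0) (at k)"
  proof (rule tendstoI)
    fix e :: real assume e: "e > 0"
    \<comment> \<open>Squared because \<open>L2_dist\<close> is a square root, and halved because
      \<open>displacement\<close> gives a weak inequality where a strict one is wanted.\<close>
    then have "(e / 2)\<^sup>2 > 0" by simp
    then obtain N where N: "open N" "0 \<in> N" "\<And>n. n \<in> N \<Longrightarrow> (LINT x|M. (cmod (f (act n x) - f x))\<^sup>2) \<le> (e / 2)\<^sup>2"
      using displacement[OF f(1)] by metis
    have "open ((\<lambda>l. - l + k) -` N)" using N(1) by (intro open_vimage continuous_intros)
    moreover have "k \<in> (\<lambda>l. - l + k) -` N" using N(2) by simp
    ultimately have "eventually (\<lambda>l. l \<in> (\<lambda>l. - l + k) -` N) (at k)"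
      by (rule topological_tendstoD[OF tendsto_ident_at])
    then show "eventually (\<lambda>l. dist (L2_dist M (koopman act M l u) (koopman act M k u)) 0 < e) (at k)"
    proof eventually_elim
      case (elim l)
      then have "sqrt (LINT x|M. (cmod (f (act (- l + k) x) - f x))\<^sup>2) \<le> e / 2"
        using N(3)[of "- l + k"] e by (intro real_le_lsqrt) auto
      then show ?case using e unfolding dist by (simp add: dist_real_def)
    qed
  qed
qed

end

subsection \<open>The invariant measure on the punctured hull\<close>

context model_hull
begin

abbreviation "X \<equiv> borel_of (punctured_hull_topology P)"

lemma space_X: "space X = phull"
  by (simp add: topspace_hull)

lemma beta_measurable_mY: "\<beta> \<in> measurable X mY"
  unfolding measurable_cong_sets[OF refl sets_mY] by (rule beta_measurable)

lemma translate_hull: assumes Q: "Q \<in> phull" shows "k +o Q \<in> phull"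
proof (rule hullI)
  have "k +o Q \<in> topspace chabauty_fell"
    using continuous_map_image_subset_topspace[OF continuous_map_chabauty_translate[of k]] hull_closed[OF Q]
    by (auto simp: chabauty_fell_topspace)
  then show "closed (k +o Q)" by (simp add: chabauty_fell_topspace)
  show "k +o Q \<noteq> {}" using hull_nonempty[OF Q] by (auto simp: elt_set_plus_def)
  fix S assume S: "openin chabauty_fell S" "k +o Q \<in> S"
  have "openin chabauty_fell {C \<in> topspace chabauty_fell. k +o C \<in> S}"
    using continuous_map_chabauty_translate S(1) by (rule openin_continuous_map_preimage)
  moreover have "Q \<in> {C \<in> topspace chabauty_fell. k +o C \<in> S}"
    using S(2) hull_closed[OF Q] by (simp add: chabauty_fell_topspace)
  ultimately obtain g where "k +o (g +o P) \<in> S" using hull_approx[OF Q] by blast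
  then have "(k + g) +o P \<in> S" by (simp add: set_plus_rearrange2)
  then show "\<exists>g. g +o P \<in> S" by blast
qed

lemma translate_measurable: "(+o) k \<in> measurable X X"
proof (rule measurable_borel_ofI)
  show "(+o) k \<in> space X \<rightarrow> topspace (punctured_hull_topology P)"
    unfolding space_X topspace_hull using translate_hull by blast
  fix U assume "openin (punctured_hull_topology P) U"
  then obtain S where S: "openin chabauty_fell S" "U = S \<inter> phull"
    unfolding punctured_hull_topology_def openin_subtopology by blast
  have "openin chabauty_fell {C \<in> topspace chabauty_fell. k +o C \<in> S}"
    using continuous_map_chabauty_translate S(1) by (rule openin_continuous_map_preimage)
  then have "openin (punctured_hull_topology P) ({C \<in> topspace chabauty_fell. k +o C \<in> S} \<inter> phull)"
    unfolding punctured_hull_topology_def openin_subtopology by blast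
  moreover have "(+o) k -` U \<inter> space X = {C \<in> topspace chabauty_fell. k +o C \<in> S} \<inter> phull"
    unfolding space_X S(2) using translate_hull hull_closed by (auto simp: chabauty_fell_topspace)
  ultimately show "(+o) k -` U \<inter> space X \<in> sets X" by (simp add: openin_sets_borel_of)
qed

section \<open>The measurable section of the parametrization map\<close>

definition nonsing :: "('g \<times> 'h) set set" where
  "nonsing = \<Y> - singular"

lemma nonsing_sets: "nonsing \<in> sets mY"
  unfolding nonsing_def space_mY[symmetric] using singular_sets by (rule sets.compl_sets)

lemma AE_nonsing: "AE y in mY. y \<in> nonsing"
proof -
  have "AE y in mY. y \<notin> singular"
    using emeasure_singular singular_sets by (intro AE_not_in) (auto simp: null_sets_def)
  then show ?thesis using AE_space by eventually_elim (simp add: nonsing_def space_mY)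
qed

text \<open>The first factor leaves the second coordinates of the points of a coset
  unchanged.\<close>

lemma nonsing_act: "y \<in> nonsing \<Longrightarrow> param_act g y \<in> nonsing"
  unfolding nonsing_def singular_def using param_act_coset[of y g]
  by (auto simp: param_act_def bex_translate_iff)

text \<open>The value on the null set of singular cosets is arbitrary.\<close>

definition section_map :: "('g \<times> 'h) set \<Rightarrow> 'g set" where
  "section_map y = (if y \<in> nonsing then window_points y else P)"

lemma section_map_hull: "section_map y \<in> phull"
  using window_points_hull(1)[of y] orbit_hull[of 0]
  by (auto simp: section_map_def nonsing_def elt_set_plus_def)

lemma beta_section_map: "y \<in> nonsing \<Longrightarrow> \<beta> (section_map y) = y"
  using window_points_hull(2)[of y] by (simp add: section_map_def nonsing_def)

lemma section_map_beta: "Q \<in> phull \<Longrightarrow> \<beta> Q \<in> nonsing \<Longrightarrow> section_map (\<beta> Q) = Q"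
  using beta_inverse[of Q] by (simp add: section_map_def nonsing_def)

text \<open>Continuity is known only at nonsingular cosets, so a preimage need not be open. On the
  nonsingular cosets it coincides with \<open>O'\<close>, the largest open set on which
  \<open>window_points\<close> takes values in \<open>S\<close>; the remainder is all or none of the
  singular set.\<close>

lemma section_map_measurable: "section_map \<in> measurable mY X"
proof (rule measurable_borel_ofI)
  show "section_map \<in> space mY \<rightarrow> topspace (punctured_hull_topology P)"
    using section_map_hull by (simp add: topspace_hull)
  fix U assume U: "openin (punctured_hull_topology P) U"
  then obtain S where S: "openin chabauty_fell S" "U = S \<inter> phull"
    unfolding punctured_hull_topology_def openin_subtopology by blast
  define O' where "O' = \<Union>{B. openin \<T> B \<and> (\<forall>z\<in>B. window_points z \<in> S)}"
  have O': "O' \<in> sets mY"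
    unfolding O'_def sets_mY by (intro openin_sets_borel_of openin_Union) auto
  have eq: "window_points y \<in> S \<longleftrightarrow> y \<in> O'" if y: "y \<in> nonsing" for y
  proof
    assume "window_points y \<in> S"
    then obtain B where "openin \<T> B" "y \<in> B" "\<forall>z\<in>B. window_points z \<in> S"
      using window_points_continuous[OF _ _ S(1), of y] y by (auto simp: nonsing_def)
    then show "y \<in> O'" unfolding O'_def by (intro UnionI[of B]) auto
  qed (auto simp: O'_def)
  have "section_map -` U \<inter> space mY = O' \<inter> nonsing \<union> (if P \<in> U then singular else {})"
  proof (rule set_eqI)
    fix y
    show "y \<in> section_map -` U \<inter> space mY \<longleftrightarrow> y \<in> O' \<inter> nonsing \<union> (if P \<in> U then singular else {})"
    proof (cases "y \<in> nonsing")
      case True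
      then have "y \<in> \<Y>" "y \<notin> singular" by (auto simp: nonsing_def)
      then show ?thesis
        using True eq[OF True] section_map_hull[of y] by (simp add: section_map_def S(2) space_mY)
    next
      case False
      then have "y \<in> space mY \<longleftrightarrow> y \<in> singular" by (auto simp: nonsing_def space_mY singular_def)
      then show ?thesis using False by (simp add: section_map_def)
    qed
  qed
  then show "section_map -` U \<inter> space mY \<in> sets mY"
    using O' nonsing_sets singular_sets by simp
qed

section \<open>Transfer of measures between the coset space and the punctured hull\<close>

definition \<nu> :: "'g set measure" where
  "\<nu> = distr mY X section_map"

lemma nu_prob: "prob_measure_on (punctured_hull_topology P) \<nu>"
  unfolding prob_measure_on_def \<nu>_def using section_map_measurable Y.prob_space_distr by simp

lemma push_prob:
  assumes "prob_measure_on (punctured_hull_topology P) \<nu>'"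
  shows "prob_measure_on \<T> (distr \<nu>' mY \<beta>)" "\<beta> \<in> measurable \<nu>' mY"
proof -
  have s: "sets \<nu>' = sets X" and p: "prob_space \<nu>'" using assms by (auto simp: prob_measure_on_def)
  show b: "\<beta> \<in> measurable \<nu>' mY"
    unfolding measurable_cong_sets[OF s refl] by (rule beta_measurable_mY)
  show "prob_measure_on \<T> (distr \<nu>' mY \<beta>)"
    using prob_space.prob_space_distr[OF p b] by (simp add: prob_measure_on_def sets_mY)
qed

lemma push_nu: "distr \<nu> mY \<beta> = mY"
proof -
  have "distr \<nu> mY \<beta> = distr mY mY (\<beta> \<circ> section_map)"
    unfolding \<nu>_def by (rule distr_distr[OF beta_measurable_mY section_map_measurable])
  also have "\<dots> = distr mY mY (\<lambda>y. y)"
  proof (rule distr_cong_AE)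
    show "AE y in mY. (\<beta> \<circ> section_map) y = y"
      using AE_nonsing by eventually_elim (simp add: beta_section_map)
  qed (simp_all add: measurable_comp[OF section_map_measurable beta_measurable_mY])
  also have "\<dots> = mY" by (rule distr_id)
  finally show ?thesis .
qed

text \<open>Since the image under \<open>\<beta>\<close> is \<open>mY\<close>, almost every point
  for \<open>\<nu>'\<close> has a nonsingular image and is recovered from it by
  \<open>section_map\<close>. Hence \<open>\<nu>'\<close> is the image of \<open>mY\<close> under
  the section. All identifications of measures on the hull go through this lemma.\<close>

lemma eq_nuI:
  assumes p: "prob_measure_on (punctured_hull_topology P) \<nu>'" and push: "distr \<nu>' mY \<beta> = mY"
  shows "\<nu>' = \<nu>"
proof -
  have s: "sets \<nu>' = sets X" using p by (auto simp: prob_measure_on_def)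
  have sp: "space \<nu>' = phull" using sets_eq_imp_space_eq[OF s] space_X by simp
  note b = push_prob(2)[OF p]
  have "AE y in distr \<nu>' mY \<beta>. y \<in> nonsing" unfolding push by (rule AE_nonsing)
  then have "AE Q in \<nu>'. \<beta> Q \<in> nonsing" by (rule AE_distrD[OF b])
  then have ae: "AE Q in \<nu>'. section_map (\<beta> Q) = Q"
    using AE_space by eventually_elim (simp add: section_map_beta sp)
  have "\<nu> = distr (distr \<nu>' mY \<beta>) X section_map" unfolding \<nu>_def push ..
  also have "\<dots> = distr \<nu>' X (section_map \<circ> \<beta>)"
    by (rule distr_distr[OF section_map_measurable b])
  also have "\<dots> = distr \<nu>' X (\<lambda>Q. Q)"
    using ae measurable_comp[OF b section_map_measurable] s
    by (intro distr_cong_AE) (auto intro: measurable_ident_sets)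
  also have "\<dots> = \<nu>'" by (rule distr_id2[OF s[symmetric]])
  finally show ?thesis by simp
qed

lemma translate_measurable':
  assumes "sets \<nu>' = sets X" shows "(+o) k \<in> measurable \<nu>' \<nu>'"
  unfolding measurable_cong_sets[OF assms assms] by (rule translate_measurable)

lemma push_translate:
  assumes p: "prob_measure_on (punctured_hull_topology P) \<nu>'"
  shows "distr (distr \<nu>' mY \<beta>) (distr \<nu>' mY \<beta>) (param_act k) = distr (distr \<nu>' \<nu>' ((+o) k)) mY \<beta>"
proof -
  have s: "sets \<nu>' = sets X" using p by (auto simp: prob_measure_on_def)
  have sp: "space \<nu>' = phull" using sets_eq_imp_space_eq[OF s] space_X by simp
  note b = push_prob(2)[OF p]
  have pm: "param_act k \<in> measurable mY mY" unfolding param_act_def[abs_def] by measurable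
  have "distr (distr \<nu>' mY \<beta>) (distr \<nu>' mY \<beta>) (param_act k) = distr (distr \<nu>' mY \<beta>) mY (param_act k)"
    by (rule distr_cong) simp_all
  also have "\<dots> = distr \<nu>' mY (param_act k \<circ> \<beta>)" by (rule distr_distr[OF pm b])
  also have "\<dots> = distr \<nu>' mY (\<beta> \<circ> (+o) k)"
    by (rule distr_cong) (simp_all add: sp beta_equivariant)
  also have "\<dots> = distr (distr \<nu>' \<nu>' ((+o) k)) mY \<beta>"
    by (rule distr_distr[OF b translate_measurable'[OF s], symmetric])
  finally show ?thesis .
qed

lemma push_stationary:
  assumes p: "prob_measure_on (punctured_hull_topology P) \<nu>'" and st: "stationary_measure (+o) \<mu> \<nu>'"
  shows "stationary_measure param_act \<mu> (distr \<nu>' mY \<beta>)"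
  unfolding stationary_measure_def
proof
  have s: "sets \<nu>' = sets X" using p by (auto simp: prob_measure_on_def)
  note b = push_prob(2)[OF p]
  fix B assume "B \<in> sets (distr \<nu>' mY \<beta>)"
  then have B: "B \<in> sets mY" by simp
  let ?A = "\<beta> -` B \<inter> space \<nu>'"
  have A: "?A \<in> sets \<nu>'" using b B by (rule measurable_sets)
  have b': "\<beta> \<in> measurable (distr \<nu>' \<nu>' ((+o) g)) mY" for g using b by simp
  have "emeasure (distr (distr \<nu>' mY \<beta>) (distr \<nu>' mY \<beta>) (param_act g)) B = emeasure (distr \<nu>' \<nu>' ((+o) g)) ?A" for g
    unfolding push_translate[OF p] using emeasure_distr[OF b' B] by simp
  then show "(\<integral>\<^sup>+ g. emeasure (distr (distr \<nu>' mY \<beta>) (distr \<nu>' mY \<beta>) (param_act g)) B \<partial>\<mu>) = emeasure (distr \<nu>' mY \<beta>) B"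
    using st A emeasure_distr[OF b B] unfolding stationary_measure_def by simp
qed

lemma invariant_stationary:
  assumes "invariant_measure act \<eta>" "prob_space \<mu>" shows "stationary_measure act \<mu> \<eta>"
  using assms prob_space.emeasure_space_1[OF assms(2)]
  by (simp add: invariant_measure_def stationary_measure_def)

text \<open>By equivariance of \<open>\<beta>\<close>, a translate of \<open>\<nu>\<close> is still
  pushed to \<open>mY\<close>, and \<open>eq_nuI\<close> identifies it with
  \<open>\<nu>\<close>.\<close>

lemma nu_invariant: "invariant_measure (+o) \<nu>"
  unfolding invariant_measure_def
proof
  fix k
  have s: "sets \<nu> = sets X" using nu_prob by (auto simp: prob_measure_on_def)
  have "prob_space (distr \<nu> \<nu> ((+o) k))"
    using nu_prob translate_measurable'[OF s] by (auto simp: prob_measure_on_def intro: prob_space.prob_space_distr)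
  then have p: "prob_measure_on (punctured_hull_topology P) (distr \<nu> \<nu> ((+o) k))"
    using s by (simp add: prob_measure_on_def)
  have "distr (distr \<nu> \<nu> ((+o) k)) mY \<beta> = distr mY mY (param_act k)"
    using push_translate[OF nu_prob, of k] by (simp add: push_nu)
  also have "\<dots> = mY" using invY unfolding invariant_measure_def param_act_def[abs_def] by blast
  finally show "distr \<nu> \<nu> ((+o) k) = \<nu>" by (rule eq_nuI[OF p])
qed

lemma nu_unique_stationary:
  assumes \<mu>: "admissible mG \<mu>" and p: "prob_measure_on (punctured_hull_topology P) \<nu>'" and st: "stationary_measure (+o) \<mu> \<nu>'"
  shows "\<nu>' = \<nu>"
  using stationary_unique[OF \<mu> push_prob(1)[OF p] push_stationary[OF p st]] by (rule eq_nuI[OF p])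

text \<open>An invariant measure is stationary for every probability measure on the group, so any
  one admissible choice reduces this to unique stationarity.\<close>

lemma nu_unique_invariant:
  assumes p: "prob_measure_on (punctured_hull_topology P) \<nu>'" and inv: "invariant_measure (+o) \<nu>'"
  shows "\<nu>' = \<nu>"
proof -
  obtain \<mu> where \<mu>: "admissible mG \<mu>" using ex_admissible by blast
  then have "prob_space \<mu>" by (simp add: admissible_def)
  with inv have "stationary_measure (+o) \<mu> \<nu>'" by (rule invariant_stationary)
  then show ?thesis by (rule nu_unique_stationary[OF \<mu> p])
qed

lemma sets_nu: "sets \<nu> = sets X" and space_nu: "space \<nu> = phull"
  by (simp_all add: \<nu>_def topspace_hull)

lemma beta_mp: "\<beta> \<in> measurable \<nu> mY" "distr \<nu> mY \<beta> = mY"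
  using push_prob(2)[OF nu_prob] push_nu by auto

lemma section_mp: "section_map \<in> measurable mY \<nu>" "distr mY \<nu> section_map = \<nu>"
proof -
  show "section_map \<in> measurable mY \<nu>"
    unfolding measurable_cong_sets[OF refl sets_nu] by (rule section_map_measurable)
  have "distr mY \<nu> section_map = distr mY X section_map" by (rule distr_cong) (simp_all add: sets_nu)
  then show "distr mY \<nu> section_map = \<nu>" by (simp add: \<nu>_def)
qed

lemma AE_beta_nonsing: "AE Q in \<nu>. \<beta> Q \<in> nonsing"
  using AE_comp[OF beta_mp AE_nonsing] .

lemma nonsingular_hull_eq: "nonsingular_hull \<Gamma> W P \<beta> = \<beta> -` nonsing \<inter> space \<nu>"
  unfolding nonsingular_hull_def nonsingular_eq nonsing_def[symmetric] by (auto simp: space_nu)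

lemma nonsingular_hull_sets: "nonsingular_hull \<Gamma> W P \<beta> \<in> sets \<nu>"
  unfolding nonsingular_hull_eq using beta_mp(1) nonsing_sets by (rule measurable_sets)

lemma emeasure_nonsingular_hull: "emeasure \<nu> (nonsingular_hull \<Gamma> W P \<beta>) = 1"
proof -
  interpret nu: prob_space \<nu> using nu_prob by (simp add: prob_measure_on_def)
  have "AE Q in \<nu>. Q \<in> nonsingular_hull \<Gamma> W P \<beta>"
    using AE_beta_nonsing AE_space by eventually_elim (simp add: nonsingular_hull_eq)
  then show ?thesis by (rule nu.emeasure_eq_1_AE[OF nonsingular_hull_sets])
qed

lemma isomorphism: "measurable_isomorphism (+o) param_act \<nu> mY \<beta>"
  unfolding measurable_isomorphism_def
proof (intro conjI allI ballI)
  let ?A = "nonsingular_hull \<Gamma> W P \<beta>"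
  show "\<beta> \<in> measurable \<nu> mY" "distr \<nu> mY \<beta> = mY" by (rule beta_mp)+
  show "\<beta> (k +o Q) = param_act k (\<beta> Q)" if "Q \<in> space \<nu>" for k Q
    using beta_equivariant \<open>Q \<in> space \<nu>\<close> by (simp add: space_nu)
  have mem: "Q \<in> ?A \<longleftrightarrow> Q \<in> phull \<and> \<beta> Q \<in> nonsing" for Q by (auto simp: nonsingular_hull_eq space_nu)
  have subA: "k +o Q \<in> ?A" if "Q \<in> ?A" for k Q
    using that translate_hull beta_equivariant nonsing_act by (simp add: mem)
  have invA: "(+o) k ` ?A = ?A" for k
  proof (intro equalityI subsetI)
    fix Q assume "Q \<in> ?A"
    then have "- k +o Q \<in> ?A" by (rule subA)
    moreover have "k +o (- k +o Q) = Q" by (auto simp: mem_translate_iff)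
    ultimately show "Q \<in> (+o) k ` ?A" by (metis imageI)
  qed (use subA in auto)
  have invB: "param_act k ` nonsing = nonsing" for k
  proof (intro equalityI subsetI)
    fix y assume "y \<in> nonsing"
    then have "param_act (- k) y \<in> nonsing" by (rule nonsing_act)
    moreover have "param_act k (param_act (- k) y) = y" by (simp add: param_act_def set_plus_rearrange2 flip: zero_prod_def)
    ultimately show "y \<in> param_act k ` nonsing" by (metis imageI)
  qed (use nonsing_act in auto)
  have bij: "bij_betw \<beta> ?A nonsing"
    by (rule bij_betw_byWitness[where f'=section_map])
      (auto simp: mem section_map_beta beta_section_map section_map_hull)
  \<comment> \<open>The inverse in the definition of an isomorphism is obtained by choice; on the
    nonsingular cosets it agrees with \<open>section_map\<close>, whose measurability is
    known.\<close>
  have inv_eq: "inv_into ?A \<beta> y = section_map y" if "y \<in> nonsing" for y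
    using bij_betw_imp_inj_on[OF bij] that
    by (intro inv_into_f_eq) (auto simp: mem section_map_hull beta_section_map)
  have "section_map \<in> measurable (restrict_space mY nonsing) (restrict_space \<nu> ?A)"
    by (rule measurable_restrict_space3[OF section_mp(1)])
      (auto simp: mem section_map_hull beta_section_map)
  then have "inv_into ?A \<beta> \<in> measurable (restrict_space mY nonsing) (restrict_space \<nu> ?A)"
    by (subst measurable_cong[where g=section_map]) (auto simp: inv_eq space_restrict_space)
  moreover have "AE Q in \<nu>. Q \<in> ?A"
    using AE_beta_nonsing AE_space by eventually_elim (simp add: nonsingular_hull_eq)
  ultimately show "\<exists>A\<in>sets \<nu>. \<exists>B\<in>sets mY. (AE x in \<nu>. x \<in> A) \<and> (AE y in mY. y \<in> B) \<and>
        (\<forall>k. (+o) k ` A = A) \<and> (\<forall>k. param_act k ` B = B) \<and> bij_betw \<beta> A B \<and>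
        inv_into A \<beta> \<in> measurable (restrict_space mY B) (restrict_space \<nu> A)"
    using nonsingular_hull_sets nonsing_sets AE_nonsing invA invB bij by blast
qed

section \<open>Strong continuity on both spaces and the induced isomorphism of
  representations\<close>

lemma param_measurable: "param_act k \<in> measurable mY mY"
  unfolding param_act_def[abs_def] by measurable

lemma param_distr: "distr mY mY (param_act k) = mY"
  using invY unfolding invariant_measure_def param_act_def[abs_def] by blast

sublocale Yact: small_translation_action mY param_act
proof
  show "param_act k \<in> measurable mY mY" "distr mY mY (param_act k) = mY" for k
    by (rule param_measurable param_distr)+
  show "param_act (k + l) x = param_act k (param_act l x)" for k l and x :: "('g \<times> 'h) set"
    by (simp add: param_act_def set_plus_rearrange2)
  show "param_act 0 x = x" for x :: "('g \<times> 'h) set"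
    by (simp add: param_act_def flip: zero_prod_def)
  show "\<exists>N. open N \<and> 0 \<in> N \<and> (\<forall>n\<in>N. emeasure mY (sym_diff (param_act n -` A \<inter> space mY) A) \<le> ennreal e)"
    if "A \<in> sets mY" "e > 0" for A e
    using small_sym_diff[OF \<open>A \<in> sets mY\<close> \<open>e > 0\<close>] by metis
qed

sublocale nu: prob_space \<nu>
  using nu_prob by (simp add: prob_measure_on_def)

sublocale nuact: small_translation_action \<nu> "(+o)"
proof
  show tm: "(+o) k \<in> measurable \<nu> \<nu>" for k by (rule translate_measurable'[OF sets_nu])
  show "distr \<nu> \<nu> ((+o) k) = \<nu>" for k using nu_invariant by (simp add: invariant_measure_def)
  show "(k + l) +o x = k +o (l +o x)" for k l and x :: "'g set" by (simp add: set_plus_rearrange2)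
  show "0 +o x = x" for x :: "'g set" by (auto simp: mem_translate_iff)
  show "\<exists>N. open N \<and> 0 \<in> N \<and> (\<forall>n\<in>N. emeasure \<nu> (sym_diff ((+o) n -` A \<inter> space \<nu>) A) \<le> ennreal e)"
    if A: "A \<in> sets \<nu>" and e: "e > 0" for A e
  proof -
    \<comment> \<open>Up to a null set \<open>A\<close> is the preimage of \<open>B\<close> under
      the equivariant, measure preserving \<open>\<beta>\<close>. The symmetric differences of
      \<open>A\<close> and of \<open>B\<close> with their translates thus have equal measure, and
      the estimate on the coset space carries over.\<close>
    define B where "B = section_map -` A \<inter> space mY"
    have B: "B \<in> sets mY" unfolding B_def using section_mp(1) A by (rule measurable_sets)
    obtain N where N: "open N" "0 \<in> N"
      "\<And>n. n \<in> N \<Longrightarrow> emeasure mY (sym_diff (param_act n -` B \<inter> space mY) B) \<le> ennreal e"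
      using small_sym_diff[OF B e] by blast
    have "emeasure \<nu> (sym_diff ((+o) n -` A \<inter> space \<nu>) A) = emeasure mY (sym_diff (param_act n -` B \<inter> space mY) B)" for n
    proof -
      let ?D = "sym_diff (param_act n -` B \<inter> space mY) B"
      have D: "?D \<in> sets mY" using measurable_sets[OF param_measurable B] B by auto
      have "emeasure mY ?D = emeasure \<nu> (\<beta> -` ?D \<inter> space \<nu>)"
        using emeasure_distr[OF beta_mp(1) D] by (simp add: beta_mp(2))
      also have "\<dots> = emeasure \<nu> (sym_diff ((+o) n -` A \<inter> space \<nu>) A)"
      proof (rule emeasure_eq_AE)
        show "AE Q in \<nu>. Q \<in> \<beta> -` ?D \<inter> space \<nu> \<longleftrightarrow> Q \<in> sym_diff ((+o) n -` A \<inter> space \<nu>) A"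
          using AE_beta_nonsing AE_space
        proof eventually_elim
          case (elim Q)
          then have Q: "Q \<in> phull" "\<beta> Q \<in> nonsing" by (auto simp: space_nu)
          have n: "n +o Q \<in> phull" "\<beta> (n +o Q) \<in> nonsing"
            using Q translate_hull nonsing_act beta_equivariant by auto
          have "\<beta> Q \<in> B \<longleftrightarrow> Q \<in> A"
            using Q beta_coset by (simp add: B_def space_mY section_map_beta)
          moreover have "param_act n (\<beta> Q) \<in> B \<longleftrightarrow> n +o Q \<in> A"
            using n Q beta_coset[OF n(1)] section_map_beta[OF n] by (simp add: B_def space_mY beta_equivariant)
          ultimately show ?case using Q beta_coset by (simp add: space_nu space_mY)
        qed
        show "\<beta> -` ?D \<inter> space \<nu> \<in> sets \<nu>" using beta_mp(1) D by (rule measurable_sets)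
        show "sym_diff ((+o) n -` A \<inter> space \<nu>) A \<in> sets \<nu>" using measurable_sets[OF tm A] A by auto
      qed
      finally show ?thesis by simp
    qed
    then show ?thesis using N by auto
  qed
qed

lemma representation_isomorphism:
  "unitary_rep_isomorphism mY (koopman param_act mY) \<nu> (koopman (+o) \<nu>) (L2_pullback \<nu> \<beta>)"
  unfolding unitary_rep_isomorphism_def
proof (intro conjI allI ballI)
  show "L2_unitary_rep mY (koopman param_act mY)" by (rule Yact.koopman_rep)
  show "L2_unitary_rep \<nu> (koopman (+o) \<nu>)" by (rule nuact.koopman_rep)
  show "L2_unitary mY \<nu> (L2_pullback \<nu> \<beta>)"
  proof (rule L2_unitary_pullback[OF beta_mp section_mp])
    show "AE Q in \<nu>. section_map (\<beta> Q) = Q"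
      using AE_beta_nonsing AE_space by eventually_elim (simp add: space_nu section_map_beta)
    show "AE y in mY. \<beta> (section_map y) = y"
      using AE_nonsing by eventually_elim (rule beta_section_map)
  qed
  fix k u assume "u \<in> L2 mY"
  then obtain f where f: "f \<in> L2_fun mY" "u = L2_class mY f" by (rule L2E)
  have fb: "f \<circ> \<beta> \<in> L2_fun \<nu>" by (rule L2_fun_comp[OF beta_mp f(1)])
  have fk: "f \<circ> param_act (- k) \<in> L2_fun mY" by (rule L2_fun_comp[OF param_measurable param_distr f(1)])
  have "L2_class \<nu> (f \<circ> param_act (- k) \<circ> \<beta>) = L2_class \<nu> (f \<circ> \<beta> \<circ> (+o) (- k))"
  proof (rule L2_class_eqI)
    show "f \<circ> param_act (- k) \<circ> \<beta> \<in> L2_fun \<nu>" by (rule L2_fun_comp[OF beta_mp fk])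
    show "f \<circ> \<beta> \<circ> (+o) (- k) \<in> L2_fun \<nu>"
      by (rule L2_fun_comp[OF nuact.act_measurable nuact.act_distr fb])
    show "AE Q in \<nu>. (f \<circ> param_act (- k) \<circ> \<beta>) Q = (f \<circ> \<beta> \<circ> (+o) (- k)) Q"
      by (intro AE_I2) (simp add: space_nu beta_equivariant)
  qed
  then show "L2_pullback \<nu> \<beta> (koopman param_act mY k u) = koopman (+o) \<nu> k (L2_pullback \<nu> \<beta> u)"
    unfolding f(2) Yact.koopman_class[OF f(1)] L2_pullback_class[OF beta_mp f(1)]
      L2_pullback_class[OF beta_mp fk] nuact.koopman_class[OF fb] .
qed

end

theorem theorem3p4:
  fixes \<Gamma> :: "('g::{topological_group_add,t2_space,second_countable_topology}
                \<times> 'h::{topological_group_add,t2_space,second_countable_topology}) set"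
    and mG :: "'g measure" and mH :: "'h measure"
    and W\<^sub>0 :: "'h set" and P\<^sub>0 :: "'g set"
    and mY :: "('g \<times> 'h) set measure"
    and \<beta> :: "'g set \<Rightarrow> ('g \<times> 'h) set"
  assumes "locally_compact_space (euclidean :: 'g topology)"
    and "locally_compact_space (euclidean :: 'h topology)"
    and "haar_measure mG" and "haar_measure mH"
    and "cut_and_project_scheme \<Gamma>"
    and "regular_window mH \<Gamma> W\<^sub>0"
    and "P\<^sub>0 = model_set \<Gamma> W\<^sub>0"
    and "prob_measure_on (coset_topology \<Gamma>) mY" and "invariant_measure (+o) mY"
    and "parametrization_map \<Gamma> P\<^sub>0 \<beta>"
  shows "\<exists>\<nu>.
      (\<forall>\<nu>'. prob_measure_on (punctured_hull_topology P\<^sub>0) \<nu>' \<and>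
             invariant_measure (+o) \<nu>' \<longleftrightarrow> \<nu>' = \<nu>) \<and>
      emeasure \<nu> (nonsingular_hull \<Gamma> W\<^sub>0 P\<^sub>0 \<beta>) = 1 \<and>
      (\<forall>\<mu>. admissible mG \<mu> \<longrightarrow>
        (\<forall>\<nu>'. prob_measure_on (punctured_hull_topology P\<^sub>0) \<nu>' \<and>
               stationary_measure (+o) \<mu> \<nu>' \<longleftrightarrow> \<nu>' = \<nu>)) \<and>
      measurable_isomorphism (+o) param_act \<nu> mY \<beta> \<and>
      unitary_rep_isomorphism mY (koopman param_act mY) \<nu> (koopman (+o) \<nu>) (L2_pullback \<nu> \<beta>)"
proof -
  interpret model_hull \<Gamma> mG mH mY W\<^sub>0 P\<^sub>0 \<beta>
    using assms by unfold_locales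
  have stat: "stationary_measure (+o) \<mu> \<nu>" if "admissible mG \<mu>" for \<mu>
    using nu_invariant that by (intro invariant_stationary) (simp_all add: admissible_def)
  show ?thesis
  proof (intro exI[of _ \<nu>] conjI allI impI)
    show "prob_measure_on (punctured_hull_topology P\<^sub>0) \<nu>' \<and> invariant_measure (+o) \<nu>' \<longleftrightarrow> \<nu>' = \<nu>" for \<nu>'
      using nu_prob nu_invariant nu_unique_invariant by blast
    show "prob_measure_on (punctured_hull_topology P\<^sub>0) \<nu>' \<and> stationary_measure (+o) \<mu> \<nu>' \<longleftrightarrow> \<nu>' = \<nu>"
      if "admissible mG \<mu>" for \<mu> \<nu>'
      using nu_prob stat[OF that] nu_unique_stationary[OF that] by blast
  qed (rule emeasure_nonsingular_hull isomorphism representation_isomorphism)+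
qed

end
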